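(* Let $n$ be any positive integer (the spatial dimension), let $2\le q<\infty$ and $b=\frac n2-\frac1q$. Then there is a constant $C<\infty$ such that $$\|e^{itD}f(x)\|_{L^\infty_xL^q_t}\le C\,\|f\|_{\dot H^b(\mathbb{R}^n)}$$ for all $f\in\dot H^b(\mathbb{R}^n)$.
   Context: The Fourier transform of $f$ on $\mathbb{R}^n$ is denoted $\hat f=\mathcal F(f)$, and $p(D)f=\mathcal F^{-1}(p(|\xi|)\hat f(\xi))$; thus $e^{itD}f=\mathcal F^{-1}(e^{it|\xi|}\hat f(\xi))$. $\dot H^s=D^{-s}L^2(\mathbb{R}^n)$ is the homogeneous Sobolev space (for $s<n/2$), with $\|f\|_{\dot H^s}=\|D^sf\|_{L^2}$. The norm $\|F\|_{L^\infty_xL^q_t}$ is the $L^\infty$ norm in $x\in\mathbb{R}^n$ of the $L^q$ norm in $t\in\mathbb{R}$. *)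

theory Defs
  imports "HOL-Analysis.Analysis" "HOL-Probability.Essential_Supremum"
begin

primrec iter_deriv :: "'a::euclidean_space list \<Rightarrow> ('a \<Rightarrow> complex) \<Rightarrow> 'a \<Rightarrow> complex" where
  "iter_deriv [] \<phi> = \<phi>"
| "iter_deriv (v # vs) \<phi> = (\<lambda>x. frechet_derivative (iter_deriv vs \<phi>) (at x) v)"

definition schwartz :: "('a::euclidean_space \<Rightarrow> complex) set" where
  "schwartz = {\<phi>. \<forall>vs \<in> lists Basis. iter_deriv vs \<phi> differentiable_on UNIV \<and>
     (\<forall>k. bounded (range (\<lambda>x. norm x ^ k *\<^sub>R iter_deriv vs \<phi> x)))}"

definition fourier_integral :: "('a::euclidean_space \<Rightarrow> complex) \<Rightarrow> 'a \<Rightarrow> complex" where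
  "fourier_integral \<phi> \<xi> = (LINT x|lborel. cis (- (x \<bullet> \<xi>)) * \<phi> x)"

text \<open>Functions that define a tempered distribution by integration. Here and below, functions
  are Borel representatives of their classes modulo equality almost everywhere.\<close>

definition temperate :: "('a::euclidean_space \<Rightarrow> complex) \<Rightarrow> bool" where
  "temperate f \<longleftrightarrow> (\<exists>N::nat. integrable lborel (\<lambda>x. f x / of_real ((1 + norm x) ^ N)))"

text \<open>\<open>is_fourier f h\<close>: the tempered distribution given by \<open>h\<close> is the Fourier transform of the one
  given by \<open>f\<close>. The function \<open>f\<close> determines \<open>h\<close> almost everywhere, and conversely.\<close>

definition is_fourier :: "('a::euclidean_space \<Rightarrow> complex) \<Rightarrow> ('a \<Rightarrow> complex) \<Rightarrow> bool" where
  "is_fourier f h \<longleftrightarrow> temperate f \<and> temperate h \<and>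
     (\<forall>\<phi> \<in> schwartz. (LINT x|lborel. f x * fourier_integral \<phi> x) = (LINT \<xi>|lborel. h \<xi> * \<phi> \<xi>))"

text \<open>\<open>is_mult p f g\<close> says \<open>g = p(D) f\<close> almost everywhere.\<close>

definition is_mult ::
    "(real \<Rightarrow> complex) \<Rightarrow> ('a::euclidean_space \<Rightarrow> complex) \<Rightarrow> ('a \<Rightarrow> complex) \<Rightarrow> bool" where
  "is_mult p f g \<longleftrightarrow> (\<exists>h. is_fourier f h \<and> is_fourier g (\<lambda>\<xi>. p (norm \<xi>) * h \<xi>))"

text \<open>A representative of \<open>p(D) f\<close>; meaningful only where some \<open>g\<close> with \<open>is_mult p f g\<close> exists.\<close>

definition mult :: "(real \<Rightarrow> complex) \<Rightarrow> ('a::euclidean_space \<Rightarrow> complex) \<Rightarrow> 'a \<Rightarrow> complex" where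
  "mult p f = (SOME g. is_mult p f g)"

definition Lp_norm :: "'a measure \<Rightarrow> real \<Rightarrow> ('a \<Rightarrow> complex) \<Rightarrow> ennreal" where
  "Lp_norm M p f = (let I = (\<integral>\<^sup>+x. ennreal (norm (f x) powr p) \<partial>M) in
     if I = \<infinity> then \<infinity> else ennreal (enn2real I powr (1 / p)))"

definition L2_space :: "('a::euclidean_space \<Rightarrow> complex) set" where
  "L2_space = {g \<in> borel_measurable lborel. Lp_norm lborel 2 g < \<infinity>}"

text \<open>\<open>Hdot s = D\<^sup>-\<^sup>s L\<^sup>2\<close>. For \<open>0 \<le> s < n/2\<close> all its elements are functions: if \<open>g\<close> is in \<open>L\<^sup>2\<close>
  with Fourier transform \<open>h\<close>, then \<open>|\<xi>|\<^sup>-\<^sup>s h\<close> lies in \<open>L\<^sup>1 + L\<^sup>2\<close> (split at \<open>|\<xi>| = 1\<close>), so its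
  inverse Fourier transform is in \<open>L\<^sup>\<infinity> + L\<^sup>2\<close>. The convention \<open>0 powr s = 0\<close> only affects the
  null set \<open>\<xi> = 0\<close>.\<close>

definition Hdot :: "real \<Rightarrow> ('a::euclidean_space \<Rightarrow> complex) set" where
  "Hdot s = {f. \<exists>g \<in> L2_space. is_mult (\<lambda>r. of_real (r powr (- s))) g f}"

definition Hdot_norm :: "real \<Rightarrow> ('a::euclidean_space \<Rightarrow> complex) \<Rightarrow> ennreal" where
  "Hdot_norm s f = Lp_norm lborel 2 (mult (\<lambda>r. of_real (r powr s)) f)"

text \<open>\<open>is_wave f u\<close>: \<open>u\<close> is a jointly measurable representative of \<open>(t, x) \<mapsto> (exp(itD) f)(x)\<close>. Joint
  measurability is what makes mixed norms independent of the representative: two such \<open>u\<close> agree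
  almost everywhere on space-time.\<close>

definition is_wave :: "('a::euclidean_space \<Rightarrow> complex) \<Rightarrow> (real \<Rightarrow> 'a \<Rightarrow> complex) \<Rightarrow> bool" where
  "is_wave f u \<longleftrightarrow> (\<lambda>(t, x). u t x) \<in> borel_measurable (lborel \<Otimes>\<^sub>M lborel) \<and>
     (\<forall>t. is_mult (\<lambda>r. exp (\<i> * of_real (t * r))) f (u t))"

definition LinfLq_norm :: "real \<Rightarrow> (real \<Rightarrow> 'a::euclidean_space \<Rightarrow> complex) \<Rightarrow> ennreal" where
  "LinfLq_norm q u = esssup lborel (\<lambda>x. Lp_norm lborel q (\<lambda>t. u t x))"

end

theory Submission
  imports Defs "HOL-Probability.Probability" "HOL-Real_Asymp.Real_Asymp"
begin

text \<open>
  Write \<open>F\<close> for the Fourier transform of \<open>f\<close> and \<open>n\<close> for the dimension. The wave is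
  \<open>u(t, x) = (2\<pi>)\<^sup>-\<^sup>n \<integral> exp(it|\<xi>|) exp(ix\<bullet>\<xi>) F(\<xi>) d\<xi>\<close>. For a fixed \<open>x\<close> the factor \<open>exp(ix\<bullet>\<xi>)\<close> has
  modulus one and can be absorbed into \<open>F\<close>, so the estimate is uniform in \<open>x\<close> as soon as the
  function of time \<open>T H(t) = \<integral> exp(it|\<xi>|) H(\<xi>) d\<xi>\<close> satisfies
  \<open>\<parallel>T H\<parallel>\<^sub>q \<le> C \<parallel>|\<xi>|\<^sup>b H\<parallel>\<^sub>2\<close> for all integrable \<open>H\<close>. This is a one-dimensional statement: \<open>T H\<close> is
  the Fourier transform of the image of \<open>H d\<xi>\<close> under \<open>\<xi> \<mapsto> |\<xi>|\<close>.

  For \<open>q = 2\<close> it is Plancherel's inequality on the line, because the image of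
  \<open>|\<xi>|\<^sup>1\<^sup>-\<^sup>n d\<xi>\<close> is a multiple of Lebesgue measure on the half line. The abstract form is
  \<open>bessel_inequality\<close>; it is proved with a Gaussian regularisation and Schur's test, and it also
  yields Plancherel's inequality in \<open>n\<close> dimensions. For \<open>q > 2\<close> the Sobolev embedding on the line is
  carried out on the frequency side (\<open>time_Lq_inequality\<close>): at the level \<open>\<alpha>\<close> the frequencies below a
  radius \<open>\<Lambda>(\<alpha>)\<close> contribute at most \<open>\<alpha>/2\<close>, so the level set is controlled by the \<open>L\<^sup>2\<close> norm of the
  high frequencies, and integration over all levels gives the \<open>L\<^sup>q\<close> norm. Together this is
  \<open>time_norm_bound\<close>.

  The rest relates this inequality to the distributional definitions of the Fourier transform.
  Testing with Gaussians shows that a tempered function determines the mollifications of its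
  transform and conversely, and \<open>L2_bound_of_mollified\<close> passes from mollifications to functions. This gives the
  bound of the \<open>L\<^sup>2\<close> norm of a transform (\<open>is_fourier_L2_bound\<close>) and the uniqueness of transforms in
  both directions (\<open>is_fourier_unique\<close>, \<open>is_fourier_inj\<close>). Conversely, the wave is constructed as the
  pointwise limit of the integrals over \<open>|\<xi>| \<le> \<kappa>\<^sub>j\<close>; if \<open>\<kappa>\<^sub>j\<close> grows fast enough, these converge almost
  everywhere and the limit has the required transform (\<open>is_fourier_lim_truncations\<close>). Fatou's lemma
  carries the estimate in time over to the limit at every \<open>x\<close> (\<open>wave_solution\<close>). Finally any two
  jointly measurable waves agree at almost every time for almost every \<open>x\<close> (\<open>is_wave_unique\<close>).
\<close>

section \<open>Radial integration\<close>

lemma nn_integral_powr_from_0: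
  fixes a c :: real
  assumes "a > -1" "c \<ge> 0"
  shows "(\<integral>\<^sup>+r. ennreal (r powr a) * indicator {0..c} r \<partial>lborel) = ennreal (c powr (a + 1) / (a + 1))"
  by (rule nn_integral_has_integral_lebesgue'[OF _ has_integral_powr_from_0[OF assms]]) simp

text \<open>The surface measure of the unit sphere, that is the derivative at \<open>1\<close> of the volume of
  the ball of radius \<open>r\<close>.\<close>

definition sphere_area :: "'a::euclidean_space itself \<Rightarrow> real" where
  "sphere_area _ = real DIM('a) * unit_ball_vol (real DIM('a))"

lemma sphere_area_pos: "sphere_area TYPE('a::euclidean_space) > 0"
  by (simp add: sphere_area_def)

text \<open>Both measures give the ball volume \<open>v\<^sub>n a\<^sup>n\<close> to every half line \<open>{..a}\<close>, and these half
  lines generate the Borel sets.\<close>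

lemma distr_norm_lborel:
  "distr (lborel :: 'a::euclidean_space measure) borel norm =
    density lborel (\<lambda>r. ennreal (sphere_area TYPE('a) * r powr (real DIM('a) - 1)) * indicator {0..} r)"
    (is "?M = ?N")
proof (rule measure_eqI_generator_eq)
  let ?n = "real DIM('a)" and ?s = "sphere_area TYPE('a)"
  have emM: "emeasure ?M {..a} = ennreal (unit_ball_vol ?n * max 0 a ^ DIM('a))" for a :: real
  proof (cases "a \<ge> 0")
    case True
    have "norm -` {..a} = (cball 0 a :: 'a set)" by auto
    then show ?thesis using True by (simp add: emeasure_distr emeasure_cball)
  next
    case False
    have "norm -` {..a} = ({} :: 'a set)" using False by (auto simp: not_le intro: le_less_trans dest: order_trans[OF norm_ge_zero])
    then show ?thesis using False by (simp add: emeasure_distr)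
  qed
  have emN: "emeasure ?N {..a} = ennreal (unit_ball_vol ?n * max 0 a ^ DIM('a))" for a :: real
  proof -
    have "emeasure ?N {..a} =
        (\<integral>\<^sup>+r. ennreal (?s * r powr (?n - 1)) * indicator {0..} r * indicator {..a} r \<partial>lborel)"
      by (simp add: emeasure_density)
    also have "\<dots> = (\<integral>\<^sup>+r. ennreal ?s * (ennreal (r powr (?n - 1)) * indicator {0..max 0 a} r) \<partial>lborel)"
      using sphere_area_pos[where 'a='a]
      by (intro nn_integral_cong_AE AE_I[where N="{0}"])
         (auto simp: indicator_def ennreal_mult split: if_splits)
    also have "\<dots> = ennreal ?s * ennreal (max 0 a powr ?n / ?n)"
      by (subst nn_integral_cmult) (auto simp: nn_integral_powr_from_0)
    also have "\<dots> = ennreal (unit_ball_vol ?n * max 0 a ^ DIM('a))"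
      using sphere_area_pos[where 'a='a]
      by (subst ennreal_mult[symmetric])
         (auto simp: sphere_area_def powr_realpow' max_def zero_power DIM_positive)
    finally show ?thesis .
  qed
  show "Int_stable (range (atMost :: real \<Rightarrow> _))" by (auto simp: Int_stable_def Int_atMost)
  show "range (atMost :: real \<Rightarrow> _) \<subseteq> Pow UNIV" by simp
  show "emeasure ?M X = emeasure ?N X" if "X \<in> range atMost" for X
    using that emM emN by auto
  have *: "sets (borel :: real measure) = sigma_sets UNIV (range atMost)"
    unfolding borel_eq_atMost by (simp add: image_def)
  show "sets ?M = sigma_sets UNIV (range atMost)" "sets ?N = sigma_sets UNIV (range atMost)"
    using * by simp_all
  show "range (\<lambda>i. {..real i}) \<subseteq> range atMost" by auto
  show "(\<Union>i. {..real i}) = UNIV" by (auto simp: real_arch_simple)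
  show "emeasure ?M {..real i} \<noteq> \<infinity>" for i by (simp add: emM)
qed

lemma nn_integral_radial:
  fixes f :: "real \<Rightarrow> ennreal"
  assumes [measurable]: "f \<in> borel_measurable borel"
  shows "(\<integral>\<^sup>+x. f (norm (x::'a::euclidean_space)) \<partial>lborel) =
    (\<integral>\<^sup>+r. ennreal (sphere_area TYPE('a) * r powr (real DIM('a) - 1)) * f r * indicator {0..} r \<partial>lborel)"
proof -
  have "(\<integral>\<^sup>+x. f (norm (x::'a)) \<partial>lborel) = (\<integral>\<^sup>+r. f r \<partial>distr (lborel::'a measure) borel norm)"
    by (simp add: nn_integral_distr)
  then show ?thesis
    unfolding distr_norm_lborel by (simp add: nn_integral_density mult_ac)
qed

text \<open>The image of \<open>|x|\<^sup>1\<^sup>-\<^sup>n dx\<close> under the norm is at most a multiple of Lebesgue measure; this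
  is what reduces integrals in frequency space to a one-dimensional problem.\<close>

lemma nn_integral_radial_weighted_le:
  fixes f :: "real \<Rightarrow> ennreal"
  assumes [measurable]: "f \<in> borel_measurable borel"
  shows "(\<integral>\<^sup>+x. f (norm (x::'a::euclidean_space)) * ennreal (norm x powr (1 - real DIM('a))) \<partial>lborel)
    \<le> ennreal (sphere_area TYPE('a)) * (\<integral>\<^sup>+r. f r \<partial>lborel)"
proof -
  let ?s = "sphere_area TYPE('a)"
  have "(\<integral>\<^sup>+x. f (norm (x::'a)) * ennreal (norm x powr (1 - real DIM('a))) \<partial>lborel) =
     (\<integral>\<^sup>+r. ennreal (?s * r powr (real DIM('a) - 1)) * (f r * ennreal (r powr (1 - real DIM('a)))) * indicator {0..} r \<partial>lborel)"
    by (rule nn_integral_radial) simp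
  also have "\<dots> \<le> (\<integral>\<^sup>+r. ennreal ?s * f r \<partial>lborel)"
  proof (rule nn_integral_mono)
    fix r :: real
    have *: "ennreal (?s * r powr (real DIM('a) - 1)) * ennreal (r powr (1 - real DIM('a))) \<le> ennreal ?s"
      using sphere_area_pos[where 'a='a]
      by (cases "r = 0") (auto simp: ennreal_mult[symmetric] powr_add[symmetric] mult.assoc)
    show "ennreal (?s * r powr (real DIM('a) - 1))
        * (f r * ennreal (r powr (1 - real DIM('a)))) * indicator {0..} r \<le> ennreal ?s * f r"
      using mult_right_mono[OF *, of "f r"] by (auto simp: indicator_def mult_ac)
  qed
  also have "\<dots> = ennreal ?s * (\<integral>\<^sup>+r. f r \<partial>lborel)" by (simp add: nn_integral_cmult)
  finally show ?thesis .
qed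

lemma nn_integral_ball_norm_powr:
  assumes "real DIM('a::euclidean_space) + p > 0" "R \<ge> 0"
  shows "(\<integral>\<^sup>+x. ennreal (norm (x::'a) powr p) * indicator {..R} (norm x) \<partial>lborel) =
    ennreal (sphere_area TYPE('a) * (R powr (real DIM('a) + p) / (real DIM('a) + p)))"
proof -
  let ?n = "real DIM('a)" and ?s = "sphere_area TYPE('a)"
  have "(\<integral>\<^sup>+x. ennreal (norm (x::'a) powr p) * indicator {..R} (norm x) \<partial>lborel) =
     (\<integral>\<^sup>+r. ennreal (?s * r powr (?n - 1)) * (ennreal (r powr p) * indicator {..R} r) * indicator {0..} r \<partial>lborel)"
    by (rule nn_integral_radial) simp
  also have "\<dots> = (\<integral>\<^sup>+r. ennreal ?s * (ennreal (r powr (?n + p - 1)) * indicator {0..R} r) \<partial>lborel)"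
    using sphere_area_pos[where 'a='a]
    by (intro nn_integral_cong)
       (auto simp: indicator_def ennreal_mult[symmetric] powr_add[symmetric] mult.assoc algebra_simps)
  also have "\<dots> = ennreal ?s * ennreal (R powr (?n + p) / (?n + p))"
    using assms by (subst nn_integral_cmult) (auto simp: nn_integral_powr_from_0)
  also have "\<dots> = ennreal (?s * (R powr (?n + p) / (?n + p)))"
    using sphere_area_pos[where 'a='a] assms by (subst ennreal_mult[symmetric]) auto
  finally show ?thesis .
qed

text \<open>Since \<open>r\<^sup>n\<^sup>-\<^sup>1 \<le> (1 + r)\<^sup>n\<^sup>-\<^sup>1\<close>, the radial integral is dominated by that of \<open>(1 + r)\<^sup>-\<^sup>2\<close>.\<close>

lemma integrable_inverse_power_norm:
  "integrable lborel (\<lambda>x::'a::euclidean_space. 1 / (1 + norm x) ^ (DIM('a) + 1))"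
proof (rule integrableI_bounded)
  let ?n = "real DIM('a)" and ?s = "sphere_area TYPE('a)"
  have "(\<integral>\<^sup>+x. ennreal (norm (1 / (1 + norm (x::'a)) ^ (DIM('a) + 1))) \<partial>lborel) =
     (\<integral>\<^sup>+x. ennreal (norm (1 / (1 + norm (norm (x::'a))) ^ (DIM('a) + 1))) \<partial>lborel)" by simp
  also have "\<dots> = (\<integral>\<^sup>+r. ennreal (?s * r powr (?n - 1)) * ennreal (norm (1 / (1 + norm r) ^ (DIM('a)
      + 1))) * indicator {0..} r \<partial>lborel)"
    by (rule nn_integral_radial) simp
  also have "\<dots> \<le> (\<integral>\<^sup>+r. ennreal (?s / (1 + r)^2) * indicator {0..} r \<partial>lborel)"
  proof (rule nn_integral_mono, goal_cases)
    case (1 r)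
    show ?case
    proof (cases "r > 0")
      case True
      have "r powr (?n - 1) = r ^ (DIM('a) - 1)"
        using True by (subst powr_realpow[symmetric]) (auto simp: of_nat_diff)
      also have "\<dots> \<le> (1 + r) ^ (DIM('a) - 1)" using True by (intro power_mono) auto
      finally have "r powr (?n - 1) * (1 + r)^2 \<le> (1 + r) ^ (DIM('a) - 1) * (1 + r)^2"
        by (intro mult_right_mono) auto
      also have "\<dots> = (1 + r) ^ (DIM('a) + 1)"
        by (simp add: power_add[symmetric] del: power_Suc)
      finally have "r powr (?n - 1) / (1 + r) ^ (DIM('a) + 1) \<le> 1 / (1 + r)^2"
        using True by (simp add: frac_le_eq divide_le_eq le_divide_eq mult.commute del: power_Suc power_add)
      then have "?s * (r powr (?n - 1) / (1 + r) ^ (DIM('a) + 1)) \<le> ?s * (1 / (1 + r)^2)"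
        using sphere_area_pos[where 'a='a] by (intro mult_left_mono) auto
      then show ?thesis using True sphere_area_pos[where 'a='a]
        by (simp add: ennreal_mult[symmetric] ennreal_leI)
    qed (auto simp: indicator_def)
  qed
  also have "\<dots> = ennreal (0 - (- ?s / (1 + 0)))"
  proof (rule nn_integral_FTC_atLeast)
    show "((\<lambda>r. - ?s / (1 + r)) \<longlongrightarrow> 0) at_top" by real_asymp
    show "DERIV (\<lambda>r. - ?s / (1 + r)) x :> ?s / (1 + x)\<^sup>2" if "0 \<le> x" for x
      using that by (auto intro!: derivative_eq_intros simp: power2_eq_square)
  qed (use sphere_area_pos[where 'a='a] in auto)
  finally show "(\<integral>\<^sup>+x. ennreal (norm (1 / (1 + norm (x::'a)) ^ (DIM('a) + 1))) \<partial>lborel) < \<infinity>"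
    by (simp add: order.strict_trans1)
qed simp

section \<open>Gaussians\<close>

text \<open>With this scaling the Fourier transform exchanges \<open>a\<close> and \<open>1 / a\<close>.\<close>

definition gauss :: "real \<Rightarrow> 'a::euclidean_space \<Rightarrow> real" where
  "gauss a x = exp (- (a * (norm x)\<^sup>2 / 2))"

lemma gauss_pos: "gauss a x > 0"
  and gauss_le_1: "a \<ge> 0 \<Longrightarrow> gauss a x \<le> 1"
  and gauss_minus [simp]: "gauss a (- x) = gauss a x"
  by (auto simp: gauss_def)

lemma gauss_commute: "gauss a (x - y) = gauss a (y - x)"
  using gauss_minus[of a "x - y"] by simp

lemma continuous_gauss: "continuous_on UNIV (gauss a)"
  unfolding gauss_def by (intro continuous_intros) auto

lemma borel_measurable_gauss [measurable]: "gauss a \<in> borel_measurable borel"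
  by (rule borel_measurable_continuous_onI[OF continuous_gauss])

lemma borel_measurable_cis [measurable]: "cis \<in> borel_measurable borel"
  by (intro borel_measurable_continuous_onI continuous_intros)

text \<open>The characteristic function of the standard normal distribution, rescaled.\<close>

lemma fourier_gauss_real:
  fixes a t :: real
  assumes "a > 0"
  shows "has_bochner_integral lborel (\<lambda>s. cis (s * t) * of_real (gauss a s))
    (of_real (sqrt (2 * pi / a) * exp (- (t\<^sup>2 / (2 * a)))))"
proof -
  have int: "integrable lborel (\<lambda>x. complex_of_real (std_normal_density x) * cis (u * x))" for u
    by (rule Bochner_Integration.integrable_bound[where f=std_normal_density])
       (auto simp: norm_mult)
  have "(LINT x|lborel. complex_of_real (std_normal_density x) * cis (u * x)) = of_real (exp (- (u\<^sup>2) / 2))" for u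
    using fun_cong[OF char_std_normal_distribution, of u]
    unfolding char_def
    by (subst (asm) integral_density)
       (auto simp: cis_conv_exp scaleR_conv_of_real normal_density_nonneg)
  with int have "has_bochner_integral lborel (\<lambda>x. complex_of_real (std_normal_density x) * cis (u * x))
      (of_real (exp (- (u\<^sup>2) / 2)))" for u
    by (simp add: has_bochner_integral_iff)
  from has_bochner_integral_mult_left[OF this[of "t / sqrt a"], of "of_real (sqrt (2 * pi))"]
  have *: "has_bochner_integral lborel (\<lambda>x. cis (t / sqrt a * x) * of_real (gauss 1 x))
      (of_real (sqrt (2 * pi) * exp (- ((t / sqrt a)\<^sup>2) / 2)))"
    by (simp add: std_normal_density_def gauss_def mult_ac)
  have "has_bochner_integral lborel (\<lambda>s. cis (s * t) * of_real (gauss a s))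
    (of_real (sqrt (2 * pi) * exp (- ((t / sqrt a)\<^sup>2) / 2)) /\<^sub>R \<bar>sqrt a\<bar>)"
    using assms * lborel_has_bochner_integral_real_affine_iff[of "sqrt a"
      "\<lambda>x. cis (t / sqrt a * x) * of_real (gauss 1 x)" _ 0]
    by (simp add: gauss_def power_mult_distrib mult_ac)
  then show ?thesis
    using assms by (simp add: scaleR_conv_of_real power_divide real_sqrt_divide field_simps)
qed

lemma cis_sum: "cis (\<Sum>i\<in>A. f i) = (\<Prod>i\<in>A. cis (f i))"
  by (induction A rule: infinite_finite_induct) (auto simp: cis_mult[symmetric])

text \<open>The Gaussian and the exponential are products over the coordinates, so the integral
  factors into one-dimensional ones.\<close>

lemma fourier_gauss:
  fixes y :: "'a::euclidean_space"
  assumes "a > 0"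
  shows "has_bochner_integral lborel (\<lambda>x. cis (x \<bullet> y) * of_real (gauss a x))
    (of_real (sqrt (2 * pi / a) ^ DIM('a) * gauss (1 / a) y))"
proof -
  interpret product_sigma_finite "\<lambda>_::'a. lborel :: real measure" ..
  let ?E = "\<lambda>f. (\<Sum>b\<in>Basis. f b *\<^sub>R b) :: 'a"
  let ?g = "\<lambda>b s. cis (s * (y \<bullet> b)) * complex_of_real (gauss a (s::real))"
  have 1: "cis (?E f \<bullet> y) * of_real (gauss a (?E f)) = (\<Prod>b\<in>Basis. ?g b (f b))" for f
  proof -
    have "cis (?E f \<bullet> y) = (\<Prod>b\<in>Basis. cis (f b * (y \<bullet> b)))"
      by (simp add: inner_sum_left cis_sum inner_commute[of y])
    moreover have "(norm (?E f))\<^sup>2 = (\<Sum>b\<in>Basis. (f b)\<^sup>2)"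
      unfolding power2_norm_eq_inner by (subst euclidean_inner) (simp add: power2_eq_square)
    then have "gauss a (?E f) = (\<Prod>b\<in>Basis. gauss a (f b))"
      by (simp add: gauss_def exp_sum[symmetric] sum_distrib_left sum_negf sum_divide_distrib)
    ultimately show ?thesis by (simp add: prod.distrib)
  qed
  have int: "integrable lborel (?g b)" and val: "integral\<^sup>L lborel (?g b)
      = of_real (sqrt (2 * pi / a) * exp (- ((y \<bullet> b)\<^sup>2 / (2 * a))))" for b
    using fourier_gauss_real[OF assms, of "y \<bullet> b"] by (auto simp: has_bochner_integral_iff)
  have "has_bochner_integral (\<Pi>\<^sub>M b\<in>Basis. lborel) (\<lambda>f. (\<Prod>b\<in>Basis. ?g b (f b)))
      (\<Prod>b\<in>(Basis::'a set). integral\<^sup>L lborel (?g b))"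
    unfolding has_bochner_integral_iff
    using product_integrable_prod[of Basis ?g] product_integral_prod[of Basis ?g] int by auto
  also have "(\<Prod>b\<in>(Basis::'a set). integral\<^sup>L lborel (?g b)) = of_real (sqrt (2 * pi / a) ^ DIM('a) * gauss (1 / a) y)"
  proof -
    have n: "(norm y)\<^sup>2 = (\<Sum>b\<in>Basis. (y \<bullet> b)\<^sup>2)"
      unfolding power2_norm_eq_inner by (subst euclidean_inner) (simp add: power2_eq_square)
    have "(\<Prod>b\<in>Basis. exp (- ((y \<bullet> b)\<^sup>2 / (2 * a)))) = gauss (1 / a) y"
      by (simp add: gauss_def n exp_sum[symmetric] sum_negf sum_divide_distrib mult.commute[of a 2])
    then show ?thesis
      unfolding val of_real_prod[symmetric] by (simp add: prod.distrib)
  qed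
  finally show ?thesis
    unfolding 1[symmetric]
    by (subst lborel_eq) (auto simp: has_bochner_integral_iff integrable_distr_eq integral_distr)
qed

lemma integrable_gauss: "a > 0 \<Longrightarrow> integrable lborel (gauss a :: 'a::euclidean_space \<Rightarrow> real)"
  and integral_gauss: "a > 0 \<Longrightarrow> (LINT x|lborel. gauss a (x::'a::euclidean_space)) = sqrt (2 * pi / a) ^ DIM('a)"
  using fourier_gauss[of a "0::'a"]
  by (auto simp: has_bochner_integral_iff gauss_def[abs_def] complex_of_real_integrable_eq simp flip: of_real_mult of_real_power)

section \<open>Bessel inequalities\<close>

abbreviation energy :: "('a::euclidean_space \<Rightarrow> complex) \<Rightarrow> ennreal" where
  "energy f \<equiv> \<integral>\<^sup>+x. ennreal ((norm (f x))\<^sup>2) \<partial>lborel"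

text \<open>The form of Fatou's lemma that passes a uniform bound to a limit.\<close>

lemma nn_integral_fatou_bound:
  fixes f :: "nat \<Rightarrow> 'a \<Rightarrow> ennreal"
  assumes [measurable]: "\<And>k. f k \<in> borel_measurable M"
    and lim: "AE x in M. g x \<le> liminf (\<lambda>k. f k x)"
    and bound: "\<And>k. (\<integral>\<^sup>+x. f k x \<partial>M) \<le> B"
  shows "(\<integral>\<^sup>+x. g x \<partial>M) \<le> B"
proof -
  have "(\<integral>\<^sup>+x. g x \<partial>M) \<le> (\<integral>\<^sup>+x. liminf (\<lambda>k. f k x) \<partial>M)"
    by (rule nn_integral_mono_AE[OF lim])
  also have "\<dots> \<le> liminf (\<lambda>k. \<integral>\<^sup>+x. f k x \<partial>M)"
    by (rule nn_integral_liminf) simp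
  also have "\<dots> \<le> limsup (\<lambda>k. \<integral>\<^sup>+x. f k x \<partial>M)" by (rule Liminf_le_Limsup) simp
  also have "\<dots> \<le> B" by (rule Limsup_bounded) (simp add: bound)
  finally show ?thesis .
qed

lemma nn_integral_lborel_affine:
  fixes f :: "'a::euclidean_space \<Rightarrow> ennreal"
  assumes [measurable]: "f \<in> borel_measurable borel" and "c \<noteq> 0"
  shows "(\<integral>\<^sup>+x. f x \<partial>lborel) = ennreal (\<bar>c\<bar> ^ DIM('a)) * (\<integral>\<^sup>+x. f (t + c *\<^sub>R x) \<partial>lborel)"
  by (subst lborel_affine[OF assms(2), of t])
     (simp add: nn_integral_density nn_integral_distr nn_integral_cmult)

lemma nn_integral_gauss_translate:
  fixes z :: "'a::euclidean_space"
  assumes "a > 0"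
  shows "(\<integral>\<^sup>+x. ennreal (gauss a (z - x)) \<partial>lborel) = ennreal (sqrt (2 * pi / a) ^ DIM('a))"
proof -
  have "(\<integral>\<^sup>+x. ennreal (gauss a (z - x)) \<partial>lborel) = (\<integral>\<^sup>+x. ennreal (gauss a (x::'a)) \<partial>lborel)"
    using nn_integral_lborel_affine[of "\<lambda>x. ennreal (gauss a x)" "-1" z] by simp
  also have "\<dots> = ennreal (LINT x|lborel. gauss a (x::'a))"
    by (intro nn_integral_eq_integral integrable_gauss assms) (auto simp: gauss_pos less_imp_le)
  finally show ?thesis by (simp add: integral_gauss assms)
qed

lemma integrable_tensor:
  fixes f :: "'a \<Rightarrow> complex" and g :: "'b \<Rightarrow> complex"
  assumes "sigma_finite_measure N" and f: "integrable M f" and g: "integrable N g"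
  shows "integrable (M \<Otimes>\<^sub>M N) (\<lambda>(x, y). f x * g y)"
proof (rule integrableI_bounded)
  interpret N: sigma_finite_measure N by fact
  note [measurable] = borel_measurable_integrable[OF f] borel_measurable_integrable[OF g]
  show "(\<lambda>(x, y). f x * g y) \<in> borel_measurable (M \<Otimes>\<^sub>M N)" by measurable
  have "(\<integral>\<^sup>+z. ennreal (norm (case z of (x, y) \<Rightarrow> f x * g y)) \<partial>(M \<Otimes>\<^sub>M N)) =
      (\<integral>\<^sup>+x. \<integral>\<^sup>+y. ennreal (norm (f x)) * ennreal (norm (g y)) \<partial>N \<partial>M)"
    by (subst N.nn_integral_fst[symmetric]) (auto simp: norm_mult ennreal_mult)
  also have "\<dots> = (\<integral>\<^sup>+x. ennreal (norm (f x)) \<partial>M) * (\<integral>\<^sup>+y. ennreal (norm (g y)) \<partial>N)"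
    by (simp add: nn_integral_cmult nn_integral_multc)
  also have "\<dots> < \<infinity>"
    using f g by (auto simp: integrable_iff_bounded ennreal_mult_less_top)
  finally show "(\<integral>\<^sup>+z. ennreal (norm (case z of (x, y) \<Rightarrow> f x * g y)) \<partial>(M \<Otimes>\<^sub>M N)) < \<infinity>" .
qed

lemma borel_measurable_cnj [measurable]: "cnj \<in> borel_measurable borel"
  by (intro borel_measurable_continuous_onI continuous_intros)

text \<open>The arithmetic-geometric mean inequality for \<open>pu\<close> and \<open>qv\<close>, divided by \<open>uv\<close>.\<close>

lemma weighted_amgm:
  fixes p q u v :: real
  assumes "u > 0" "v > 0"
  shows "p * q \<le> (p\<^sup>2 * u / v + q\<^sup>2 * v / u) / 2"
proof -
  have "0 \<le> (p * u - q * v)\<^sup>2 / (2 * u * v)" using assms by simp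
  also have "\<dots> = (p\<^sup>2 * u / v + q\<^sup>2 * v / u) / 2 - p * q"
    using assms by (simp add: power2_eq_square field_simps)
  finally show ?thesis by simp
qed

text \<open>A Fourier transform on the image of \<open>M\<close> under \<open>\<Phi>\<close>, without reference to a density of the
  image. Expanding \<open>|U(\<tau>)|\<^sup>2\<close> as a double integral and integrating against a Gaussian in \<open>\<tau>\<close> leaves
  the positive kernel \<open>k(\<Phi> x - \<Phi> y)\<close> of total mass \<open>(2\<pi>)\<^sup>m\<close>, where \<open>m\<close> is the dimension of the
  target space. Schur's test with the weight \<open>w\<close> bounds the resulting quadratic form independently
  of the width of the Gaussian, which is then sent to infinity.\<close>

lemma bessel_inequality:
  fixes \<Phi> :: "'m \<Rightarrow> 'b::euclidean_space" and H :: "'m \<Rightarrow> complex" and w :: "'m \<Rightarrow> real"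
  assumes M: "sigma_finite_measure M"
    and [measurable]: "\<Phi> \<in> M \<rightarrow>\<^sub>M borel" "w \<in> borel_measurable M"
    and H: "integrable M H"
    and w: "AE x in M. w x > 0"
    and push: "\<And>k. k \<in> borel_measurable borel \<Longrightarrow>
      (\<integral>\<^sup>+x. k (\<Phi> x) * ennreal (1 / w x) \<partial>M) \<le> D * (\<integral>\<^sup>+y. k y \<partial>lborel)"
  shows "(\<integral>\<^sup>+\<tau>. ennreal ((norm (LINT x|M. cis (\<tau> \<bullet> \<Phi> x) * H x))\<^sup>2) \<partial>lborel)
    \<le> ennreal ((2 * pi) ^ DIM('b)) * D * (\<integral>\<^sup>+x. ennreal ((norm (H x))\<^sup>2 * w x) \<partial>M)"
    (is "_ \<le> ?B")
proof -
  interpret M: sigma_finite_measure M by fact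
  interpret MM: pair_sigma_finite M M ..
  interpret LMM: pair_sigma_finite lborel "M \<Otimes>\<^sub>M M" ..
  note [measurable] = borel_measurable_integrable[OF H]
  define U where "U \<tau> = (LINT x|M. cis (\<tau> \<bullet> \<Phi> x) * H x)" for \<tau>
  have [measurable]: "U \<in> borel_measurable borel" unfolding U_def by measurable
  have intH: "integrable M (\<lambda>x. cis (\<tau> \<bullet> \<Phi> x) * H x)" for \<tau>
    by (rule Bochner_Integration.integrable_bound[OF H]) (auto simp: norm_mult)
  have regularised: "(\<integral>\<^sup>+\<tau>. ennreal ((norm (U \<tau>))\<^sup>2 * gauss e \<tau>) \<partial>lborel) \<le> ?B" if e: "e > 0" for e
  proof -
    define c where "c = sqrt (2 * pi / e) ^ DIM('b)"
    have c: "c > 0" using e by (simp add: c_def)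
    define k where "k s = c * gauss (1 / e) s" for s :: 'b
    have k: "k s > 0" for s using c by (simp add: k_def gauss_pos)
    have [measurable]: "k \<in> borel_measurable borel" unfolding k_def by measurable
    have ksym: "k (s - t) = k (t - s)" for s t by (simp add: k_def gauss_commute)
    have kint: "(\<integral>\<^sup>+s. ennreal (k (z - s)) \<partial>lborel) = ennreal ((2 * pi) ^ DIM('b))" for z
    proof -
      have "(\<integral>\<^sup>+s. ennreal (k (z - s)) \<partial>lborel) = ennreal c * ennreal (sqrt (2 * pi / (1 / e)) ^ DIM('b))"
        using e c unfolding k_def
        by (simp add: ennreal_mult gauss_pos less_imp_le nn_integral_cmult nn_integral_gauss_translate)
      also have "\<dots> = ennreal ((sqrt (2 * pi / e) * sqrt (2 * pi / (1 / e))) ^ DIM('b))"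
        using c e by (subst ennreal_mult[symmetric]) (auto simp: c_def power_mult_distrib)
      also have "sqrt (2 * pi / e) * sqrt (2 * pi / (1 / e)) = sqrt ((2 * pi)\<^sup>2)"
        unfolding real_sqrt_mult[symmetric] using e by (simp add: power2_eq_square)
      also have "\<dots> = 2 * pi" by (subst real_sqrt_abs) simp
      finally show ?thesis .
    qed
    \<comment> \<open>The Gaussian factor makes the integrand integrable on the product, so that Fubini applies.\<close>
    define Q where "Q = (\<lambda>(\<tau>::'b, x, y). cis (\<tau> \<bullet> (\<Phi> x - \<Phi> y)) * of_real (gauss e \<tau>) * (H x * cnj (H y)))"
    have [measurable]: "Q \<in> borel_measurable (lborel \<Otimes>\<^sub>M (M \<Otimes>\<^sub>M M))" unfolding Q_def by measurable
    have HH: "integrable (M \<Otimes>\<^sub>M M) (\<lambda>(x, y). H x * cnj (H y))"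
      using H by (intro integrable_tensor M) auto
    have Qint: "integrable (lborel \<Otimes>\<^sub>M (M \<Otimes>\<^sub>M M)) Q"
    proof (rule Bochner_Integration.integrable_bound)
      show "integrable (lborel \<Otimes>\<^sub>M (M \<Otimes>\<^sub>M M)) (\<lambda>(\<tau>, z). of_real (gauss e (\<tau>::'b)) * (case z of (x, y) \<Rightarrow> H x * cnj (H y)))"
        by (rule integrable_tensor[OF MM.sigma_finite_measure_axioms integrable_of_real[OF integrable_gauss[OF e]] HH])
    qed (auto simp: Q_def norm_mult)
    have inner1: "(LINT z|(M \<Otimes>\<^sub>M M). Q (\<tau>, z)) = of_real ((norm (U \<tau>))\<^sup>2 * gauss e \<tau>)" for \<tau>
    proof -
      have int2: "integrable (M \<Otimes>\<^sub>M M) (\<lambda>(x, y). (cis (\<tau> \<bullet> \<Phi> x) * H x) * cnj (cis (\<tau> \<bullet> \<Phi> y) * H y))"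
        by (intro integrable_tensor M) (simp_all only: integrable_cnj intH)
      have "Q (\<tau>, z) = of_real (gauss e \<tau>) * (case z of (x, y) \<Rightarrow> (cis (\<tau> \<bullet> \<Phi> x) * H x) * cnj (cis (\<tau> \<bullet> \<Phi> y) * H y))" for z
        by (simp add: Q_def split_beta inner_diff_right cis_divide[symmetric] cis_cnj cis_mult[symmetric] divide_inverse)
      then have "(LINT z|(M \<Otimes>\<^sub>M M). Q (\<tau>, z)) = of_real (gauss e \<tau>) *
          (LINT z|(M \<Otimes>\<^sub>M M). (case z of (x, y) \<Rightarrow> (cis (\<tau> \<bullet> \<Phi> x) * H x) * cnj (cis (\<tau> \<bullet> \<Phi> y) * H y)))"
        by simp
      also have "(LINT z|(M \<Otimes>\<^sub>M M). (case z of (x, y) \<Rightarrow> (cis (\<tau> \<bullet> \<Phi> x) * H x) * cnj (cis (\<tau> \<bullet> \<Phi> y) * H y)))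
          = (LINT x|M. LINT y|M. (cis (\<tau> \<bullet> \<Phi> x) * H x) * cnj (cis (\<tau> \<bullet> \<Phi> y) * H y))"
        by (rule MM.integral_fst[symmetric, OF int2])
      also have "\<dots> = U \<tau> * cnj (U \<tau>)"
        by (simp only: integral_mult_right_zero integral_mult_left_zero Bochner_Integration.integral_cnj U_def)
      also have "\<dots> = of_real ((norm (U \<tau>))\<^sup>2)" by (rule complex_norm_square[symmetric])
      finally show ?thesis by simp
    qed
    have inner2: "(LINT \<tau>|lborel. Q (\<tau>, x, y)) = of_real (k (\<Phi> x - \<Phi> y)) * (H x * cnj (H y))" for x y
      using fourier_gauss[OF e, of "\<Phi> x - \<Phi> y"]
      by (simp add: Q_def has_bochner_integral_iff k_def c_def)
    have "complex_of_real (LINT \<tau>|lborel. (norm (U \<tau>))\<^sup>2 * gauss e \<tau>) = (LINT \<tau>|lborel. LINT z|(M \<Otimes>\<^sub>M M). Q (\<tau>, z))"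
      by (simp only: inner1 integral_complex_of_real)
    also have "\<dots> = (LINT z|(M \<Otimes>\<^sub>M M). LINT \<tau>|lborel. Q (\<tau>, z))"
      using LMM.Fubini_integral[of "\<lambda>a b. Q (a, b)"] Qint by simp
    also have "\<dots> = (LINT z|(M \<Otimes>\<^sub>M M). of_real (k (\<Phi> (fst z) - \<Phi> (snd z))) * (H (fst z) * cnj (H (snd z))))"
      by (intro Bochner_Integration.integral_cong refl) (metis inner2 prod.collapse)
    finally have eq: "complex_of_real (LINT \<tau>|lborel. (norm (U \<tau>))\<^sup>2 * gauss e \<tau>) = \<dots>" .
    have int1: "integrable lborel (\<lambda>\<tau>. (norm (U \<tau>))\<^sup>2 * gauss e \<tau>)"
      using LMM.integrable_fst'[OF Qint] unfolding inner1 by (simp only: complex_of_real_integrable_eq)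
    have "(\<integral>\<^sup>+\<tau>. ennreal ((norm (U \<tau>))\<^sup>2 * gauss e \<tau>) \<partial>lborel) = ennreal (LINT \<tau>|lborel. (norm (U \<tau>))\<^sup>2 * gauss e \<tau>)"
      using int1 by (intro nn_integral_eq_integral) (auto simp: gauss_pos less_imp_le)
    also have "\<dots> \<le> ennreal (norm (complex_of_real (LINT \<tau>|lborel. (norm (U \<tau>))\<^sup>2 * gauss e \<tau>)))"
      by (intro ennreal_leI) simp
    also have "\<dots> \<le> (\<integral>\<^sup>+z. ennreal (norm (of_real (k (\<Phi> (fst z) - \<Phi> (snd z))) * (H (fst z) * cnj (H (snd z))))) \<partial>(M \<Otimes>\<^sub>M M))"
      unfolding eq
    proof (rule integral_norm_bound_ennreal)
      have "(\<lambda>z. LINT \<tau>|lborel. Q (\<tau>, z)) = (\<lambda>z. of_real (k (\<Phi> (fst z) - \<Phi> (snd z))) * (H (fst z) * cnj (H (snd z))))"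
        by (auto simp: inner2)
      then show "integrable (M \<Otimes>\<^sub>M M) (\<lambda>z. of_real (k (\<Phi> (fst z) - \<Phi> (snd z))) * (H (fst z) * cnj (H (snd z))))"
        using LMM.integrable_snd[of "\<lambda>a b. Q (a, b)"] Qint by simp
    qed
    also have "\<dots> = (\<integral>\<^sup>+x. \<integral>\<^sup>+y. ennreal (k (\<Phi> x - \<Phi> y) * (norm (H x) * norm (H y))) \<partial>M \<partial>M)"
      by (subst M.nn_integral_fst[symmetric]) (auto simp: norm_mult k abs_of_pos)
    finally have A: "(\<integral>\<^sup>+\<tau>. ennreal ((norm (U \<tau>))\<^sup>2 * gauss e \<tau>) \<partial>lborel) \<le>
      (\<integral>\<^sup>+x. \<integral>\<^sup>+y. ennreal (k (\<Phi> x - \<Phi> y) * (norm (H x) * norm (H y))) \<partial>M \<partial>M)" .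
    \<comment> \<open>One of the two terms of the weighted arithmetic-geometric mean; the other one is \<open>R y x\<close>.\<close>
    define R where "R x y = ennreal ((norm (H x))\<^sup>2 * w x) * (ennreal (k (\<Phi> x - \<Phi> y)) * ennreal (1 / w y))" for x y
    have [measurable]: "(\<lambda>(x, y). R x y) \<in> borel_measurable (M \<Otimes>\<^sub>M M)" unfolding R_def by measurable
    have R: "(\<integral>\<^sup>+x. \<integral>\<^sup>+y. R x y \<partial>M \<partial>M) \<le> ?B"
    proof -
      have "(\<integral>\<^sup>+y. R x y \<partial>M) \<le> ennreal ((norm (H x))\<^sup>2 * w x) * (D * ennreal ((2 * pi) ^ DIM('b)))" for x
        using push[of "\<lambda>s. ennreal (k (\<Phi> x - s))"] kint[of "\<Phi> x"]
        unfolding R_def by (subst nn_integral_cmult) (auto intro!: mult_left_mono)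
      then have "(\<integral>\<^sup>+x. \<integral>\<^sup>+y. R x y \<partial>M \<partial>M) \<le> (\<integral>\<^sup>+x. ennreal ((norm (H x))\<^sup>2 * w x) * (D * ennreal ((2 * pi) ^ DIM('b))) \<partial>M)"
        by (intro nn_integral_mono) auto
      also have "\<dots> = ?B" by (subst nn_integral_multc) (auto simp: mult_ac)
      finally show ?thesis .
    qed
    have "(\<integral>\<^sup>+x. \<integral>\<^sup>+y. ennreal (k (\<Phi> x - \<Phi> y) * (norm (H x) * norm (H y))) \<partial>M \<partial>M) \<le>
        (\<integral>\<^sup>+x. \<integral>\<^sup>+y. ennreal (1/2) * (R x y + R y x) \<partial>M \<partial>M)"
    proof (rule nn_integral_mono_AE, use w in eventually_elim)
      case (elim x)
      show ?case
      proof (rule nn_integral_mono_AE, use w in eventually_elim)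
        case (elim y)
        let ?h = "norm (H x)" and ?g = "norm (H y)" and ?k = "k (\<Phi> x - \<Phi> y)"
        have "?k * (?h * ?g) \<le> ?k * ((?h\<^sup>2 * w x / w y + ?g\<^sup>2 * w y / w x) / 2)"
          using weighted_amgm[OF \<open>0 < w x\<close> \<open>0 < w y\<close>, of ?h ?g] k by (intro mult_left_mono) (auto simp: less_imp_le)
        also have "\<dots> = (1/2) * ((?h\<^sup>2 * w x) * (?k * (1 / w y)) + (?g\<^sup>2 * w y) * (?k * (1 / w x)))"
          by (simp add: field_simps)
        finally have "ennreal (?k * (?h * ?g)) \<le> ennreal \<dots>" by (rule ennreal_leI)
        also have "\<dots> = ennreal (1/2) * (ennreal ((?h\<^sup>2 * w x) * (?k * (1 / w y))) + ennreal ((?g\<^sup>2 * w y) * (?k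
            * (1 / w x))))"
          using \<open>0 < w x\<close> \<open>0 < w y\<close> k[of "\<Phi> x - \<Phi> y"]
          by (subst ennreal_mult, simp, simp, subst ennreal_plus) (simp_all only: mult_nonneg_nonneg
              zero_le_power2 less_imp_le divide_nonneg_nonneg zero_le_one)
        also have "\<dots> = ennreal (1/2) * (R x y + R y x)"
          using \<open>0 < w x\<close> \<open>0 < w y\<close> k[of "\<Phi> x - \<Phi> y"]
          unfolding R_def ksym[of "\<Phi> y" "\<Phi> x"]
          by (simp only: ennreal_mult mult_nonneg_nonneg
              zero_le_power2 less_imp_le divide_nonneg_nonneg zero_le_one)
        finally show ?case .
      qed
    qed
    also have "\<dots> = ennreal (1/2) * ((\<integral>\<^sup>+x. \<integral>\<^sup>+y. R x y \<partial>M \<partial>M) + (\<integral>\<^sup>+x. \<integral>\<^sup>+y. R y x \<partial>M \<partial>M))"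
    proof -
      have [measurable]: "R x \<in> borel_measurable M" "(\<lambda>y. R y x) \<in> borel_measurable M" for x
        unfolding R_def by measurable
      have [measurable]: "(\<lambda>x. \<integral>\<^sup>+y. R x y \<partial>M) \<in> borel_measurable M" "(\<lambda>x. \<integral>\<^sup>+y. R y x \<partial>M) \<in> borel_measurable M"
        unfolding R_def by measurable
      show ?thesis by (simp add: nn_integral_cmult nn_integral_add)
    qed
    also have "(\<integral>\<^sup>+x. \<integral>\<^sup>+y. R y x \<partial>M \<partial>M) = (\<integral>\<^sup>+x. \<integral>\<^sup>+y. R x y \<partial>M \<partial>M)"
      by (rule MM.Fubini') measurable
    also have "ennreal (1/2) * ((\<integral>\<^sup>+x. \<integral>\<^sup>+y. R x y \<partial>M \<partial>M) + (\<integral>\<^sup>+x. \<integral>\<^sup>+y. R x y \<partial>M \<partial>M))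
       = (ennreal (1/2) * 2) * (\<integral>\<^sup>+x. \<integral>\<^sup>+y. R x y \<partial>M \<partial>M)"
      by (simp only: mult_2[symmetric] mult.assoc)
    also have "ennreal (1/2) * 2 = 1"
      using ennreal_mult[of "1/2" 2] by simp
    finally show ?thesis using A R by simp
  qed
  have "energy U \<le> ?B"
  proof (rule nn_integral_fatou_bound[where f="\<lambda>k \<tau>. ennreal ((norm (U \<tau>))\<^sup>2 * gauss (1 / real (Suc k)) \<tau>)"])
    have "(\<lambda>k. (norm (U \<tau>))\<^sup>2 * gauss (1 / real (Suc k)) \<tau>) \<longlonglongrightarrow> (norm (U \<tau>))\<^sup>2 * exp (- (0 * (norm \<tau>)\<^sup>2 / 2))" for \<tau>
      unfolding gauss_def by (intro tendsto_intros LIMSEQ_Suc[OF lim_1_over_n])  auto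
    then have "(\<lambda>k. ennreal ((norm (U \<tau>))\<^sup>2 * gauss (1 / real (Suc k)) \<tau>)) \<longlonglongrightarrow> ennreal ((norm (U \<tau>))\<^sup>2)" for \<tau>
      by (intro tendsto_ennrealI) simp
    then have "liminf (\<lambda>k. ennreal ((norm (U \<tau>))\<^sup>2 * gauss (1 / real (Suc k)) \<tau>)) = ennreal ((norm (U \<tau>))\<^sup>2)" for \<tau>
      by (intro lim_imp_Liminf) auto
    then show "AE \<tau> in lborel. ennreal ((norm (U \<tau>))\<^sup>2) \<le> liminf (\<lambda>k. ennreal ((norm (U \<tau>))\<^sup>2 * gauss (1 / real (Suc k)) \<tau>))"
      by (simp only: order_refl eventually_True)
    show "(\<integral>\<^sup>+\<tau>. ennreal ((norm (U \<tau>))\<^sup>2 * gauss (1 / real (Suc k)) \<tau>) \<partial>lborel) \<le> ?B" for k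
      by (rule regularised) simp
  qed simp
  then show ?thesis by (simp add: U_def)
qed

text \<open>The case \<open>\<Phi> = id\<close> with constant weight.\<close>

lemma plancherel_inequality:
  fixes G :: "'a::euclidean_space \<Rightarrow> complex"
  assumes G: "integrable lborel G"
  shows "(\<integral>\<^sup>+y. ennreal ((norm (LINT x|lborel. cis (y \<bullet> x) * G x))\<^sup>2) \<partial>lborel)
    \<le> ennreal ((2 * pi) ^ DIM('a)) * energy G"
  using bessel_inequality[of lborel "\<lambda>x. x" "\<lambda>_. 1" G 1] G by (simp add: lborel.sigma_finite_measure_axioms)

abbreviation time_profile :: "('a::euclidean_space \<Rightarrow> complex) \<Rightarrow> real \<Rightarrow> complex" where
  "time_profile H t \<equiv> LINT x|lborel. cis (t * norm x) * H x"

text \<open>The case \<open>\<Phi> = norm\<close>, with the weight \<open>|\<xi>|\<^sup>n\<^sup>-\<^sup>1\<close>: the image of \<open>|\<xi>|\<^sup>1\<^sup>-\<^sup>n d\<xi>\<close> is at most a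
  multiple of Lebesgue measure.\<close>

lemma time_plancherel_inequality:
  fixes H :: "'a::euclidean_space \<Rightarrow> complex"
  assumes H: "integrable lborel H"
  shows "(\<integral>\<^sup>+t. ennreal ((norm (time_profile H t))\<^sup>2) \<partial>lborel)
    \<le> ennreal (2 * pi * sphere_area TYPE('a)) *
       (\<integral>\<^sup>+x. ennreal ((norm (H x))\<^sup>2 * norm x powr (real DIM('a) - 1)) \<partial>lborel)"
proof -
  have *: "1 / norm x powr (real DIM('a) - 1) = norm x powr (1 - real DIM('a))" for x :: 'a
    by (simp add: powr_minus_divide[symmetric])
  have "AE x::'a in lborel. x \<noteq> 0" by (rule AE_lborel_singleton)
  then have "AE x::'a in lborel. norm x powr (real DIM('a) - 1) > 0" by eventually_elim simp
  from bessel_inequality[where \<Phi>="norm :: 'a \<Rightarrow> real" and M=lborel and H=H and D="ennreal (sphere_area TYPE('a))",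
      OF lborel.sigma_finite_measure_axioms _ _ H this]
  show ?thesis
    using nn_integral_radial_weighted_le[where 'a='a]
    by (simp add: * ennreal_mult sphere_area_pos less_imp_le del: ennreal_mult'')
qed

section \<open>Integrability in time at a fixed point\<close>

abbreviation weighted_energy :: "real \<Rightarrow> ('a::euclidean_space \<Rightarrow> complex) \<Rightarrow> ennreal" where
  "weighted_energy b F \<equiv> \<integral>\<^sup>+x. ennreal ((norm (F x))\<^sup>2 * norm x powr (2 * b)) \<partial>lborel"

text \<open>Cauchy-Schwarz with the factor \<open>|\<xi>|\<^sup>-\<^sup>b\<close>, whose square is integrable near the origin because
  \<open>2b < n\<close>.\<close>

lemma low_frequency_L1_bound:
  fixes F :: "'a::euclidean_space \<Rightarrow> complex"
  assumes [measurable]: "F \<in> borel_measurable borel" and b: "2 * b < real DIM('a)" and R: "R \<ge> 0"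
  shows "(\<integral>\<^sup>+x. ennreal (norm (if norm x \<le> R then F x else 0)) \<partial>lborel)\<^sup>2 \<le>
    weighted_energy b F *
    ennreal (sphere_area TYPE('a) * (R powr (real DIM('a) - 2 * b) / (real DIM('a) - 2 * b)))"
proof -
  have "(\<integral>\<^sup>+x. ennreal (norm (if norm x \<le> R then F x else 0)) \<partial>lborel) =
      (\<integral>\<^sup>+x. ennreal (norm (F x) * norm x powr b) * (ennreal (norm x powr (- b)) * indicator {..R} (norm x)) \<partial>lborel)"
    using AE_lborel_singleton[of "0::'a"]
    by (intro nn_integral_cong_AE, eventually_elim)
       (auto simp: indicator_def ennreal_mult[symmetric] powr_minus divide_simps)
  also have "\<dots>\<^sup>2 \<le> (\<integral>\<^sup>+x. (ennreal (norm (F x) * norm x powr b))\<^sup>2 \<partial>lborel) *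
      (\<integral>\<^sup>+x. (ennreal (norm (x::'a) powr (- b)) * indicator {..R} (norm x))\<^sup>2 \<partial>lborel)"
    by (rule Cauchy_Schwarz_nn_integral) auto
  also have "(\<integral>\<^sup>+x. (ennreal (norm (F x) * norm x powr b))\<^sup>2 \<partial>lborel) = weighted_energy b F"
  proof -
    have "(norm (F x) * norm x powr b)\<^sup>2 = (norm (F x))\<^sup>2 * norm x powr (2 * b)" for x
      by (simp add: power_mult_distrib power2_eq_square powr_add[symmetric])
    then show ?thesis by (simp add: ennreal_power)
  qed
  also have "(\<integral>\<^sup>+x. (ennreal (norm (x::'a) powr (- b)) * indicator {..R} (norm x))\<^sup>2 \<partial>lborel)
      = (\<integral>\<^sup>+x. ennreal (norm (x::'a) powr (- (2 * b))) * indicator {..R} (norm x) \<partial>lborel)"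
    by (intro nn_integral_cong) (auto simp add: power2_eq_square ennreal_mult[symmetric] powr_add[symmetric] indicator_def)
  also have "\<dots> = ennreal (sphere_area TYPE('a) * (R powr (real DIM('a) - 2 * b) / (real DIM('a) - 2 * b)))"
    using nn_integral_ball_norm_powr[where 'a='a, of "- (2 * b)" R] b R by simp
  finally show ?thesis .
qed

lemma powr_layer_cake:
  fixes u q :: real
  assumes "u \<ge> 0" "q > 0"
  shows "ennreal (u powr q) = (\<integral>\<^sup>+\<alpha>. ennreal (q * \<alpha> powr (q - 1)) * indicator {0..u} \<alpha> \<partial>lborel)"
proof -
  have "(\<integral>\<^sup>+\<alpha>. ennreal (q * \<alpha> powr (q - 1)) * indicator {0..u} \<alpha> \<partial>lborel)
      = (\<integral>\<^sup>+\<alpha>. ennreal q * (ennreal (\<alpha> powr (q - 1)) * indicator {0..u} \<alpha>) \<partial>lborel)"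
    using assms by (simp add: ennreal_mult mult.assoc)
  also have "\<dots> = ennreal q * ennreal (u powr q / q)"
    using assms by (subst nn_integral_cmult) (auto simp: nn_integral_powr_from_0)
  also have "\<dots> = ennreal (u powr q)"
    using assms by (simp add: ennreal_mult[symmetric])
  finally show ?thesis by simp
qed

lemma ennreal_mult3: "0 \<le> a \<Longrightarrow> 0 \<le> b \<Longrightarrow> ennreal a * (ennreal b * ennreal c) = ennreal (a * (b * c))"
  by (simp only: ennreal_mult' mult_nonneg_nonneg)

text \<open>Fix a level \<open>\<alpha>\<close>. By Cauchy-Schwarz the frequencies \<open>|\<xi>| \<le> \<Lambda>\<close> contribute at most
  \<open>A c \<Lambda>\<^bsup>1/q\<^esup>\<close>, since \<open>n - 2b = 2/q\<close>. With \<open>\<Lambda>(\<alpha>)\<close> chosen such that this is \<open>\<alpha>/2\<close>, the remaining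
  frequencies must contribute at least \<open>\<alpha>/2\<close> wherever \<open>|U| \<ge> \<alpha>\<close>, and Chebyshev's inequality with the
  \<open>L\<^sup>2\<close> bound measures the level set. In the integral over all levels each \<open>\<xi>\<close> only meets the levels
  \<open>\<alpha> \<le> 2 A c |\<xi>|\<^bsup>1/q\<^esup>\<close>; integrating \<open>\<alpha>\<^sup>q\<^sup>-\<^sup>3\<close> over them, which requires \<open>q > 2\<close>, yields the missing
  power \<open>|\<xi>|\<^bsup>1 - 2/q\<^esup>\<close> of the weight and the constant \<open>K\<close>.\<close>

lemma time_Lq_inequality:
  fixes q b A :: real and H :: "'a::euclidean_space \<Rightarrow> complex"
  defines "\<sigma> \<equiv> sphere_area TYPE('a)"
  defines "K \<equiv> 8 * pi * \<sigma> * q / (q - 2) * (2 * sqrt (\<sigma> * q / 2)) powr (q - 2)"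
  assumes q: "q > 2" and b: "b = real DIM('a) / 2 - 1 / q"
    and H: "integrable lborel H" and A: "A > 0"
    and HA: "weighted_energy b H \<le> ennreal (A\<^sup>2)"
  shows "(\<integral>\<^sup>+t. ennreal (norm (time_profile H t) powr q) \<partial>lborel) \<le> ennreal (K * A powr q)"
proof -
  let ?n = "real DIM('a)"
  note [measurable] = borel_measurable_integrable[OF H]
  define U where "U t = (time_profile H t)" for t
  have [measurable]: "U \<in> borel_measurable borel" unfolding U_def by measurable
  have \<sigma>: "\<sigma> > 0" unfolding \<sigma>_def by (rule sphere_area_pos)
  define c where "c = sqrt (\<sigma> * q / 2)"
  have c: "c > 0" using \<sigma> q by (simp add: c_def)
  \<comment> \<open>The radius at which the bound \<open>A c \<Lambda>\<^bsup>1/q\<^esup>\<close> of the low frequencies equals \<open>\<alpha> / 2\<close>.\<close>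
  define \<Lambda> where "\<Lambda> \<alpha> = (\<alpha> / (2 * A * c)) powr q" for \<alpha>
  have [measurable]: "\<Lambda> \<in> borel_measurable borel" unfolding \<Lambda>_def by measurable
  define hi where "hi \<alpha> x = (if norm x > \<Lambda> \<alpha> then H x else 0)" for \<alpha> x
  define lo where "lo \<alpha> x = (if norm x \<le> \<Lambda> \<alpha> then H x else 0)" for \<alpha> x
  have [measurable]: "(\<lambda>(\<alpha>, x). hi \<alpha> x) \<in> borel_measurable (borel \<Otimes>\<^sub>M borel)"
    "hi \<alpha> \<in> borel_measurable borel" "lo \<alpha> \<in> borel_measurable borel" for \<alpha>
    unfolding hi_def lo_def by measurable
  have ihi: "integrable lborel (hi \<alpha>)" and ilo: "integrable lborel (lo \<alpha>)" for \<alpha>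
    by (rule Bochner_Integration.integrable_bound[OF H]; simp add: hi_def lo_def)+
  have imult: "integrable lborel (\<lambda>x. cis (t * norm x) * F x)" if "integrable lborel F" for t and F :: "'a \<Rightarrow> complex"
    using borel_measurable_integrable[OF that]
    by (intro Bochner_Integration.integrable_bound[OF that]) (auto simp: norm_mult)
  define V where "V \<alpha> t = (LINT x|lborel. cis (t * norm x) * hi \<alpha> x)" for \<alpha> t
  have [measurable]: "V \<alpha> \<in> borel_measurable borel" for \<alpha> unfolding V_def by measurable
  have lo_bound: "norm (LINT x|lborel. cis (t * norm x) * lo \<alpha> x) \<le> \<alpha> / 2" if "\<alpha> > 0" for \<alpha> t
  proof -
    have "\<sigma> * (\<Lambda> \<alpha> powr (real DIM('a) - 2 * b) / (real DIM('a) - 2 * b)) = \<sigma> * ((\<alpha> / (2 * A * c))\<^sup>2 / (2 / q))"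
      using q A c that by (simp add: \<Lambda>_def b powr_powr powr_numeral)
    also have "\<dots> = \<alpha>\<^sup>2 / (4 * A\<^sup>2)"
    proof -
      have c2: "c\<^sup>2 = \<sigma> * q / 2" using \<sigma> q by (simp add: c_def)
      show ?thesis unfolding power_divide power_mult_distrib c2 using \<sigma> q A by (simp add: field_simps)
    qed
    finally have L: "\<sigma> * (\<Lambda> \<alpha> powr (real DIM('a) - 2 * b) / (real DIM('a) - 2 * b)) = \<alpha>\<^sup>2 / (4 * A\<^sup>2)" .
    have "(\<integral>\<^sup>+x. ennreal (norm (lo \<alpha> x)) \<partial>lborel)\<^sup>2 \<le>
       weighted_energy b H * ennreal (\<alpha>\<^sup>2 / (4 * A\<^sup>2))"
      unfolding L[symmetric] lo_def \<sigma>_def by (rule low_frequency_L1_bound) (use q in \<open>auto simp: b \<Lambda>_def\<close>)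
    also have "\<dots> \<le> ennreal (A\<^sup>2) * ennreal (\<alpha>\<^sup>2 / (4 * A\<^sup>2))"
      by (intro mult_right_mono HA) auto
    also have "\<dots> = ennreal ((\<alpha> / 2)\<^sup>2)"
      using A by (simp add: ennreal_mult[symmetric] power_divide)
    also have "(\<integral>\<^sup>+x. ennreal (norm (lo \<alpha> x)) \<partial>lborel) = ennreal (LINT x|lborel. norm (lo \<alpha> x))"
      using ilo by (intro nn_integral_eq_integral) auto
    finally have "(LINT x|lborel. norm (lo \<alpha> x))\<^sup>2 \<le> (\<alpha> / 2)\<^sup>2"
      by (simp add: ennreal_power)
    then have "(LINT x|lborel. norm (lo \<alpha> x)) \<le> \<alpha> / 2"
      by (rule power2_le_imp_le) (use that in linarith)
    moreover have "norm (LINT x|lborel. cis (t * norm x) * lo \<alpha> x) \<le> (LINT x|lborel. norm (lo \<alpha> x))"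
      using integral_norm_bound[of lborel "\<lambda>x. cis (t * norm x) * lo \<alpha> x"]
      by (simp only: norm_mult norm_cis mult_1)
    ultimately show ?thesis by linarith
  qed
  have level: "(\<integral>\<^sup>+t. indicator {0..norm (U t)} \<alpha> \<partial>lborel) \<le>
     ennreal (4 / \<alpha>\<^sup>2 * (2 * pi * \<sigma>)) * (\<integral>\<^sup>+x. ennreal ((norm (hi \<alpha> x))\<^sup>2 * norm x powr (?n - 1)) \<partial>lborel)"
    if \<alpha>: "\<alpha> > 0" for \<alpha>
  proof -
    have "indicator {0..norm (U t)} \<alpha> \<le> ennreal (4 / \<alpha>\<^sup>2) * ennreal ((norm (V \<alpha> t))\<^sup>2)" for t
    proof (cases "\<alpha> \<le> norm (U t)")
      case True
      have "U t = (LINT x|lborel. cis (t * norm x) * lo \<alpha> x + cis (t * norm x) * hi \<alpha> x)"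
        unfolding U_def by (intro Bochner_Integration.integral_cong) (auto simp: lo_def hi_def)
      also have "\<dots> = (LINT x|lborel. cis (t * norm x) * lo \<alpha> x) + V \<alpha> t"
        unfolding V_def by (intro Bochner_Integration.integral_add imult ihi ilo)
      finally have "norm (U t) \<le> norm (LINT x|lborel. cis (t * norm x) * lo \<alpha> x) + norm (V \<alpha> t)"
        by (simp add: norm_triangle_ineq)
      then have "\<alpha> / 2 \<le> norm (V \<alpha> t)" using lo_bound[OF \<alpha>, of t] True by linarith
      then have "(\<alpha> / 2)\<^sup>2 \<le> (norm (V \<alpha> t))\<^sup>2" using \<alpha> by (intro power_mono) auto
      then have "1 \<le> 4 / \<alpha>\<^sup>2 * (norm (V \<alpha> t))\<^sup>2" using \<alpha> by (simp add: field_simps)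
      then have "ennreal 1 \<le> ennreal (4 / \<alpha>\<^sup>2 * (norm (V \<alpha> t))\<^sup>2)" by (rule ennreal_leI)
      then show ?thesis using True \<alpha> by (simp add: ennreal_mult[symmetric])
    qed auto
    then have "(\<integral>\<^sup>+t. indicator {0..norm (U t)} \<alpha> \<partial>lborel) \<le> (\<integral>\<^sup>+t. ennreal (4 / \<alpha>\<^sup>2) * ennreal ((norm (V \<alpha> t))\<^sup>2) \<partial>lborel)"
      by (intro nn_integral_mono) auto
    also have "\<dots> = ennreal (4 / \<alpha>\<^sup>2) * (\<integral>\<^sup>+t. ennreal ((norm (V \<alpha> t))\<^sup>2) \<partial>lborel)"
      by (rule nn_integral_cmult) simp
    also have "\<dots> \<le> ennreal (4 / \<alpha>\<^sup>2) * (ennreal (2 * pi * \<sigma>)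
        * (\<integral>\<^sup>+x. ennreal ((norm (hi \<alpha> x))\<^sup>2 * norm x powr (?n - 1)) \<partial>lborel))"
      unfolding V_def \<sigma>_def by (intro mult_left_mono time_plancherel_inequality ihi) auto
    finally show ?thesis using \<sigma> by (simp only: ennreal_mult mult_nonneg_nonneg divide_nonneg_nonneg zero_le_power2 zero_le_numeral pi_ge_zero less_imp_le mult.assoc)
  qed
  let ?J = "\<lambda>\<alpha> x. ennreal (q * \<alpha> powr (q - 1)) * indicator {0<..} \<alpha> *
    (ennreal (4 / \<alpha>\<^sup>2 * (2 * pi * \<sigma>)) * ennreal ((norm (hi \<alpha> x))\<^sup>2 * norm x powr (?n - 1)))"
  have inner: "(\<integral>\<^sup>+\<alpha>. ?J \<alpha> x \<partial>lborel)
    \<le> ennreal (K * A powr (q - 2)) * ennreal ((norm (H x))\<^sup>2 * norm x powr (2 * b))" for x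
  proof -
    define M where "M = 2 * A * c * norm x powr (1 / q)"
    have M0: "M \<ge> 0" using A c by (simp add: M_def)
    define D where "D = 8 * pi * \<sigma> * q * ((norm (H x))\<^sup>2 * norm x powr (?n - 1))"
    have D0: "D \<ge> 0" using \<sigma> q by (simp add: D_def)
    have "(\<integral>\<^sup>+\<alpha>. ?J \<alpha> x \<partial>lborel)
      \<le> (\<integral>\<^sup>+\<alpha>. ennreal D * (ennreal (\<alpha> powr (q - 3)) * indicator {0..M} \<alpha>) \<partial>lborel)"
    proof (rule nn_integral_mono)
      fix \<alpha> :: real
      show "?J \<alpha> x \<le> ennreal D * (ennreal (\<alpha> powr (q - 3)) * indicator {0..M} \<alpha>)"
      proof (cases "\<alpha> > 0 \<and> norm x > \<Lambda> \<alpha>")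
        case True
        have "\<alpha> / (2 * A * c) = \<Lambda> \<alpha> powr (1 / q)"
          using True A c q by (simp add: \<Lambda>_def powr_powr)
        also have "\<dots> \<le> norm x powr (1 / q)" using True q by (intro powr_mono2) (auto simp: \<Lambda>_def)
        finally have "\<alpha> \<le> M" using A c by (simp add: M_def field_simps)
        moreover have "\<alpha> powr (q - 1) = \<alpha> powr (q - 3) * \<alpha>\<^sup>2"
          using True by (simp add: powr_numeral[symmetric] powr_add[symmetric] del: powr_numeral)
        then have "q * \<alpha> powr (q - 1) * (4 / \<alpha>\<^sup>2 * (2 * pi * \<sigma>) * ((norm (H x))\<^sup>2 * norm x powr (?n - 1)))
            = D * \<alpha> powr (q - 3)"
          using True by (simp add: D_def field_simps)
        then have "ennreal (q * \<alpha> powr (q - 1)) * (ennreal (4 / \<alpha>\<^sup>2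
            * (2 * pi * \<sigma>)) * ennreal ((norm (H x))\<^sup>2 * norm x powr (?n - 1))) = ennreal D * ennreal (\<alpha> powr (q - 3))"
          using ennreal_mult3[of "q * \<alpha> powr (q - 1)" "4 / \<alpha>\<^sup>2 * (2 * pi * \<sigma>)" "(norm (H x))\<^sup>2 * norm x powr (?n - 1)"]
            ennreal_mult'[OF D0, of "\<alpha> powr (q - 3)"] q \<sigma> by simp
        ultimately show ?thesis using True by (simp add: hi_def)
      qed (auto simp: hi_def)
    qed
    also have "\<dots> = ennreal D * ennreal (M powr (q - 2) / (q - 2))"
      using q M0 nn_integral_powr_from_0[of "q - 3" M] by (subst nn_integral_cmult) auto
    also have "\<dots> = ennreal (D * (M powr (q - 2) / (q - 2)))"
      using q M0 D0 by (subst ennreal_mult) auto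
    also have "D * (M powr (q - 2) / (q - 2)) = (K * A powr (q - 2)) * ((norm (H x))\<^sup>2 * norm x powr (2 * b))"
    proof -
      have "2 * b = (?n - 1) + 1 / q * (q - 2)" using q by (simp add: b field_simps)
      then have "norm x powr (2 * b) = norm x powr (?n - 1) * norm x powr (1 / q * (q - 2))"
        by (simp only: powr_add)
      moreover have "M powr (q - 2) = (2 * c) powr (q - 2) * A powr (q - 2) * norm x powr (1 / q * (q - 2))"
        using A c unfolding M_def by (simp add: powr_mult powr_powr mult_ac)
      ultimately show ?thesis unfolding D_def K_def c_def[symmetric] by simp
    qed
    also have "ennreal \<dots> = ennreal (K * A powr (q - 2)) * ennreal ((norm (H x))\<^sup>2 * norm x powr (2 * b))"
      using q \<sigma> by (intro ennreal_mult) (auto simp: K_def)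
    finally show ?thesis .
  qed
  have "(\<integral>\<^sup>+t. ennreal (norm (U t) powr q) \<partial>lborel)
      = (\<integral>\<^sup>+t. \<integral>\<^sup>+\<alpha>. ennreal (q * \<alpha> powr (q - 1)) * indicator {0..norm (U t)} \<alpha> \<partial>lborel \<partial>lborel)"
    using q by (simp add: powr_layer_cake)
  also have "\<dots> = (\<integral>\<^sup>+\<alpha>. \<integral>\<^sup>+t. ennreal (q * \<alpha> powr (q - 1)) * indicator {0..norm (U t)} \<alpha> \<partial>lborel \<partial>lborel)"
    unfolding indicator_def atLeastAtMost_iff of_bool_def by (rule lborel_pair.Fubini') measurable
  also have "\<dots> \<le> (\<integral>\<^sup>+\<alpha>. \<integral>\<^sup>+x. ?J \<alpha> x \<partial>lborel \<partial>lborel)"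
  proof (rule nn_integral_mono)
    fix \<alpha> :: real
    have "(\<integral>\<^sup>+t. ennreal (q * \<alpha> powr (q - 1)) * indicator {0..norm (U t)} \<alpha> \<partial>lborel)
        = ennreal (q * \<alpha> powr (q - 1)) * (\<integral>\<^sup>+t. indicator {0..norm (U t)} \<alpha> \<partial>lborel)"
      unfolding indicator_def atLeastAtMost_iff of_bool_def by (rule nn_integral_cmult) measurable
    also have "\<dots> \<le> ennreal (q * \<alpha> powr (q - 1)) * indicator {0<..} \<alpha> * (ennreal (4 / \<alpha>\<^sup>2 * (2 * pi * \<sigma>)) *
      (\<integral>\<^sup>+x. ennreal ((norm (hi \<alpha> x))\<^sup>2 * norm x powr (?n - 1)) \<partial>lborel))"
    proof (cases "\<alpha> > 0")
      case True
      then show ?thesis using mult_left_mono[OF level[OF True], of "ennreal (q * \<alpha> powr (q - 1))"] by simp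
    next
      case False
      then have "ennreal (q * \<alpha> powr (q - 1)) = 0 \<or> \<alpha> < 0" using q by (cases "\<alpha> = 0") auto
      then show ?thesis by auto
    qed
    also have "\<dots> = (\<integral>\<^sup>+x. ?J \<alpha> x \<partial>lborel)"
      by (simp add: nn_integral_cmult)
    finally show "(\<integral>\<^sup>+t. ennreal (q * \<alpha> powr (q - 1)) * indicator {0..norm (U t)} \<alpha> \<partial>lborel) \<le> \<dots>" .
  qed
  also have "\<dots> = (\<integral>\<^sup>+x. \<integral>\<^sup>+\<alpha>. ?J \<alpha> x \<partial>lborel \<partial>lborel)"
    by (rule lborel_pair.Fubini') measurable
  also have "\<dots> \<le> (\<integral>\<^sup>+x. ennreal (K * A powr (q - 2)) * ennreal ((norm (H x))\<^sup>2 * norm x powr (2 * b)) \<partial>lborel)"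
    by (rule nn_integral_mono) (rule inner)
  also have "\<dots> = ennreal (K * A powr (q - 2)) * weighted_energy b H"
    by (rule nn_integral_cmult) measurable
  also have "\<dots> \<le> ennreal (K * A powr (q - 2)) * ennreal (A\<^sup>2)"
    by (intro mult_left_mono HA) auto
  also have "\<dots> = ennreal (K * A powr q)"
  proof -
    have "A powr (q - 2) * A\<^sup>2 = A powr q"
      using A by (simp add: powr_numeral[symmetric] powr_add[symmetric] del: powr_numeral)
    then show ?thesis using q \<sigma> by (subst ennreal_mult[symmetric]) (auto simp: K_def mult.assoc)
  qed
  finally show ?thesis by (simp add: U_def)
qed

text \<open>The value \<open>A = 0\<close> is treated apart, because the radius in the proof for \<open>q > 2\<close> depends on
  \<open>1 / A\<close>.\<close>

theorem time_norm_bound: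
  fixes q b :: real
  assumes q: "q \<ge> 2" and b: "b = real DIM('a::euclidean_space) / 2 - 1 / q"
  shows "\<exists>C>0. \<forall>(H :: 'a \<Rightarrow> complex) A. integrable lborel H \<longrightarrow> A \<ge> 0 \<longrightarrow>
    weighted_energy b H \<le> ennreal (A\<^sup>2) \<longrightarrow>
    (\<integral>\<^sup>+t. ennreal (norm (time_profile H t) powr q) \<partial>lborel) \<le> ennreal ((C * A) powr q)"
proof -
  let ?T = "\<lambda>(H :: 'a \<Rightarrow> complex) t. LINT x|lborel. cis (t * norm x) * H x"
  let ?N = "\<lambda>H :: 'a \<Rightarrow> complex. \<integral>\<^sup>+x. ennreal ((norm (H x))\<^sup>2 * norm x powr (2 * b)) \<partial>lborel"
  let ?\<sigma> = "sphere_area TYPE('a)"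
  have \<sigma>: "?\<sigma> > 0" by (rule sphere_area_pos)
  have "\<exists>C>0. \<forall>H A. integrable lborel H \<longrightarrow> A > 0 \<longrightarrow> ?N H \<le> ennreal (A\<^sup>2) \<longrightarrow>
      (\<integral>\<^sup>+t. ennreal (norm (?T H t) powr q) \<partial>lborel) \<le> ennreal ((C * A) powr q)"
  proof (cases "q = 2")
    case True
    show ?thesis
    proof (intro exI[of _ "sqrt (2 * pi * ?\<sigma>)"] conjI allI impI)
      fix H :: "'a \<Rightarrow> complex" and A :: real
      assume H: "integrable lborel H" and A: "A > 0" and N: "?N H \<le> ennreal (A\<^sup>2)"
      have "2 * b = real DIM('a) - 1" using True by (simp add: b)
      then have "(\<integral>\<^sup>+t. ennreal ((norm (?T H t))\<^sup>2) \<partial>lborel) \<le> ennreal (2 * pi * ?\<sigma>) * ?N H"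
        using time_plancherel_inequality[OF H] by simp
      also have "\<dots> \<le> ennreal (2 * pi * ?\<sigma>) * ennreal (A\<^sup>2)" using N by (rule mult_left_mono) simp
      also have "\<dots> = ennreal ((sqrt (2 * pi * ?\<sigma>) * A) powr q)"
        using \<sigma> A True by (simp add: powr_numeral power_mult_distrib ennreal_mult)
      finally show "(\<integral>\<^sup>+t. ennreal (norm (?T H t) powr q) \<partial>lborel) \<le> ennreal ((sqrt (2 * pi * ?\<sigma>) * A) powr q)"
        using True by (simp add: powr_numeral)
    qed (use \<sigma> in simp)
  next
    case False
    with q have q2: "q > 2" by simp
    define K where "K = 8 * pi * ?\<sigma> * q / (q - 2) * (2 * sqrt (?\<sigma> * q / 2)) powr (q - 2)"
    have K: "K > 0" using \<sigma> q2 by (simp add: K_def)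
    show ?thesis
    proof (intro exI[of _ "K powr (1 / q)"] conjI allI impI)
      fix H :: "'a \<Rightarrow> complex" and A :: real
      assume H: "integrable lborel H" and A: "A > 0" and N: "?N H \<le> ennreal (A\<^sup>2)"
      have "(K powr (1 / q) * A) powr q = K * A powr q"
        using K A q2 by (simp add: powr_mult powr_powr)
      then show "(\<integral>\<^sup>+t. ennreal (norm (?T H t) powr q) \<partial>lborel) \<le> ennreal ((K powr (1 / q) * A) powr q)"
        using time_Lq_inequality[OF q2 b H A N] by (simp add: K_def)
    qed (use K in simp)
  qed
  then obtain C where C: "C > 0" and bound: "\<And>H A. integrable lborel H \<Longrightarrow> A > 0 \<Longrightarrow> ?N H \<le> ennreal (A\<^sup>2) \<Longrightarrow>
      (\<integral>\<^sup>+t. ennreal (norm (?T H t) powr q) \<partial>lborel) \<le> ennreal ((C * A) powr q)" by blast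
  show ?thesis
  proof (intro exI[of _ C] conjI allI impI C)
    fix H :: "'a \<Rightarrow> complex" and A :: real
    assume H: "integrable lborel H" and A: "A \<ge> 0" and N: "?N H \<le> ennreal (A\<^sup>2)"
    show "(\<integral>\<^sup>+t. ennreal (norm (?T H t) powr q) \<partial>lborel) \<le> ennreal ((C * A) powr q)"
    proof (cases "A = 0")
      case False
      with A bound[OF H _ N] show ?thesis by simp
    next
      case True
      have [measurable]: "H \<in> borel_measurable borel" using borel_measurable_integrable[OF H] by simp
      have "AE x in lborel. ennreal ((norm (H x))\<^sup>2 * norm x powr (2 * b)) = 0"
        using N True by (subst nn_integral_0_iff_AE[symmetric]) auto
      with AE_lborel_singleton[of "0::'a"] have "AE x in lborel. H x = 0"
        by eventually_elim (auto simp: ennreal_eq_0_iff mult_le_0_iff)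
      then have "AE x in lborel. cis (t * norm x) * H x = 0" for t by eventually_elim simp
      then have "?T H t = 0" for t by (rule integral_eq_zero_AE)
      then show ?thesis by simp
    qed
  qed
qed

section \<open>Rapidly decreasing and tempered functions\<close>

text \<open>The decay of Schwartz functions without their smoothness. It is all that is needed for the
  pairing with a tempered function, and Fourier transforms of Schwartz functions have it.\<close>

definition rapid :: "('a::euclidean_space \<Rightarrow> complex) \<Rightarrow> bool" where
  "rapid \<psi> \<longleftrightarrow> \<psi> \<in> borel_measurable borel \<and> (\<forall>N::nat. \<exists>C. \<forall>x. norm (\<psi> x) * (1 + norm x) ^ N \<le> C)"

text \<open>Decay in the form of the definition of Schwartz functions, by \<open>1 + r \<le> 2 max 1 r\<close>.\<close>

lemma rapidI:
  fixes \<psi> :: "'a::euclidean_space \<Rightarrow> complex"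
  assumes "\<psi> \<in> borel_measurable borel"
    and "\<And>k::nat. \<exists>C. \<forall>x. norm x ^ k * norm (\<psi> x) \<le> C"
  shows "rapid \<psi>"
  unfolding rapid_def
proof (intro conjI allI assms(1))
  fix N :: nat
  from assms(2) obtain C where C: "\<And>k x. norm x ^ k * norm (\<psi> x) \<le> C k" by metis
  show "\<exists>C. \<forall>x. norm (\<psi> x) * (1 + norm x) ^ N \<le> C"
  proof (intro exI allI)
    fix x :: 'a
    have "(1 + norm x) ^ N \<le> (2 * max 1 (norm x)) ^ N" by (intro power_mono) auto
    also have "\<dots> \<le> 2 ^ N * (1 + norm x ^ N)"
      unfolding power_mult_distrib by (intro mult_left_mono) (auto simp: max_def)
    finally have "norm (\<psi> x) * (1 + norm x) ^ N \<le> norm (\<psi> x) * (2 ^ N * (1 + norm x ^ N))"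
      by (intro mult_left_mono) auto
    also have "\<dots> = 2 ^ N * (norm x ^ 0 * norm (\<psi> x) + norm x ^ N * norm (\<psi> x))" by (simp add: algebra_simps)
    also have "\<dots> \<le> 2 ^ N * (C 0 + C N)" by (intro mult_left_mono add_mono C) auto
    finally show "norm (\<psi> x) * (1 + norm x) ^ N \<le> 2 ^ N * (C 0 + C N)" .
  qed
qed

lemma of_real_one_plus_norm_power_neq_0: "complex_of_real ((1 + norm x) ^ N) \<noteq> 0"
  unfolding of_real_eq_0_iff by (simp add: add_nonneg_eq_0_iff)

lemma rapid_measurable: "rapid \<psi> \<Longrightarrow> \<psi> \<in> borel_measurable borel"
  by (simp add: rapid_def)

lemma rapid_bound:
  fixes N :: nat
  assumes "rapid \<psi>"
  obtains C where "C > 0" "\<And>x. norm (\<psi> x) * (1 + norm x) ^ N \<le> C"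
proof -
  from assms obtain C where "\<And>x. norm (\<psi> x) * (1 + norm x) ^ N \<le> C" unfolding rapid_def by metis
  then show thesis by (intro that[of "max C 1"]) (auto simp: le_max_iff_disj)
qed

lemma integrable_temperate_mult:
  fixes \<psi> :: "'a::euclidean_space \<Rightarrow> complex"
  assumes "temperate h" "rapid \<psi>"
  shows "integrable lborel (\<lambda>x. h x * \<psi> x)"
proof -
  from assms obtain N where N: "integrable lborel (\<lambda>x. h x / of_real ((1 + norm x) ^ N))"
    unfolding temperate_def by blast
  from assms(2) obtain C where C: "C > 0" "\<And>x. norm (\<psi> x) * (1 + norm x) ^ N \<le> C" using rapid_bound[where N=N] by blast
  note [measurable] = rapid_measurable[OF assms(2)] borel_measurable_integrable[OF N]
  have cancel: "c \<noteq> 0 \<Longrightarrow> a * b = (a / c) * (b * c)" for a b c :: complex by simp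
  have eq: "h x * \<psi> x = (h x / of_real ((1 + norm x) ^ N)) * (\<psi> x * of_real ((1 + norm x) ^ N))" for x
    by (rule cancel) (rule of_real_one_plus_norm_power_neq_0)
  show ?thesis
    unfolding eq
  proof (rule Bochner_Integration.integrable_bound)
    show "integrable lborel (\<lambda>x. of_real C * (h x / of_real ((1 + norm x) ^ N)))"
      using N by (rule integrable_mult_right)
    show "AE x in lborel. norm ((h x / of_real ((1 + norm x) ^ N)) * (\<psi> x * of_real ((1 + norm x) ^ N)))
        \<le> norm (of_real C * (h x / of_real ((1 + norm x) ^ N)))"
    proof (rule AE_I2)
      fix x
      have "norm (\<psi> x * of_real ((1 + norm x) ^ N)) \<le> norm (complex_of_real C)"
        using C(1) C(2)[of x] by (simp only: norm_mult norm_of_real abs_of_pos) simp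
      then show "norm ((h x / of_real ((1 + norm x) ^ N)) * (\<psi> x * of_real ((1 + norm x) ^ N)))
        \<le> norm (of_real C * (h x / of_real ((1 + norm x) ^ N)))"
        unfolding norm_mult[of "h x / _"] norm_mult[of "of_real C"]
        by (simp only: mult.commute[of "norm (of_real C)"] mult_left_mono norm_ge_zero)
    qed
  qed measurable
qed

lemma temperate_measurable:
  assumes "temperate h"
  shows "h \<in> borel_measurable borel"
proof -
  from assms obtain N where N: "integrable lborel (\<lambda>x. h x / of_real ((1 + norm x) ^ N))"
    unfolding temperate_def by blast
  have "(\<lambda>x. (h x / of_real ((1 + norm x) ^ N)) * of_real ((1 + norm x) ^ N)) \<in> borel_measurable borel"
    using borel_measurable_integrable[OF N] by measurable
  moreover have "(h x / of_real ((1 + norm x) ^ N)) * of_real ((1 + norm x) ^ N) = h x" for x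
    using of_real_one_plus_norm_power_neq_0[of x N] by (simp add: field_simps del: of_real_power of_real_add)
  ultimately show ?thesis by simp
qed

lemma temperate_integrableI:
  "integrable lborel h \<Longrightarrow> temperate h"
  unfolding temperate_def by (intro exI[of _ 0]) simp

text \<open>Domination transfers temperateness; in particular multipliers of modulus one preserve it.\<close>

lemma temperate_bound:
  assumes g: "temperate g" and [measurable]: "f \<in> borel_measurable borel"
    and le: "AE x in lborel. norm (f x) \<le> norm (g x)"
  shows "temperate f"
proof -
  from g obtain N where N: "integrable lborel (\<lambda>x. g x / of_real ((1 + norm x) ^ N))"
    unfolding temperate_def by blast
  have "integrable lborel (\<lambda>x. f x / of_real ((1 + norm x) ^ N))"
  proof (rule Bochner_Integration.integrable_bound[OF N])
    show "AE x in lborel. norm (f x / of_real ((1 + norm x) ^ N)) \<le> norm (g x / of_real ((1 + norm x) ^ N))"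
      using le by eventually_elim (simp only: norm_divide divide_right_mono norm_ge_zero)
  qed measurable
  then show ?thesis unfolding temperate_def by blast
qed

lemma temperate_const: "temperate (\<lambda>x::'a::euclidean_space. c)"
  unfolding temperate_def
proof
  have "integrable lborel (\<lambda>x::'a. c * (1 / of_real ((1 + norm x) ^ (DIM('a) + 1))))"
    using integrable_of_real[OF integrable_inverse_power_norm[where 'a='a], where 'a=complex]
    by (intro integrable_mult_right) (simp only: of_real_divide of_real_1)
  then show "integrable lborel (\<lambda>x::'a. c / of_real ((1 + norm x) ^ (DIM('a) + 1)))"
    by (simp only: times_divide_eq_right mult_1_right)
qed

lemma temperate_add:
  fixes f g :: "'a::euclidean_space \<Rightarrow> complex"
  assumes f: "temperate f" and g: "temperate g"
  shows "temperate (\<lambda>x. f x + g x)"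
proof -
  note [measurable] = temperate_measurable[OF f] temperate_measurable[OF g]
  from f g obtain M N where M: "integrable lborel (\<lambda>x. f x / of_real ((1 + norm x) ^ M))"
    and N: "integrable lborel (\<lambda>x. g x / of_real ((1 + norm x) ^ N))"
    unfolding temperate_def by blast
  have gen: "integrable lborel (\<lambda>x. h x / of_real ((1 + norm x) ^ L))"
    if "integrable lborel (\<lambda>x. h x / of_real ((1 + norm x) ^ K))" "K
        \<le> L" "h \<in> borel_measurable borel" for h :: "'a \<Rightarrow> complex" and K L :: nat
  proof (rule Bochner_Integration.integrable_bound[OF that(1)])
    show "AE x in lborel. norm (h x / of_real ((1 + norm x) ^ L)) \<le> norm (h x / of_real ((1 + norm x) ^ K))"
    proof (rule AE_I2)
      fix x :: 'a
      have "(1 + norm x) ^ K \<le> (1 + norm x) ^ L" using that(2) by (intro power_increasing) auto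
      then show "norm (h x / of_real ((1 + norm x) ^ L)) \<le> norm (h x / of_real ((1 + norm x) ^ K))"
        unfolding norm_divide norm_of_real by (intro divide_left_mono) (auto simp: add_pos_nonneg intro!: mult_pos_pos)
    qed
  qed (use that(3) in measurable)
  have "integrable lborel (\<lambda>x. f x / of_real ((1 + norm x) ^ max M N) + g x / of_real ((1 + norm x) ^ max M N))"
    by (intro Bochner_Integration.integrable_add gen[OF M] gen[OF N]) auto
  then show ?thesis unfolding temperate_def by (intro exI[of _ "max M N"]) (simp only: add_divide_distrib)
qed

lemma rapid_integrable: "rapid \<psi> \<Longrightarrow> integrable lborel \<psi>"
  using integrable_temperate_mult[OF temperate_const[of 1], of \<psi>] by simp

lemma rapid_bounded_mult:
  assumes "rapid \<psi>" and [measurable]: "f \<in> borel_measurable borel" and "\<And>x. norm (f x) \<le> B"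
  shows "rapid (\<lambda>x. f x * \<psi> x)"
  unfolding rapid_def
proof (intro conjI allI)
  note [measurable] = rapid_measurable[OF assms(1)]
  show "(\<lambda>x. f x * \<psi> x) \<in> borel_measurable borel" by measurable
  fix N
  from assms(1) obtain C where C: "C > 0" "\<And>x. norm (\<psi> x) * (1 + norm x) ^ N \<le> C" using rapid_bound[where N=N] by blast
  show "\<exists>C. \<forall>x. norm (f x * \<psi> x) * (1 + norm x) ^ N \<le> C"
  proof (intro exI allI)
    fix x
    have "norm (f x * \<psi> x) * (1 + norm x) ^ N = norm (f x) * (norm (\<psi> x) * (1 + norm x) ^ N)"
      by (simp add: norm_mult)
    also have "\<dots> \<le> B * C"
      using assms(3)[of x] C by (intro mult_mono) (auto intro: order_trans[OF norm_ge_zero])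
    finally show "norm (f x * \<psi> x) * (1 + norm x) ^ N \<le> B * C" .
  qed
qed

lemma one_plus_norm_submult: "1 + norm (x + y) \<le> (1 + norm x) * (1 + norm (y::'a::real_normed_vector))"
proof -
  have "1 + norm (x + y) \<le> 1 + norm x + norm y + norm x * norm y"
    using norm_triangle_ineq[of x y] by (simp add: add_increasing2)
  then show ?thesis by (simp add: algebra_simps)
qed

lemma one_plus_norm_power_submult:
  "(1 + norm (x + y)) ^ N \<le> (1 + norm x) ^ N * (1 + norm (y::'a::real_normed_vector)) ^ N"
  unfolding power_mult_distrib[symmetric] by (intro power_mono one_plus_norm_submult) simp

lemma rapid_translate:
  assumes "rapid \<psi>"
  shows "rapid (\<lambda>x. \<psi> (x - y))"
  unfolding rapid_def
proof (intro conjI allI)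
  note [measurable] = rapid_measurable[OF assms(1)]
  show "(\<lambda>x. \<psi> (x - y)) \<in> borel_measurable borel" by measurable
  fix N
  from assms(1) obtain C where C: "C > 0" "\<And>x. norm (\<psi> x) * (1 + norm x) ^ N \<le> C" using rapid_bound[where N=N] by blast
  show "\<exists>C. \<forall>x. norm (\<psi> (x - y)) * (1 + norm x) ^ N \<le> C"
  proof (intro exI allI)
    fix x
    have "norm (\<psi> (x - y)) * (1 + norm x) ^ N \<le> norm (\<psi> (x - y)) * ((1 + norm (x - y)) ^ N * (1 + norm y) ^ N)"
      using one_plus_norm_power_submult[of "x - y" y N] by (intro mult_left_mono) auto
    also have "\<dots> \<le> C * (1 + norm y) ^ N"
      unfolding mult.assoc[symmetric] by (intro mult_right_mono C) auto
    finally show "norm (\<psi> (x - y)) * (1 + norm x) ^ N \<le> C * (1 + norm y) ^ N" .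
  qed
qed

text \<open>From \<open>1 + r \<le> exp r\<close>, the left side is at most \<open>exp (N r - a r\<^sup>2 / 2)\<close>; complete the square.\<close>

lemma power_mult_gauss_bound:
  fixes r :: real
  assumes "a > 0" "r \<ge> 0"
  shows "(1 + r) ^ N * exp (- (a * r\<^sup>2 / 2)) \<le> exp ((real N)\<^sup>2 / (2 * a))"
proof -
  have "(1 + r) ^ N \<le> exp r ^ N" using assms by (intro power_mono) auto
  also have "\<dots> = exp (real N * r)" by (simp add: exp_of_nat_mult)
  finally have "(1 + r) ^ N * exp (- (a * r\<^sup>2 / 2)) \<le> exp (real N * r) * exp (- (a * r\<^sup>2 / 2))"
    by (intro mult_right_mono) auto
  also have "\<dots> = exp (real N * r - a * r\<^sup>2 / 2)" unfolding exp_add[symmetric] by simp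
  also have "real N * r - a * r\<^sup>2 / 2 \<le> (real N)\<^sup>2 / (2 * a)"
  proof -
    have "0 \<le> (real N - a * r)\<^sup>2 / (2 * a)" using assms by simp
    also have "\<dots> = (real N)\<^sup>2 / (2 * a) - (real N * r - a * r\<^sup>2 / 2)"
      using assms by (simp add: power2_eq_square field_simps)
    finally show ?thesis by simp
  qed
  finally show ?thesis by simp
qed

lemma rapid_gauss:
  assumes "a > 0"
  shows "rapid (\<lambda>x::'a::euclidean_space. of_real (gauss a x))"
  unfolding rapid_def
proof (rule conjI)
  show "(\<lambda>x::'a. complex_of_real (gauss a x)) \<in> borel_measurable borel" by measurable
  show "\<forall>N. \<exists>C. \<forall>x::'a. norm (complex_of_real (gauss a x)) * (1 + norm x) ^ N \<le> C"
  proof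
    fix N
    have "norm (complex_of_real (gauss a x)) * (1 + norm x) ^ N \<le> exp ((real N)\<^sup>2 / (2 * a))" for x :: 'a
      using power_mult_gauss_bound[OF assms norm_ge_zero, of x N]
      by (simp only: gauss_def norm_of_real abs_exp_cancel mult.commute)
    then show "\<exists>C. \<forall>x::'a. norm (complex_of_real (gauss a x)) * (1 + norm x) ^ N \<le> C" by (intro exI allI)
  qed
qed

lemma rapid_modulated_gauss:
  fixes y z :: "'a::euclidean_space"
  assumes "a > 0"
  shows "rapid (\<lambda>x. cis (x \<bullet> z) * of_real (gauss a (x - y)))"
proof (rule rapid_bounded_mult)
  show "rapid (\<lambda>x. complex_of_real (gauss a (x - y)))"
    by (rule rapid_translate[OF rapid_gauss[OF assms]])
  show "(\<lambda>x. cis (x \<bullet> z)) \<in> borel_measurable borel" by measurable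
  show "norm (cis (x \<bullet> z)) \<le> 1" for x by simp
qed

section \<open>Fourier transforms of Schwartz functions\<close>

lemma iter_deriv_append: "iter_deriv ws (iter_deriv vs \<phi>) = iter_deriv (ws @ vs) \<phi>"
  by (induction ws) auto

lemma schwartz_iter_deriv:
  fixes \<phi> :: "'a::euclidean_space \<Rightarrow> complex"
  assumes "\<phi> \<in> schwartz" "vs \<in> lists Basis"
  shows "iter_deriv vs \<phi> \<in> schwartz"
  unfolding schwartz_def
proof (intro CollectI ballI)
  fix ws :: "'a list" assume "ws \<in> lists Basis"
  then have "ws @ vs \<in> lists Basis" using assms(2) by simp
  then show "iter_deriv ws (iter_deriv vs \<phi>) differentiable_on UNIV \<and>
      (\<forall>k. bounded (range (\<lambda>x. norm x ^ k *\<^sub>R iter_deriv ws (iter_deriv vs \<phi>) x)))"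
    using assms(1) unfolding schwartz_def iter_deriv_append by blast
qed

lemma schwartz_derivative:
  assumes "\<phi> \<in> schwartz" "v \<in> Basis"
  shows "(\<lambda>x. frechet_derivative \<phi> (at x) v) \<in> schwartz"
  using schwartz_iter_deriv[OF assms(1), of "[v]"] assms(2) by simp

lemma schwartz_differentiable:
  assumes "\<phi> \<in> schwartz"
  shows "\<phi> differentiable (at x)"
proof -
  have "iter_deriv [] \<phi> differentiable_on UNIV" using assms unfolding schwartz_def by blast
  then show ?thesis by (simp add: differentiable_on_def)
qed

lemma schwartz_continuous: "\<phi> \<in> schwartz \<Longrightarrow> continuous_on UNIV \<phi>"
  by (simp add: continuous_at_imp_continuous_on differentiable_imp_continuous_within schwartz_differentiable)

lemma rapid_schwartz:
  assumes "\<phi> \<in> schwartz"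
  shows "rapid \<phi>"
proof (rule rapidI)
  show "\<phi> \<in> borel_measurable borel"
    by (rule borel_measurable_continuous_onI[OF schwartz_continuous[OF assms]])
  fix k :: nat
  have "bounded (range (\<lambda>x. norm x ^ k *\<^sub>R iter_deriv [] \<phi> x))"
    using assms unfolding schwartz_def by blast
  then show "\<exists>C. \<forall>x. norm x ^ k * norm (\<phi> x) \<le> C" by (auto simp: bounded_iff norm_power)
qed

lemma schwartz_integrable: "\<phi> \<in> schwartz \<Longrightarrow> integrable lborel \<phi>"
  by (intro rapid_integrable rapid_schwartz)

lemma integrable_cis_mult:
  fixes G :: "'a::euclidean_space \<Rightarrow> complex"
  assumes "integrable lborel G" and [measurable]: "f \<in> borel_measurable borel"
  shows "integrable lborel (\<lambda>x. cis (f x) * G x)"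
  using borel_measurable_integrable[OF assms(1)]
  by (intro Bochner_Integration.integrable_bound[OF assms(1)]) (auto simp: norm_mult)

lemma integral_lborel_translate:
  fixes f :: "'a::euclidean_space \<Rightarrow> complex"
  assumes [measurable]: "f \<in> borel_measurable borel"
  shows "(LINT x|lborel. f (c + x)) = (LINT x|lborel. f x)"
proof -
  have "(LINT x|lborel. f x) = (LINT x|distr lborel borel ((+) c). f x)"
    by (simp add: lborel_distr_plus)
  also have "\<dots> = (LINT x|lborel. f (c + x))" by (subst integral_distr) auto
  finally show ?thesis by simp
qed

text \<open>Instead of integrating by parts, pass to the limit in difference quotients: translation
  invariance shows that the transform of the quotient is \<open>fourier_integral \<phi> y\<close> times the quotient of
  the exponential. The mean value theorem and the decay of the derivative dominate the quotients.\<close>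

lemma fourier_derivative:
  fixes \<phi> :: "'a::euclidean_space \<Rightarrow> complex"
  assumes \<phi>: "\<phi> \<in> schwartz" and v: "v \<in> Basis"
  shows "fourier_integral (\<lambda>x. frechet_derivative \<phi> (at x) v) y = \<i> * of_real (y \<bullet> v) * fourier_integral \<phi> y"
proof -
  define d where "d x = frechet_derivative \<phi> (at x) v" for x
  have d: "d \<in> schwartz" unfolding d_def by (rule schwartz_derivative[OF assms])
  note [measurable] = rapid_measurable[OF rapid_schwartz[OF \<phi>]] rapid_measurable[OF rapid_schwartz[OF d]]
  define \<delta> where "\<delta> k = 1 / real (Suc k)" for k
  have \<delta>0: "\<delta> k > 0" and \<delta>1: "\<delta> k \<le> 1" for k by (auto simp: \<delta>_def)
  have \<delta>lim: "\<delta> \<longlonglongrightarrow> 0" unfolding \<delta>_def by (rule LIMSEQ_Suc[OF lim_1_over_n])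
  have \<delta>at: "filterlim \<delta> (at 0) sequentially"
    using \<delta>lim \<delta>0 by (auto simp: filterlim_at less_imp_neq[THEN not_sym])
  have path: "((\<lambda>s. \<phi> (x + s *\<^sub>R v)) has_derivative (\<lambda>h. h *\<^sub>R d (x + s *\<^sub>R v))) (at s)" for x and s :: real
  proof -
    have D: "(\<phi> has_derivative frechet_derivative \<phi> (at (x + s *\<^sub>R v))) (at (x + s *\<^sub>R v))"
      by (simp add: frechet_derivative_works[symmetric] schwartz_differentiable \<phi>)
    have "((\<lambda>s. x + s *\<^sub>R v) has_derivative (\<lambda>h. h *\<^sub>R v)) (at s)"
      by (auto intro!: derivative_eq_intros)
    from has_derivative_compose[OF this D] show ?thesis
      using linear_scale[OF has_derivative_linear[OF D]] by (simp add: d_def)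
  qed
  define Q where "Q k x = (\<phi> (x + \<delta> k *\<^sub>R v) - \<phi> x) /\<^sub>R \<delta> k" for k x
  have Qlim: "(\<lambda>k. Q k x) \<longlonglongrightarrow> d x" for x
  proof -
    have "(\<lambda>h. norm (\<phi> (x + h *\<^sub>R v) - \<phi> x - h *\<^sub>R d x) / norm h) \<midarrow>0\<rightarrow> 0"
      using path[of x 0] unfolding has_derivative_at by simp
    from filterlim_compose[OF this \<delta>at]
    have "(\<lambda>k. norm (\<phi> (x + \<delta> k *\<^sub>R v) - \<phi> x - \<delta> k *\<^sub>R d x) / norm (\<delta> k)) \<longlonglongrightarrow> 0" .
    also have "(\<lambda>k. norm (\<phi> (x + \<delta> k *\<^sub>R v) - \<phi> x - \<delta> k *\<^sub>R d x) / norm (\<delta> k)) = (\<lambda>k. norm (Q k x - d x))"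
    proof
      fix k
      have "Q k x - d x = (\<phi> (x + \<delta> k *\<^sub>R v) - \<phi> x - \<delta> k *\<^sub>R d x) /\<^sub>R \<delta> k"
        using \<delta>0[of k] by (simp add: Q_def algebra_simps)
      then show "norm (\<phi> (x + \<delta> k *\<^sub>R v) - \<phi> x - \<delta> k *\<^sub>R d x) / norm (\<delta> k) = norm (Q k x - d x)"
        by (simp add: divide_inverse mult.commute)
    qed
    finally have "(\<lambda>k. Q k x - d x) \<longlonglongrightarrow> 0" by (rule tendsto_norm_zero_cancel)
    then show ?thesis by (rule LIM_zero_cancel)
  qed
  let ?N = "DIM('a) + 1"
  obtain C where C: "C > 0" "\<And>x. norm (d x) * (1 + norm x) ^ ?N \<le> C"
    using rapid_bound[OF rapid_schwartz[OF d]] by metis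
  \<comment> \<open>The mean value point is within distance one of \<open>x\<close>, which costs the factor \<open>2 ^ ?N\<close>.\<close>
  have Qbound: "norm (Q k x) \<le> 2 ^ ?N * C * (1 / (1 + norm x) ^ ?N)" for k x
  proof -
    have "\<exists>s\<in>{0<..<\<delta> k}. norm (\<phi> (x + \<delta> k *\<^sub>R v) - \<phi> (x + 0 *\<^sub>R v)) \<le> norm ((\<delta> k - 0) *\<^sub>R d (x + s *\<^sub>R v))"
      by (rule mvt_general[OF \<delta>0])
         (use path in \<open>auto intro!: continuous_at_imp_continuous_on has_derivative_continuous\<close>)
    then obtain s where s: "0 < s" "s < \<delta> k"
      and "norm (\<phi> (x + \<delta> k *\<^sub>R v) - \<phi> x) \<le> norm (\<delta> k *\<^sub>R d (x + s *\<^sub>R v))" by auto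
    moreover have "norm (Q k x) = norm (\<phi> (x + \<delta> k *\<^sub>R v) - \<phi> x) / \<delta> k"
      using \<delta>0[of k] by (simp add: Q_def divide_inverse mult.commute)
    ultimately have "norm (Q k x) \<le> norm (d (x + s *\<^sub>R v))"
      using \<delta>0[of k] by (simp add: pos_divide_le_eq mult.commute)
    moreover have "norm (d (x + s *\<^sub>R v)) * (1 + norm x) ^ ?N \<le> 2 ^ ?N * C"
    proof -
      have "(1 + norm (x + s *\<^sub>R v + - (s *\<^sub>R v))) ^ ?N \<le> (1 + norm (x + s *\<^sub>R v)) ^ ?N * (1 + norm (- (s *\<^sub>R v))) ^ ?N"
        by (rule one_plus_norm_power_submult)
      also have "(1 + norm (- (s *\<^sub>R v))) ^ ?N \<le> 2 ^ ?N"
        using s \<delta>1[of k] v by (intro power_mono) auto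
      finally have "(1 + norm x) ^ ?N \<le> (1 + norm (x + s *\<^sub>R v)) ^ ?N * 2 ^ ?N"
        by (simp add: mult_left_mono)
      then have "norm (d (x + s *\<^sub>R v)) * (1 + norm x) ^ ?N \<le> norm (d (x + s *\<^sub>R v)) * ((1 + norm (x
          + s *\<^sub>R v)) ^ ?N * 2 ^ ?N)"
        by (intro mult_left_mono) auto
      also have "\<dots> \<le> C * 2 ^ ?N" unfolding mult.assoc[symmetric] by (intro mult_right_mono C) auto
      finally show ?thesis by (simp add: mult.commute)
    qed
    ultimately have "norm (Q k x) * (1 + norm x) ^ ?N \<le> 2 ^ ?N * C"
      by (meson mult_right_mono order_trans zero_le_power add_nonneg_nonneg norm_ge_zero zero_le_one)
    moreover have "(1 + norm x) ^ ?N > 0" by (simp add: add_pos_nonneg)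
    ultimately show ?thesis by (simp only: times_divide_eq_right mult_1_right pos_le_divide_eq)
  qed
  have [measurable]: "Q k \<in> borel_measurable borel" for k unfolding Q_def by measurable
  have lim1: "(\<lambda>k. LINT x|lborel. cis (- (x \<bullet> y)) * Q k x) \<longlonglongrightarrow> (LINT x|lborel. cis (- (x \<bullet> y)) * d x)"
  proof (rule integral_dominated_convergence)
    show "integrable lborel (\<lambda>x::'a. 2 ^ ?N * C * (1 / (1 + norm x) ^ ?N))"
      by (intro integrable_mult_right integrable_inverse_power_norm)
    show "AE x in lborel. norm (cis (- (x \<bullet> y)) * Q k x) \<le> 2 ^ ?N * C * (1 / (1 + norm x) ^ ?N)" for k
      using Qbound by (intro AE_I2) (simp only: norm_mult norm_cis mult_1)
    show "AE x in lborel. (\<lambda>k. cis (- (x \<bullet> y)) * Q k x) \<longlonglongrightarrow> cis (- (x \<bullet> y)) * d x"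
      by (intro AE_I2 tendsto_intros Qlim)
  qed measurable
  have eq: "(LINT x|lborel. cis (- (x \<bullet> y)) * Q k x)
      = (exp (\<i> * of_real (v \<bullet> y) * of_real (\<delta> k)) - 1) / of_real (\<delta> k) * fourier_integral \<phi> y" for k
  proof -
    let ?e = "exp (\<i> * of_real (v \<bullet> y) * of_real (\<delta> k))"
    have i1: "integrable lborel (\<lambda>x. cis (- (x \<bullet> y)) * \<phi> x)"
      by (intro integrable_cis_mult schwartz_integrable \<phi>) measurable
    have e: "?e = cis ((v \<bullet> y) * \<delta> k)" by (simp add: cis_conv_exp mult.assoc)
    have phase: "(v \<bullet> y) * \<delta> k + - ((\<delta> k *\<^sub>R v + x) \<bullet> y) = - (x \<bullet> y)" for x
      by (simp add: inner_add_left mult.commute)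
    have "(LINT x|lborel. cis (- (x \<bullet> y)) * \<phi> (x + \<delta> k *\<^sub>R v)) = (LINT x|lborel. ?e * (cis (- ((\<delta> k *\<^sub>R v
        + x) \<bullet> y)) * \<phi> (\<delta> k *\<^sub>R v + x)))"
      unfolding e mult.assoc[symmetric] cis_mult phase by (simp only: add.commute)
    also have "\<dots> = ?e * (LINT x|lborel. cis (- (x \<bullet> y)) * \<phi> x)"
      by (subst integral_mult_right_zero, subst integral_lborel_translate[where f="\<lambda>x. cis (- (x \<bullet> y)) * \<phi> x"]) auto
    finally have 1: "(LINT x|lborel. cis (- (x \<bullet> y)) * \<phi> (x + \<delta> k *\<^sub>R v)) = ?e * fourier_integral \<phi> y"
      by (simp add: fourier_integral_def)
    have i2: "integrable lborel (\<lambda>x. cis (- (x \<bullet> y)) * \<phi> (x + \<delta> k *\<^sub>R v))"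
      using rapid_integrable[OF rapid_translate[OF rapid_schwartz[OF \<phi>], of "- (\<delta> k *\<^sub>R v)"]]
      by (intro integrable_cis_mult) (simp, measurable)
    have "(LINT x|lborel. cis (- (x \<bullet> y)) * Q k x) = (LINT x|lborel. (cis (- (x \<bullet> y)) * \<phi> (x
        + \<delta> k *\<^sub>R v) - cis (- (x \<bullet> y)) * \<phi> x) / of_real (\<delta> k))"
      by (intro Bochner_Integration.integral_cong refl) (simp add: Q_def scaleR_conv_of_real divide_inverse algebra_simps)
    also have "\<dots> = (?e * fourier_integral \<phi> y - fourier_integral \<phi> y) / of_real (\<delta> k)"
      using 1 by (simp add: Bochner_Integration.integral_diff[OF i2 i1] fourier_integral_def)
    finally show ?thesis by (simp add: algebra_simps diff_divide_distrib)
  qed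
  have "((\<lambda>z. exp (\<i> * of_real (v \<bullet> y) * z)) has_field_derivative \<i> * of_real (v \<bullet> y)) (at 0)"
    by (auto intro!: derivative_eq_intros)
  then have "((\<lambda>h. (exp (\<i> * of_real (v \<bullet> y) * h) - 1) / h) \<longlongrightarrow> \<i> * of_real (v \<bullet> y)) (at 0)"
    by (simp add: DERIV_def)
  moreover have "filterlim (\<lambda>k. complex_of_real (\<delta> k)) (at 0) sequentially"
    using \<delta>0 tendsto_of_real[OF \<delta>lim, where 'a=complex] by (auto simp: filterlim_at less_imp_neq[THEN not_sym])
  ultimately have "(\<lambda>k. (exp (\<i> * of_real (v \<bullet> y) * of_real (\<delta> k)) - 1) / of_real (\<delta> k)) \<longlonglongrightarrow> \<i> * of_real (v \<bullet> y)"
    by (rule filterlim_compose)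
  then have lim2: "(\<lambda>k. LINT x|lborel. cis (- (x \<bullet> y)) * Q k x) \<longlonglongrightarrow> \<i> * of_real (v \<bullet> y) * fourier_integral \<phi> y"
    unfolding eq by (intro tendsto_intros)
  show ?thesis
    using LIMSEQ_unique[OF lim1 lim2] by (simp add: fourier_integral_def d_def inner_commute)
qed

lemma fourier_measurable [measurable]:
  assumes [measurable]: "\<phi> \<in> borel_measurable borel"
  shows "fourier_integral \<phi> \<in> borel_measurable borel"
  unfolding fourier_integral_def[abs_def] by measurable

lemma fourier_norm_le: "norm (fourier_integral \<phi> y) \<le> (LINT x|lborel. norm (\<phi> x))"
  unfolding fourier_integral_def
  using integral_norm_bound[of lborel "\<lambda>x. cis (- (x \<bullet> y)) * \<phi> x"] by (simp add: norm_mult)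

text \<open>Each derivative in the direction \<open>v\<close> gains a factor \<open>y \<bullet> v\<close>, and transforms of integrable
  functions are bounded.\<close>

lemma schwartz_fourier_decay:
  assumes "v \<in> Basis"
  shows "\<phi> \<in> schwartz \<Longrightarrow> \<exists>C. \<forall>y. \<bar>y \<bullet> v\<bar> ^ k * norm (fourier_integral \<phi> y) \<le> C"
proof (induction k arbitrary: \<phi>)
  case 0
  then show ?case using fourier_norm_le by auto
next
  case (Suc k)
  from Suc.IH[OF schwartz_derivative[OF Suc.prems assms]]
  show ?case by (auto simp: fourier_derivative[OF Suc.prems assms] norm_mult mult_ac abs_mult)
qed

text \<open>Some coordinate of \<open>y\<close> is at least \<open>norm y / n\<close> in modulus, so decay in each coordinate
  direction suffices.\<close>

lemma rapid_fourier:
  fixes \<phi> :: "'a::euclidean_space \<Rightarrow> complex"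
  assumes \<phi>: "\<phi> \<in> schwartz"
  shows "rapid (fourier_integral \<phi>)"
proof (rule rapidI)
  note [measurable] = rapid_measurable[OF rapid_schwartz[OF \<phi>]]
  show "fourier_integral \<phi> \<in> borel_measurable borel" by measurable
  let ?f = "\<lambda>y. norm (fourier_integral \<phi> y)"
  obtain B where B: "\<And>v k y. v \<in> Basis \<Longrightarrow> \<bar>y \<bullet> v\<bar> ^ k * ?f y \<le> B v k"
    using schwartz_fourier_decay[OF _ \<phi>] by metis
  have B': "norm y ^ k * ?f y \<le> real DIM('a) ^ k * (\<Sum>v\<in>Basis. \<bar>B v k\<bar>)" for k y
  proof -
    have "\<exists>v\<in>Basis. norm y \<le> real DIM('a) * \<bar>y \<bullet> v\<bar>"
    proof (rule ccontr)
      assume "\<not> (\<exists>v\<in>Basis. norm y \<le> real DIM('a) * \<bar>y \<bullet> v\<bar>)"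
      then have "\<bar>y \<bullet> v\<bar> < norm y / real DIM('a)" if "v \<in> Basis" for v
        using that by (auto simp: field_simps not_le)
      then have "(\<Sum>v\<in>Basis. \<bar>y \<bullet> v\<bar>) < (\<Sum>v\<in>(Basis::'a set). norm y / real DIM('a))"
        by (intro sum_strict_mono) auto
      then show False using norm_le_l1[of y] by simp
    qed
    then obtain v where v: "v \<in> Basis" and le: "norm y \<le> real DIM('a) * \<bar>y \<bullet> v\<bar>" by blast
    have "norm y ^ k * ?f y \<le> (real DIM('a) * \<bar>y \<bullet> v\<bar>) ^ k * ?f y"
      using le by (intro mult_right_mono power_mono) auto
    also have "\<dots> = real DIM('a) ^ k * (\<bar>y \<bullet> v\<bar> ^ k * ?f y)" by (simp add: power_mult_distrib)
    also have "\<dots> \<le> real DIM('a) ^ k * (\<Sum>v\<in>Basis. \<bar>B v k\<bar>)"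
    proof (intro mult_left_mono)
      have "\<bar>y \<bullet> v\<bar> ^ k * ?f y \<le> \<bar>B v k\<bar>" using B[OF v, of y k] by linarith
      also have "\<dots> \<le> (\<Sum>v\<in>Basis. \<bar>B v k\<bar>)" using v by (intro member_le_sum) auto
      finally show "\<bar>y \<bullet> v\<bar> ^ k * ?f y \<le> (\<Sum>v\<in>Basis. \<bar>B v k\<bar>)" .
    qed simp
    finally show ?thesis .
  qed
  then show "\<exists>C. \<forall>y. norm y ^ k * ?f y \<le> C" for k by (intro exI allI)
qed

section \<open>Gaussians as test functions\<close>

text \<open>The polynomial functions that arise as coefficients when a Gaussian is differentiated
  repeatedly.\<close>

inductive_set polys :: "('a::euclidean_space \<Rightarrow> complex) set" where
  const: "(\<lambda>x. c) \<in> polys"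
| lin: "(\<lambda>x. of_real (x \<bullet> w)) \<in> polys"
| add: "p \<in> polys \<Longrightarrow> q \<in> polys \<Longrightarrow> (\<lambda>x. p x + q x) \<in> polys"
| mult: "p \<in> polys \<Longrightarrow> q \<in> polys \<Longrightarrow> (\<lambda>x. p x * q x) \<in> polys"

lemma polys_derivative:
  "p \<in> polys \<Longrightarrow> \<exists>p'. (\<forall>v. p' v \<in> polys) \<and> (\<forall>x. (p has_derivative (\<lambda>v. p' v x)) (at x))"
proof (induction rule: polys.induct)
  case (const c)
  show ?case by (intro exI[of _ "\<lambda>_ _. 0"]) (simp add: polys.const)
next
  case (lin w)
  have "((\<lambda>x. complex_of_real (x \<bullet> w)) has_derivative (\<lambda>v. of_real (v \<bullet> w))) (at x)" for x
    by (rule bounded_linear_imp_has_derivative)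
       (rule bounded_linear_compose[OF bounded_linear_of_real bounded_linear_inner_left])
  then show ?case by (intro exI[of _ "\<lambda>v _. of_real (v \<bullet> w)"]) (simp add: polys.const)
next
  case (add p q)
  then obtain p' q' where "\<And>v. p' v \<in> polys" "\<And>x. (p has_derivative (\<lambda>v. p' v x)) (at x)"
    "\<And>v. q' v \<in> polys" "\<And>x. (q has_derivative (\<lambda>v. q' v x)) (at x)" by blast
  then show ?case
    by (intro exI[of _ "\<lambda>v x. p' v x + q' v x"] conjI allI polys.add has_derivative_add)
next
  case (mult p q)
  then obtain p' q' where "\<And>v. p' v \<in> polys" "\<And>x. (p has_derivative (\<lambda>v. p' v x)) (at x)"
    "\<And>v. q' v \<in> polys" "\<And>x. (q has_derivative (\<lambda>v. q' v x)) (at x)" by blast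
  with mult.hyps show ?case
    by (intro exI[of _ "\<lambda>v x. p x * q' v x + p' v x * q x"] conjI allI polys.add polys.mult has_derivative_mult)
qed

lemma polys_bound:
  "p \<in> polys \<Longrightarrow> \<exists>C\<ge>0. \<exists>N. \<forall>x. norm (p x) \<le> C * (1 + norm x) ^ N"
proof (induction rule: polys.induct)
  case (const c)
  show ?case by (intro exI[of _ "norm c"] conjI exI[of _ 0]) auto
next
  case (lin w)
  have "norm (complex_of_real (x \<bullet> w)) \<le> norm w * (1 + norm x) ^ 1" for x
    using Cauchy_Schwarz_ineq2[of x w] by (simp add: algebra_simps add_increasing)
  then show ?case by (intro exI[of _ "norm w"] conjI exI[of _ 1]) auto
next
  case (add p q)
  then obtain C D M N where *: "C \<ge> 0" "\<And>x. norm (p x) \<le> C * (1 + norm x) ^ M"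
    "D \<ge> 0" "\<And>x. norm (q x) \<le> D * (1 + norm x) ^ N" by blast
  have "norm (p x + q x) \<le> (C + D) * (1 + norm x) ^ max M N" for x
  proof -
    have "(1 + norm x) ^ M \<le> (1 + norm x) ^ max M N" "(1 + norm x) ^ N \<le> (1 + norm x) ^ max M N"
      by (intro power_increasing; simp)+
    then have "C * (1 + norm x) ^ M \<le> C * (1 + norm x) ^ max M N" "D * (1 + norm x) ^ N \<le> D * (1 + norm x) ^ max M N"
      using * by (intro mult_left_mono; simp)+
    then show ?thesis
      using *(2)[of x] *(4)[of x] norm_triangle_ineq[of "p x" "q x"] unfolding distrib_right by linarith
  qed
  then show ?case using * by (intro exI[of _ "C + D"] conjI exI[of _ "max M N"]) auto
next
  case (mult p q)
  then obtain C D M N where *: "C \<ge> 0" "\<And>x. norm (p x) \<le> C * (1 + norm x) ^ M"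
    "D \<ge> 0" "\<And>x. norm (q x) \<le> D * (1 + norm x) ^ N" by blast
  have "norm (p x * q x) \<le> (C * D) * (1 + norm x) ^ (M + N)" for x
  proof -
    have "norm (p x) * norm (q x) \<le> (C * (1 + norm x) ^ M) * (D * (1 + norm x) ^ N)"
      using * by (intro mult_mono) auto
    then show ?thesis by (simp add: norm_mult power_add mult_ac)
  qed
  then show ?case using * by (intro exI[of _ "C * D"] conjI exI[of _ "M + N"]) auto
qed

text \<open>By induction every iterated derivative of the Gaussian \<open>E\<close> is a polynomial multiple of \<open>E\<close>:
  the derivative of \<open>E\<close> in the direction \<open>v\<close> is \<open>L v\<close> times \<open>E\<close> with an affine function \<open>L v\<close>.\<close>

lemma modulated_gauss_schwartz:
  fixes y z :: "'a::euclidean_space"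
  assumes a: "a > 0"
  shows "(\<lambda>x. cis (x \<bullet> z) * of_real (gauss a (x - y))) \<in> schwartz"
proof -
  define E where "E x = cis (x \<bullet> z) * complex_of_real (gauss a (x - y))" for x
  define L where "L v x = \<i> * of_real (v \<bullet> z) + of_real (a * (y \<bullet> v)) + of_real (- a) * complex_of_real (x \<bullet> v)" for v x
  have L: "L v \<in> polys" for v
    unfolding L_def[abs_def] by (intro polys.intros)
  have E': "(E has_derivative (\<lambda>v. L v x * E x)) (at x)" for x
  proof -
    define G where "G x = \<i> * complex_of_real (x \<bullet> z) + of_real (- (a * ((x - y) \<bullet> (x - y)) / 2))" for x
    have EG: "E = (\<lambda>x. exp (G x))"
    proof
      fix x
      have "E x = exp (\<i> * complex_of_real (x \<bullet> z)) * exp (of_real (- (a * ((x - y) \<bullet> (x - y)) / 2)))"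
        by (simp only: E_def gauss_def cis_conv_exp power2_norm_eq_inner exp_of_real)
      then show "E x = exp (G x)" by (simp only: G_def exp_add)
    qed
    have "(G has_derivative (\<lambda>v. \<i> * of_real (v \<bullet> z) + of_real (- (a * ((x - y) \<bullet> v + v \<bullet> (x - y)) / 2)))) (at x)"
      unfolding G_def[abs_def] by (auto intro!: derivative_eq_intros)
    moreover have "(\<lambda>v. \<i> * of_real (v \<bullet> z) + of_real (- (a * ((x - y) \<bullet> v + v \<bullet> (x - y)) / 2))) = (\<lambda>v. L v x)"
    proof
      fix v
      have "- (a * ((x - y) \<bullet> v + v \<bullet> (x - y)) / 2) = a * (y \<bullet> v) + (- a) * (x \<bullet> v)"
        by (simp add: inner_diff_left inner_diff_right inner_commute[of v] field_simps)
      then show "\<i> * of_real (v \<bullet> z) + of_real (- (a * ((x - y) \<bullet> v + v \<bullet> (x - y)) / 2)) = L v x"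
        by (simp only: L_def of_real_add of_real_mult add.assoc)
    qed
    ultimately have "(G has_derivative (\<lambda>v. L v x)) (at x)" by simp
    moreover have "(exp has_derivative (\<lambda>h. exp (G x) * h)) (at (G x))"
      using DERIV_exp[of "G x"] by (simp add: has_field_derivative_def)
    ultimately have "((\<lambda>x. exp (G x)) has_derivative (\<lambda>v. exp (G x) * L v x)) (at x)"
      by (rule has_derivative_compose)
    then show ?thesis by (simp add: EG mult.commute)
  qed
  have iter: "\<exists>p\<in>polys. iter_deriv vs E = (\<lambda>x. p x * E x)" for vs
  proof (induction vs)
    case Nil
    show ?case by (intro bexI[of _ "\<lambda>_. 1"]) (auto intro: polys.const)
  next
    case (Cons v vs)
    then obtain p where p: "p \<in> polys" "iter_deriv vs E = (\<lambda>x. p x * E x)" by blast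
    from polys_derivative[OF p(1)] obtain p' where p': "\<And>v. p' v \<in> polys"
      "\<And>x. (p has_derivative (\<lambda>v. p' v x)) (at x)" by blast
    have "((\<lambda>x. p x * E x) has_derivative (\<lambda>v. p x * (L v x * E x) + p' v x * E x)) (at x)" for x
      by (rule has_derivative_mult[OF p'(2) E'])
    from frechet_derivative_at[OF this, symmetric] have "iter_deriv (v # vs) E = (\<lambda>x. (p x * L v x + p' v x) * E x)"
      by (simp add: p(2) distrib_right mult.assoc)
    moreover have "(\<lambda>x. p x * L v x + p' v x) \<in> polys" by (intro polys.add polys.mult p(1) p'(1) L)
    ultimately show ?case by (rule bexI)
  qed
  have "E \<in> schwartz"
    unfolding schwartz_def
  proof (intro CollectI ballI conjI allI)
    fix vs :: "'a list" assume "vs \<in> lists Basis"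
    from iter obtain p where p: "p \<in> polys" "iter_deriv vs E = (\<lambda>x. p x * E x)" by blast
    from polys_derivative[OF p(1)] obtain p' where p': "\<And>x. (p has_derivative (\<lambda>v. p' v x)) (at x)" by blast
    show "iter_deriv vs E differentiable_on UNIV"
      unfolding p(2) differentiable_on_def differentiable_def using has_derivative_mult[OF p' E'] by auto
    fix k
    from polys_bound[OF p(1)] obtain C N where C: "C \<ge> 0" "\<And>x. norm (p x) \<le> C * (1 + norm x) ^ N" by blast
    have "rapid E" unfolding E_def[abs_def] by (rule rapid_modulated_gauss[OF a])
    then obtain D where D: "D > 0" "\<And>x. norm (E x) * (1 + norm x) ^ (k + N) \<le> D"
      using rapid_bound[where N="k + N"] by blast
    have "norm (norm x ^ k *\<^sub>R iter_deriv vs E x) \<le> C * D" for x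
    proof -
      have "norm (norm x ^ k *\<^sub>R iter_deriv vs E x) = norm x ^ k * (norm (p x) * norm (E x))"
        by (simp add: p(2) norm_mult)
      also have "\<dots> \<le> (1 + norm x) ^ k * ((C * (1 + norm x) ^ N) * norm (E x))"
        by (intro mult_mono power_mono C mult_nonneg_nonneg zero_le_power) auto
      also have "\<dots> = C * (norm (E x) * (1 + norm x) ^ (k + N))" by (simp add: power_add mult_ac)
      also have "\<dots> \<le> C * D" by (intro mult_left_mono D C)
      finally show ?thesis .
    qed
    then show "bounded (range (\<lambda>x. norm x ^ k *\<^sub>R iter_deriv vs E x))"
      unfolding bounded_iff by blast
  qed
  then show ?thesis by (simp add: E_def[abs_def])
qed

section \<open>The heat kernel and Fourier inversion\<close>

text \<open>The Gaussian probability density of variance \<open>e\<close> in each coordinate.\<close>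

definition heat :: "real \<Rightarrow> 'a::euclidean_space \<Rightarrow> real" where
  "heat e x = gauss (1 / e) x / sqrt (2 * pi * e) ^ DIM('a)"

lemma heat_pos: "e > 0 \<Longrightarrow> heat e x > 0"
  by (simp add: heat_def gauss_pos)

lemma heat_commute: "heat e (x - y) = heat e (y - x)"
  by (simp add: heat_def gauss_commute)

lemma borel_measurable_heat [measurable]: "heat e \<in> borel_measurable borel"
  unfolding heat_def[abs_def] by measurable

lemma fourier_gauss_heat:
  fixes y :: "'a::euclidean_space"
  assumes "a > 0"
  shows "has_bochner_integral lborel (\<lambda>x. cis (x \<bullet> y) * of_real (gauss a x)) (of_real ((2 * pi) ^ DIM('a) * heat a y))"
proof -
  have "sqrt (2 * pi / a) = 2 * pi / sqrt (2 * pi * a)"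
    using assms by (simp add: real_sqrt_divide real_sqrt_mult field_simps)
  then have "sqrt (2 * pi / a) ^ DIM('a) * gauss (1 / a) y = (2 * pi) ^ DIM('a) * heat a y"
    by (simp add: heat_def power_divide)
  then show ?thesis using fourier_gauss[OF assms, of y] by simp
qed

lemma heat_eq_gauss:
  "heat e = (\<lambda>x::'a::euclidean_space. (1 / sqrt (2 * pi * e) ^ DIM('a)) * gauss (1 / e) x)"
  by (auto simp: heat_def)

lemma fourier_heat:
  fixes y :: "'a::euclidean_space"
  assumes "e > 0"
  shows "has_bochner_integral lborel (\<lambda>x. cis (x \<bullet> y) * of_real (heat e x)) (of_real (gauss e y))"
proof -
  have "has_bochner_integral lborel (\<lambda>x. of_real (1 / sqrt (2 * pi * e) ^ DIM('a))
      * (cis (x \<bullet> y) * of_real (gauss (1 / e) x)))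
      (of_real (1 / sqrt (2 * pi * e) ^ DIM('a)) * of_real (sqrt (2 * pi / (1 / e)) ^ DIM('a) * gauss (1 / (1 / e)) y))"
    using assms by (intro has_bochner_integral_mult_right fourier_gauss) auto
  moreover have "(\<lambda>x. of_real (1 / sqrt (2 * pi * e) ^ DIM('a)) * (cis (x \<bullet> y) * of_real (gauss (1 / e) x)))
      = (\<lambda>x. cis (x \<bullet> y) * of_real (heat e x))"
    by (simp add: heat_eq_gauss mult_ac)
  moreover have "complex_of_real (1 / sqrt (2 * pi * e) ^ DIM('a)) * of_real (sqrt (2 * pi / (1 / e)) ^ DIM('a) * gauss (1 / (1 / e)) y) = of_real (gauss e y)"
    unfolding of_real_mult[symmetric] using assms by simp
  ultimately show ?thesis by simp
qed

lemma integrable_heat: "e > 0 \<Longrightarrow> integrable lborel (heat e :: 'a::euclidean_space \<Rightarrow> real)"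
  by (subst heat_eq_gauss, rule integrable_mult_right) (simp add: integrable_gauss)

lemma fourier_translated_heat:
  fixes y \<eta> :: "'a::euclidean_space"
  assumes "e > 0"
  shows "fourier_integral (\<lambda>x. of_real (heat e (x - \<eta>))) y = cis (- (\<eta> \<bullet> y)) * of_real (gauss e y)"
proof -
  let ?f = "\<lambda>x. cis (- (x \<bullet> y)) * complex_of_real (heat e (x - \<eta>))"
  have "fourier_integral (\<lambda>x. of_real (heat e (x - \<eta>))) y = (LINT x|lborel. ?f (\<eta> + x))"
    unfolding fourier_integral_def by (rule integral_lborel_translate[symmetric]) measurable
  also have "\<dots> = (LINT x|lborel. cis (- (\<eta> \<bullet> y)) * (cis (x \<bullet> (- y)) * of_real (heat e x)))"
    by (intro Bochner_Integration.integral_cong refl)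
       (simp add: inner_add_left cis_mult mult.assoc[symmetric])
  also have "\<dots> = cis (- (\<eta> \<bullet> y)) * of_real (gauss e y)"
    using fourier_heat[OF assms, of "- y"] by (simp add: has_bochner_integral_iff)
  finally show ?thesis .
qed

lemma fourier_modulated_gauss:
  fixes y z :: "'a::euclidean_space"
  assumes "a > 0"
  shows "fourier_integral (\<lambda>x. cis (x \<bullet> z) * of_real (gauss a x)) y = of_real ((2 * pi) ^ DIM('a) * heat a (y - z))"
proof -
  have "fourier_integral (\<lambda>x. cis (x \<bullet> z) * of_real (gauss a x)) y
      = (LINT x|lborel. cis (x \<bullet> (z - y)) * of_real (gauss a x))"
    unfolding fourier_integral_def
    by (intro Bochner_Integration.integral_cong refl)
       (simp add: inner_diff_right cis_mult mult.assoc[symmetric])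
  also have "\<dots> = of_real ((2 * pi) ^ DIM('a) * heat a (z - y))"
    using fourier_gauss_heat[OF assms, of "z - y"] by (simp add: has_bochner_integral_iff)
  finally show ?thesis by (simp add: heat_commute)
qed

lemma heat_scale: "e > 0 \<Longrightarrow> sqrt e ^ DIM('a) * heat e (sqrt e *\<^sub>R x) = heat 1 (x::'a::euclidean_space)"
  by (simp add: heat_def gauss_def power_mult_distrib real_sqrt_mult)

lemma nn_integral_heat_scale:
  fixes f :: "'a::euclidean_space \<Rightarrow> ennreal"
  assumes [measurable]: "f \<in> borel_measurable borel" and e: "e > 0"
  shows "(\<integral>\<^sup>+y. ennreal (heat e (x - y)) * f y \<partial>lborel) = (\<integral>\<^sup>+z. ennreal (heat 1 z) * f (x + sqrt e *\<^sub>R z) \<partial>lborel)"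
proof -
  have "(\<integral>\<^sup>+y. ennreal (heat e (x - y)) * f y \<partial>lborel) =
      ennreal (\<bar>sqrt e\<bar> ^ DIM('a)) * (\<integral>\<^sup>+z. ennreal (heat e (x - (x + sqrt e *\<^sub>R z))) * f (x + sqrt e *\<^sub>R z) \<partial>lborel)"
    using e by (intro nn_integral_lborel_affine) auto
  also have "\<dots> = (\<integral>\<^sup>+z. ennreal (sqrt e ^ DIM('a)) * (ennreal (heat e (sqrt e *\<^sub>R z)) * f (x + sqrt e *\<^sub>R z)) \<partial>lborel)"
    using e by (subst nn_integral_cmult) (auto simp: heat_def)
  also have "\<dots> = (\<integral>\<^sup>+z. ennreal (heat 1 z) * f (x + sqrt e *\<^sub>R z) \<partial>lborel)"
    using e by (simp add: heat_scale[symmetric] ennreal_mult heat_pos less_imp_le mult.assoc)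
  finally show ?thesis .
qed

lemma integral_lborel_affine:
  fixes f :: "'a::euclidean_space \<Rightarrow> complex"
  assumes [measurable]: "f \<in> borel_measurable borel" and "c \<noteq> 0"
  shows "(LINT x|lborel. f x) = \<bar>c\<bar> ^ DIM('a) *\<^sub>R (LINT x|lborel. f (t + c *\<^sub>R x))"
  by (subst lborel_affine[OF assms(2), of t]) (simp add: integral_density integral_distr)

lemma integral_heat_scale:
  fixes f :: "'a::euclidean_space \<Rightarrow> complex"
  assumes [measurable]: "f \<in> borel_measurable borel" and e: "e > 0"
  shows "(LINT y|lborel. of_real (heat e (x - y)) * f y) = (LINT z|lborel. of_real (heat 1 z) * f (x + sqrt e *\<^sub>R z))"
proof -
  have "(LINT y|lborel. of_real (heat e (x - y)) * f y) =
      \<bar>sqrt e\<bar> ^ DIM('a) *\<^sub>R (LINT z|lborel. of_real (heat e (x - (x + sqrt e *\<^sub>R z))) * f (x + sqrt e *\<^sub>R z))"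
    using e by (intro integral_lborel_affine) auto
  also have "\<dots> = (LINT z|lborel. of_real (sqrt e ^ DIM('a)) * (of_real (heat e (sqrt e *\<^sub>R z)) * f (x + sqrt e *\<^sub>R z)))"
    using e by (subst integral_mult_right_zero) (auto simp: heat_def scaleR_conv_of_real)
  also have "\<dots> = (LINT z|lborel. of_real (heat 1 z) * f (x + sqrt e *\<^sub>R z))"
    using e by (simp add: heat_scale[symmetric] mult.assoc)
  finally show ?thesis .
qed

text \<open>After the substitution \<open>y = x + sqrt e z\<close> the kernel is fixed and the argument of \<open>\<psi>\<close> tends to \<open>x\<close>.\<close>

lemma heat_approximates_identity:
  fixes \<psi> :: "'a::euclidean_space \<Rightarrow> complex"
  assumes cont: "continuous_on UNIV \<psi>" and bdd: "\<And>x. norm (\<psi> x) \<le> B"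
  shows "(\<lambda>k. LINT y|lborel. of_real (heat (1 / real (Suc k)) (x - y)) * \<psi> y) \<longlonglongrightarrow> \<psi> x"
proof -
  have [measurable]: "\<psi> \<in> borel_measurable borel" by (rule borel_measurable_continuous_onI[OF cont])
  have "(\<lambda>k. LINT z|lborel. of_real (heat 1 z) * \<psi> (x + sqrt (1 / real (Suc k)) *\<^sub>R z))
      \<longlonglongrightarrow> (LINT z|lborel. of_real (heat 1 (z::'a)) * \<psi> x)"
  proof (rule integral_dominated_convergence)
    show "integrable lborel (\<lambda>z::'a. heat 1 z * B)" by (intro integrable_mult_left integrable_heat) simp
    show "AE z in lborel. norm (of_real (heat 1 z) * \<psi> (x + sqrt (1 / real (Suc k)) *\<^sub>R z)) \<le> heat 1 z * B" for k
      by (intro AE_I2)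
         (simp add: norm_mult abs_of_pos[OF heat_pos] mult_left_mono bdd less_imp_le[OF heat_pos])
    have "(\<lambda>k. x + sqrt (1 / real (Suc k)) *\<^sub>R z) \<longlonglongrightarrow> x + sqrt 0 *\<^sub>R z" for z
      by (intro tendsto_intros LIMSEQ_Suc[OF lim_1_over_n])
    then have "(\<lambda>k. \<psi> (x + sqrt (1 / real (Suc k)) *\<^sub>R z)) \<longlonglongrightarrow> \<psi> x" for z
      using cont by (intro continuous_on_tendsto_compose[OF cont]) auto
    then show "AE z in lborel. (\<lambda>k. of_real (heat 1 z) * \<psi> (x + sqrt (1 / real (Suc k)) *\<^sub>R z)) \<longlonglongrightarrow> of_real (heat 1 z) * \<psi> x"
      by (intro AE_I2 tendsto_intros)
  qed measurable
  moreover have "(LINT z|lborel. complex_of_real (heat 1 (z::'a)) * \<psi> x) = \<psi> x"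
    using fourier_heat[of 1 "0::'a"] by (simp add: has_bochner_integral_iff gauss_def)
  moreover have "(LINT y|lborel. of_real (heat (1 / real (Suc k)) (x - y)) * \<psi> y)
      = (LINT z|lborel. of_real (heat 1 z) * \<psi> (x + sqrt (1 / real (Suc k)) *\<^sub>R z))" for k
    by (rule integral_heat_scale) auto
  ultimately show ?thesis by (simp only:)
qed

text \<open>A Gaussian factor makes the double integral absolutely convergent; exchanging the order of
  integration turns it into a mollification of \<open>\<phi>\<close>. As the Gaussian widens, one side tends to the
  inversion integral by dominated convergence and the other one to \<open>(2\<pi>)\<^sup>n \<phi> y\<close>.\<close>

theorem fourier_inversion_schwartz:
  fixes \<phi> :: "'a::euclidean_space \<Rightarrow> complex"
  assumes \<phi>: "\<phi> \<in> schwartz"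
  shows "(LINT x|lborel. cis (x \<bullet> y) * fourier_integral \<phi> x) = of_real ((2 * pi) ^ DIM('a)) * \<phi> y"
proof (rule LIMSEQ_unique)
  let ?I = "\<lambda>k. LINT x|lborel. of_real (gauss (1 / real (Suc k)) x) * (cis (x \<bullet> y) * fourier_integral \<phi> x)"
  note [measurable] = rapid_measurable[OF rapid_schwartz[OF \<phi>]]
  note i\<phi> = schwartz_integrable[OF \<phi>]
  note iF = rapid_integrable[OF rapid_fourier[OF \<phi>]]
  show "?I \<longlonglongrightarrow> (LINT x|lborel. cis (x \<bullet> y) * fourier_integral \<phi> x)"
  proof (rule integral_dominated_convergence)
    show "integrable lborel (\<lambda>x. norm (fourier_integral \<phi> x))" using iF by simp
    show "AE x in lborel. norm (of_real (gauss (1 / real (Suc k)) x) * (cis (x \<bullet> y) * fourier_integral \<phi> x))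
        \<le> norm (fourier_integral \<phi> x)" for k
      by (intro AE_I2)
         (simp add: norm_mult abs_of_pos[OF gauss_pos] mult_left_le_one_le gauss_le_1 less_imp_le[OF gauss_pos])
    have "(\<lambda>k. gauss (1 / real (Suc k)) x) \<longlonglongrightarrow> exp (- (0 * (norm x)\<^sup>2 / 2))" for x :: 'a
      unfolding gauss_def by (intro tendsto_intros LIMSEQ_Suc[OF lim_1_over_n]) auto
    then have "(\<lambda>k. complex_of_real (gauss (1 / real (Suc k)) x)) \<longlonglongrightarrow> of_real 1" for x :: 'a
      by (intro tendsto_of_real) simp
    then have "(\<lambda>k. of_real (gauss (1 / real (Suc k)) x) * (cis (x \<bullet> y) * fourier_integral \<phi> x)) \<longlonglongrightarrow> of_real 1
        * (cis (x \<bullet> y) * fourier_integral \<phi> x)" for x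
      by (intro tendsto_mult tendsto_const)
    then show "AE x in lborel. (\<lambda>k. of_real (gauss (1 / real (Suc k)) x) * (cis (x \<bullet> y) * fourier_integral \<phi> x))
        \<longlonglongrightarrow> cis (x \<bullet> y) * fourier_integral \<phi> x"
      by simp
  qed measurable
  have eq: "(LINT x|lborel. of_real (gauss a x) * (cis (x \<bullet> y) * fourier_integral \<phi> x))
      = of_real ((2 * pi) ^ DIM('a)) * (LINT z|lborel. of_real (heat a (y - z)) * \<phi> z)"
    if a: "a > 0" for a
  proof -
    define Q where "Q = (\<lambda>(x, z). cis (x \<bullet> (y - z)) * (complex_of_real (gauss a x) * \<phi> z))"
    have [measurable]: "Q \<in> borel_measurable (lborel \<Otimes>\<^sub>M lborel)" unfolding Q_def by measurable
    have Q: "integrable (lborel \<Otimes>\<^sub>M lborel) Q"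
    proof (rule Bochner_Integration.integrable_bound)
      show "integrable (lborel \<Otimes>\<^sub>M lborel) (\<lambda>(x::'a, z). complex_of_real (gauss a x) * \<phi> z)"
        by (rule integrable_tensor[OF lborel.sigma_finite_measure_axioms integrable_of_real[OF integrable_gauss[OF a]] i\<phi>])
    qed (auto simp: Q_def norm_mult)
    have 1: "(LINT z|lborel. Q (x, z)) = of_real (gauss a x) * (cis (x \<bullet> y) * fourier_integral \<phi> x)" for x
    proof -
      have "(LINT z|lborel. Q (x, z)) = (LINT z|lborel. (of_real (gauss a x) * cis (x \<bullet> y)) * (cis (- (z \<bullet> x)) * \<phi> z))"
      proof (intro Bochner_Integration.integral_cong refl)
        fix z
        have "cis (x \<bullet> (y - z)) = cis (x \<bullet> y) * cis (- (z \<bullet> x))"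
          unfolding cis_mult by (simp add: inner_diff_right inner_commute)
        then show "Q (x, z) = (of_real (gauss a x) * cis (x \<bullet> y)) * (cis (- (z \<bullet> x)) * \<phi> z)"
          by (simp add: Q_def)
      qed
      then show ?thesis by (simp add: fourier_integral_def mult.assoc)
    qed
    have 2: "(LINT x|lborel. Q (x, z)) = of_real ((2 * pi) ^ DIM('a)) * (of_real (heat a (y - z)) * \<phi> z)" for z
    proof -
      have "(LINT x|lborel. Q (x, z)) = (LINT x|lborel. (cis (x \<bullet> (y - z)) * of_real (gauss a x)) * \<phi> z)"
        by (simp add: Q_def mult.assoc)
      also have "\<dots> = (LINT x|lborel. cis (x \<bullet> (y - z)) * of_real (gauss a x)) * \<phi> z"
        by (rule integral_mult_left_zero)
      finally show ?thesis using fourier_gauss_heat[OF a, of "y - z"] by (simp add: has_bochner_integral_iff mult.assoc)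
    qed
    have "(LINT x|lborel. of_real (gauss a x) * (cis (x \<bullet> y) * fourier_integral \<phi> x))
        = (LINT x|lborel. LINT z|lborel. Q (x, z))"
      by (simp only: 1)
    also have "\<dots> = (LINT z|lborel. LINT x|lborel. Q (x, z))"
      using lborel_pair.Fubini_integral[of "\<lambda>a b. Q (a, b)"] Q by simp
    also have "\<dots> = of_real ((2 * pi) ^ DIM('a)) * (LINT z|lborel. of_real (heat a (y - z)) * \<phi> z)"
      unfolding 2 by (rule integral_mult_right_zero)
    finally show ?thesis .
  qed
  obtain B where B: "\<And>x. norm (\<phi> x) * (1 + norm x) ^ 0 \<le> B"
    using rapid_bound[OF rapid_schwartz[OF \<phi>], of 0] by blast
  then have "norm (\<phi> x) \<le> B" for x by simp
  from heat_approximates_identity[OF schwartz_continuous[OF \<phi>] this, of y]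
  have "(\<lambda>k. of_real ((2 * pi) ^ DIM('a)) * (LINT z|lborel. of_real (heat (1 / real (Suc k)) (y - z)) * \<phi> z))
      \<longlonglongrightarrow> of_real ((2 * pi) ^ DIM('a)) * \<phi> y"
    by (intro tendsto_mult tendsto_const)
  moreover have "1 / real (Suc k) > 0" for k by simp
  ultimately show "?I \<longlonglongrightarrow> of_real ((2 * pi) ^ DIM('a)) * \<phi> y" by (simp only: eq)
qed

section \<open>Square integrability from mollifications\<close>

lemma integrable_rapid_weight:
  fixes \<psi> :: "'a::euclidean_space \<Rightarrow> complex"
  assumes "rapid \<psi>"
  shows "integrable lborel (\<lambda>x. norm (\<psi> x) * (1 + norm x) ^ N)"
proof -
  note [measurable] = rapid_measurable[OF assms]
  let ?M = "DIM('a) + 1"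
  obtain C where C: "\<And>x. norm (\<psi> x) * (1 + norm x) ^ (N + ?M) \<le> C"
    using rapid_bound[OF assms, of "N + ?M"] by blast
  show ?thesis
  proof (rule Bochner_Integration.integrable_bound)
    show "integrable lborel (\<lambda>x::'a. C * (1 / (1 + norm x) ^ ?M))"
      by (intro integrable_mult_right integrable_inverse_power_norm)
    show "AE x in lborel. norm (norm (\<psi> x) * (1 + norm x) ^ N) \<le> norm (C * (1 / (1 + norm x) ^ ?M))"
    proof (rule AE_I2)
      fix x :: 'a
      have "(1 + norm x) ^ ?M > 0" by (intro zero_less_power) (simp add: add_pos_nonneg)
      moreover have "norm (\<psi> x) * (1 + norm x) ^ N * (1 + norm x) ^ ?M \<le> C"
        using C[of x] by (simp only: power_add mult.assoc)
      ultimately have "norm (\<psi> x) * (1 + norm x) ^ N \<le> C / (1 + norm x) ^ ?M"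
        by (simp only: pos_le_divide_eq)
      moreover have "0 \<le> norm (\<psi> x) * (1 + norm x) ^ N" by simp
      ultimately show "norm (norm (\<psi> x) * (1 + norm x) ^ N) \<le> norm (C * (1 / (1 + norm x) ^ ?M))"
        unfolding real_norm_def times_divide_eq_right mult_1_right by linarith
    qed
  qed measurable
qed

lemma rapid_heat:
  assumes "e > 0"
  shows "rapid (\<lambda>x::'a::euclidean_space. of_real (heat e x))"
proof -
  have "rapid (\<lambda>x::'a. complex_of_real (1 / sqrt (2 * pi * e) ^ DIM('a)) * of_real (gauss (1 / e) x))"
    using assms by (intro rapid_bounded_mult[OF rapid_gauss _ order_refl]) auto
  then show ?thesis unfolding heat_eq_gauss of_real_mult .
qed

lemma rapid_bounded_support:
  fixes \<psi> :: "'a::euclidean_space \<Rightarrow> complex"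
  assumes [measurable]: "\<psi> \<in> borel_measurable borel" and "\<And>x. norm (\<psi> x) \<le> B" "\<And>x. norm x > R \<Longrightarrow> \<psi> x = 0"
  shows "rapid \<psi>"
  unfolding rapid_def
proof (intro conjI allI exI)
  have B: "B \<ge> 0" using assms(2)[of 0] norm_ge_zero order_trans by blast
  show "norm (\<psi> x) * (1 + norm x) ^ N \<le> B * (1 + \<bar>R\<bar>) ^ N" for N x
  proof (cases "norm x > R")
    case False
    then show ?thesis using B assms(2)[of x] by (intro mult_mono power_mono) auto
  qed (simp add: assms(3) B)
qed measurable

text \<open>Mollifying a function of bounded support at scales \<open>e \<le> 1\<close> gives polynomial decay of every order
  uniformly in \<open>e\<close>: where \<open>\<psi> (x + sqrt e z)\<close> is nonzero, \<open>1 + norm x\<close> is at most a constant times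
  \<open>1 + norm z\<close>, and the fixed kernel decays faster than any power of \<open>z\<close>.\<close>

lemma mollification_decay:
  fixes \<psi> :: "'a::euclidean_space \<Rightarrow> complex"
  assumes [measurable]: "\<psi> \<in> borel_measurable borel" and B: "\<And>x. norm (\<psi> x) \<le> B" and supp: "\<And>x. norm x > R \<Longrightarrow> \<psi> x = 0"
  shows "\<exists>C\<ge>0. \<forall>e x. 0 < e \<longrightarrow> e \<le> 1 \<longrightarrow>
    (\<integral>\<^sup>+y. ennreal (heat e (x - y)) * ennreal (norm (\<psi> y)) \<partial>lborel) \<le> ennreal (C / (1 + norm x) ^ N)"
proof -
  obtain D where D: "D > 0" "\<And>x. norm (\<psi> x) * (1 + norm x) ^ N \<le> D"
    using rapid_bound[OF rapid_bounded_support[OF assms]] by blast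
  let ?J = "LINT z|lborel. norm (complex_of_real (heat 1 (z::'a))) * (1 + norm z) ^ N"
  have J: "?J \<ge> 0" by (intro integral_nonneg_AE AE_I2) simp
  show ?thesis
  proof (intro exI[of _ "D * ?J"] conjI allI impI)
    show "D * ?J \<ge> 0" using D J by simp
    fix e :: real and x :: 'a assume e: "0 < e" "e \<le> 1"
    have pos: "(1 + norm x) ^ N > 0" by (intro zero_less_power) (simp add: add_pos_nonneg)
    have "norm (\<psi> (x + sqrt e *\<^sub>R z)) \<le> D / (1 + norm x) ^ N * (1 + norm z) ^ N" for z
    proof -
      let ?y = "x + sqrt e *\<^sub>R z"
      have "(1 + norm x) ^ N \<le> (1 + norm ?y) ^ N * (1 + norm (- (sqrt e *\<^sub>R z))) ^ N"
        using one_plus_norm_power_submult[of ?y "- (sqrt e *\<^sub>R z)" N] by simp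
      also have "(1 + norm (- (sqrt e *\<^sub>R z))) ^ N \<le> (1 + norm z) ^ N"
        using e by (intro power_mono add_left_mono) (auto simp: mult_left_le_one_le)
      finally have "(1 + norm x) ^ N \<le> (1 + norm ?y) ^ N * (1 + norm z) ^ N" by (simp add: mult_left_mono)
      then have "norm (\<psi> ?y) * (1 + norm x) ^ N \<le> norm (\<psi> ?y) * ((1 + norm ?y) ^ N * (1 + norm z) ^ N)"
        by (rule mult_left_mono) simp
      also have "\<dots> \<le> D * (1 + norm z) ^ N"
        unfolding mult.assoc[symmetric] by (intro mult_right_mono D) simp
      finally show ?thesis
        using pos by (simp only: times_divide_eq_left pos_le_divide_eq)
    qed
    then have "(\<integral>\<^sup>+z. ennreal (heat 1 z) * ennreal (norm (\<psi> (x + sqrt e *\<^sub>R z))) \<partial>lborel)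
        \<le> (\<integral>\<^sup>+z. ennreal (heat 1 (z::'a)) * ennreal (D / (1 + norm x) ^ N * (1 + norm z) ^ N) \<partial>lborel)"
      by (intro nn_integral_mono mult_left_mono ennreal_leI) auto
    also have "\<dots> = (\<integral>\<^sup>+z. ennreal (D / (1 + norm x) ^ N) * ennreal (norm (complex_of_real (heat 1 (z::'a))) * (1
        + norm z) ^ N) \<partial>lborel)"
    proof (intro nn_integral_cong)
      fix z :: 'a
      have D': "D / (1 + norm x) ^ N \<ge> 0" using D pos by simp
      show "ennreal (heat 1 z) * ennreal (D / (1 + norm x) ^ N * (1 + norm z) ^ N) =
          ennreal (D / (1 + norm x) ^ N) * ennreal (norm (complex_of_real (heat 1 z)) * (1 + norm z) ^ N)"
        unfolding norm_of_real abs_of_pos[OF heat_pos[OF zero_less_one]] ennreal_mult'[OF D'] ennreal_mult'[OF less_imp_le[OF heat_pos[OF zero_less_one]]]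
        by (simp only: mult_ac)
    qed
    also have "\<dots> = ennreal (D / (1 + norm x) ^ N) * (\<integral>\<^sup>+z. ennreal (norm (complex_of_real (heat 1 (z::'a))) * (1
        + norm z) ^ N) \<partial>lborel)"
      by (rule nn_integral_cmult) measurable
    also have "(\<integral>\<^sup>+z. ennreal (norm (complex_of_real (heat 1 (z::'a))) * (1 + norm z) ^ N) \<partial>lborel) = ennreal ?J"
      by (intro nn_integral_eq_integral integrable_rapid_weight rapid_heat AE_I2) auto
    also have "ennreal (D / (1 + norm x) ^ N) * ennreal ?J = ennreal (D * ?J / (1 + norm x) ^ N)"
      using D J pos by (subst ennreal_mult[symmetric]) auto
    finally show "(\<integral>\<^sup>+y. ennreal (heat e (x - y)) * ennreal (norm (\<psi> y)) \<partial>lborel) \<le> ennreal (D * ?J / (1 + norm x) ^ N)"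
      using e by (subst nn_integral_heat_scale) auto
  qed
qed

text \<open>The convolution of \<open>h\<close> with the heat kernel at scale \<open>e\<close>.\<close>

abbreviation mollified :: "real \<Rightarrow> ('a::euclidean_space \<Rightarrow> complex) \<Rightarrow> 'a \<Rightarrow> complex" where
  "mollified e h y \<equiv> LINT x|lborel. h x * of_real (heat e (x - y))"

text \<open>Fubini moves the mollification from \<open>\<psi>\<close> to \<open>h\<close>, where Cauchy-Schwarz and the assumption apply.
  The mollifications \<open>m e\<close> of \<open>\<psi>\<close> converge to \<open>\<psi>\<close> and are dominated uniformly, so the bound persists
  as \<open>e\<close> tends to zero.\<close>

lemma pairing_bound_of_mollified:
  fixes h \<psi> :: "'a::euclidean_space \<Rightarrow> complex"
  assumes h: "temperate h"
    and K: "\<And>e. 0 < e \<Longrightarrow> e \<le> 1 \<Longrightarrow>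
      (\<integral>\<^sup>+y. ennreal ((norm (mollified e h y))\<^sup>2) \<partial>lborel) \<le> ennreal (k\<^sup>2)"
    and cont: "continuous_on UNIV \<psi>" and B: "\<And>x. norm (\<psi> x) \<le> B" and supp: "\<And>x. norm x > R \<Longrightarrow> \<psi> x = 0"
  shows "(norm (LINT x|lborel. h x * \<psi> x))\<^sup>2 \<le> k\<^sup>2 * (LINT x|lborel. (norm (\<psi> x))\<^sup>2)"
proof -
  note [measurable] = temperate_measurable[OF h] borel_measurable_continuous_onI[OF cont]
  have rapid\<psi>: "rapid \<psi>" by (rule rapid_bounded_support[OF _ B supp]) measurable
  from h obtain N where N: "integrable lborel (\<lambda>x. h x / of_real ((1 + norm x) ^ N))"
    unfolding temperate_def by blast
  obtain C where C: "C \<ge> 0" and decay: "\<And>e x. 0 < e \<Longrightarrow> e \<le> 1 \<Longrightarrow>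
    (\<integral>\<^sup>+y. ennreal (heat e (x - y)) * ennreal (norm (\<psi> y)) \<partial>lborel) \<le> ennreal (C / (1 + norm x) ^ N)"
    using mollification_decay[OF borel_measurable_continuous_onI[OF cont] B supp, where N=N] by blast
  have pos: "(1 + norm x) ^ N > 0" for x :: 'a by (intro zero_less_power) (simp add: add_pos_nonneg)
  define m where "m e x = (LINT y|lborel. of_real (heat e (x - y)) * \<psi> y)" for e x
  have [measurable]: "m e \<in> borel_measurable borel" for e unfolding m_def[abs_def] by measurable
  have dom: "integrable lborel (\<lambda>x. C * norm (h x / of_real ((1 + norm x) ^ N)))"
    by (intro integrable_mult_right integrable_norm N)
  have dom_eq: "norm (h x) * (C / (1 + norm x) ^ N) = C * norm (h x / of_real ((1 + norm x) ^ N))" for x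
    using pos[of x] by (simp only: norm_divide norm_of_real abs_of_pos times_divide_eq_right mult.commute)
  have m_bound: "norm (m e x) \<le> C / (1 + norm x) ^ N" if e: "0 < e" "e \<le> 1" for e x
  proof -
    have "ennreal (norm (m e x)) \<le> (\<integral>\<^sup>+y. ennreal (norm (of_real (heat e (x - y)) * \<psi> y)) \<partial>lborel)"
    proof (cases "integrable lborel (\<lambda>y. of_real (heat e (x - y)) * \<psi> y)")
      case True
      then show ?thesis unfolding m_def by (rule integral_norm_bound_ennreal)
    next
      case False
      then show ?thesis unfolding m_def by (simp add: not_integrable_integral_eq)
    qed
    also have "\<dots> = (\<integral>\<^sup>+y. ennreal (heat e (x - y)) * ennreal (norm (\<psi> y)) \<partial>lborel)"
      by (simp add: norm_mult abs_of_pos[OF heat_pos[OF e(1)]] ennreal_mult less_imp_le[OF heat_pos[OF e(1)]])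
    also have "\<dots> \<le> ennreal (C / (1 + norm x) ^ N)" by (rule decay[OF e])
    finally show ?thesis using C pos[of x] by (simp only: ennreal_le_iff divide_nonneg_pos)
  qed
  have moll: "(norm (LINT x|lborel. h x * m e x))\<^sup>2 \<le> k\<^sup>2 * (LINT x|lborel. (norm (\<psi> x))\<^sup>2)" if e: "0 < e" "e \<le> 1" for e
  proof -
    define Q where "Q = (\<lambda>(x, y). h x * (of_real (heat e (x - y)) * \<psi> y))"
    have [measurable]: "Q \<in> borel_measurable (lborel \<Otimes>\<^sub>M lborel)" unfolding Q_def by measurable
    have Qx: "(\<integral>\<^sup>+y. ennreal (norm (Q (x, y))) \<partial>lborel) \<le> ennreal (C * norm (h x / of_real ((1 + norm x) ^ N)))" for x
    proof -
      have "(\<integral>\<^sup>+y. ennreal (norm (Q (x, y))) \<partial>lborel) = (\<integral>\<^sup>+y. ennreal (norm (h x))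
          * (ennreal (heat e (x - y)) * ennreal (norm (\<psi> y))) \<partial>lborel)"
        by (simp add: Q_def norm_mult abs_of_pos[OF heat_pos[OF e(1)]] ennreal_mult less_imp_le[OF heat_pos[OF e(1)]])
      also have "\<dots> = ennreal (norm (h x)) * (\<integral>\<^sup>+y. ennreal (heat e (x - y)) * ennreal (norm (\<psi> y)) \<partial>lborel)"
        by (rule nn_integral_cmult) measurable
      also have "\<dots> \<le> ennreal (norm (h x)) * ennreal (C / (1 + norm x) ^ N)"
        by (intro mult_left_mono decay e) auto
      also have "\<dots> = ennreal (C * norm (h x / of_real ((1 + norm x) ^ N)))"
        unfolding dom_eq[symmetric] by (rule ennreal_mult'[symmetric]) simp
      finally show ?thesis .
    qed
    have Q: "integrable (lborel \<Otimes>\<^sub>M lborel) Q"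
    proof (rule integrableI_bounded)
      have "(\<integral>\<^sup>+z. ennreal (norm (Q z)) \<partial>(lborel \<Otimes>\<^sub>M lborel)) = (\<integral>\<^sup>+x. \<integral>\<^sup>+y. ennreal (norm (Q (x, y))) \<partial>lborel \<partial>lborel)"
        by (rule lborel.nn_integral_fst[symmetric]) measurable
      also have "\<dots> \<le> (\<integral>\<^sup>+x. ennreal (C * norm (h x / of_real ((1 + norm x) ^ N))) \<partial>lborel)"
        by (rule nn_integral_mono) (rule Qx)
      also have "\<dots> < \<infinity>"
      proof -
        have "norm (C * norm (h x / of_real ((1 + norm x) ^ N))) = C * norm (h x / of_real ((1 + norm x) ^ N))" for x
          using C by (simp only: real_norm_def abs_mult abs_of_nonneg norm_ge_zero)
        then show ?thesis using dom unfolding integrable_iff_bounded by (simp only:)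
      qed
      finally show "(\<integral>\<^sup>+z. ennreal (norm (Q z)) \<partial>(lborel \<Otimes>\<^sub>M lborel)) < \<infinity>" .
    qed measurable
    let ?H = "\<lambda>y. LINT x|lborel. h x * of_real (heat e (x - y))"
    have "(LINT x|lborel. h x * m e x) = (LINT x|lborel. LINT y|lborel. Q (x, y))"
      unfolding m_def Q_def by simp
    also have "\<dots> = (LINT y|lborel. LINT x|lborel. Q (x, y))"
      using lborel_pair.Fubini_integral[of "\<lambda>a b. Q (a, b)"] Q by simp
    also have "\<dots> = (LINT y|lborel. ?H y * \<psi> y)"
      unfolding Q_def by (simp add: mult.assoc[symmetric])
    finally have eq: "(LINT x|lborel. h x * m e x) = (LINT y|lborel. ?H y * \<psi> y)" .
    have "ennreal (norm (LINT y|lborel. ?H y * \<psi> y)) \<le> (\<integral>\<^sup>+y. ennreal (norm (?H y)) * ennreal (norm (\<psi> y)) \<partial>lborel)"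
    proof (cases "integrable lborel (\<lambda>y. ?H y * \<psi> y)")
      case True
      from integral_norm_bound_ennreal[OF this] show ?thesis by (simp add: norm_mult ennreal_mult)
    qed (simp add: not_integrable_integral_eq)
    then have "(ennreal (norm (LINT y|lborel. ?H y * \<psi> y)))\<^sup>2
        \<le> (\<integral>\<^sup>+y. ennreal (norm (?H y)) * ennreal (norm (\<psi> y)) \<partial>lborel)\<^sup>2"
      by (intro power_mono) auto
    also have "\<dots> \<le> (\<integral>\<^sup>+y. (ennreal (norm (?H y)))\<^sup>2 \<partial>lborel) * (\<integral>\<^sup>+y. (ennreal (norm (\<psi> y)))\<^sup>2 \<partial>lborel)"
      by (rule Cauchy_Schwarz_nn_integral) measurable
    also have "\<dots> = (\<integral>\<^sup>+y. ennreal ((norm (?H y))\<^sup>2) \<partial>lborel) * (\<integral>\<^sup>+y. ennreal ((norm (\<psi> y))\<^sup>2) \<partial>lborel)"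
      by (simp only: ennreal_power norm_ge_zero)
    also have "\<dots> \<le> ennreal (k\<^sup>2) * (\<integral>\<^sup>+y. ennreal ((norm (\<psi> y))\<^sup>2) \<partial>lborel)"
      by (intro mult_right_mono K e) simp
    also have "(\<integral>\<^sup>+y. ennreal ((norm (\<psi> y))\<^sup>2) \<partial>lborel) = ennreal (LINT y|lborel. (norm (\<psi> y))\<^sup>2)"
    proof (rule nn_integral_eq_integral)
      have "rapid (\<lambda>x. \<psi> x * \<psi> x)" by (rule rapid_bounded_mult[OF rapid\<psi> _ B]) measurable
      from rapid_integrable[OF this] have "integrable lborel (\<lambda>x. norm (\<psi> x * \<psi> x))" by (rule integrable_norm)
      then show "integrable lborel (\<lambda>y. (norm (\<psi> y))\<^sup>2)" by (simp only: norm_mult power2_eq_square)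
    qed simp
    also have "ennreal (k\<^sup>2) * \<dots> = ennreal (k\<^sup>2 * (LINT y|lborel. (norm (\<psi> y))\<^sup>2))"
      by (rule ennreal_mult'[symmetric]) simp
    finally have "ennreal ((norm (LINT y|lborel. ?H y * \<psi> y))\<^sup>2) \<le> ennreal (k\<^sup>2 * (LINT y|lborel. (norm (\<psi> y))\<^sup>2))"
      by (simp only: ennreal_power norm_ge_zero)
    then show ?thesis unfolding eq
      by (subst (asm) ennreal_le_iff) (auto intro!: mult_nonneg_nonneg integral_nonneg_AE)
  qed
  have "(\<lambda>j. LINT x|lborel. h x * m (1 / real (Suc j)) x) \<longlonglongrightarrow> (LINT x|lborel. h x * \<psi> x)"
  proof (rule integral_dominated_convergence[OF _ _ dom])
    show "AE x in lborel. norm (h x * m (1 / real (Suc j)) x) \<le> C * norm (h x / of_real ((1 + norm x) ^ N))" for j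
      unfolding dom_eq[symmetric] norm_mult by (intro AE_I2 mult_left_mono m_bound) auto
    show "AE x in lborel. (\<lambda>j. h x * m (1 / real (Suc j)) x) \<longlonglongrightarrow> h x * \<psi> x"
      unfolding m_def by (intro AE_I2 tendsto_mult tendsto_const heat_approximates_identity[OF cont B])
  qed measurable
  then have "(\<lambda>j. (norm (LINT x|lborel. h x * m (1 / real (Suc j)) x))\<^sup>2) \<longlonglongrightarrow> (norm (LINT x|lborel. h x * \<psi> x))\<^sup>2"
    by (intro tendsto_power tendsto_norm)
  then show ?thesis
    by (rule LIMSEQ_le_const2) (use moll in auto)
qed

text \<open>Lebesgue measurable functions are almost everywhere limits of continuous ones. Composing the
  approximants with the radial retraction \<open>tr\<close> onto the ball of radius \<open>B\<close> and multiplying them by a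
  cutoff makes them uniformly bounded with a common bounded support.\<close>

lemma bounded_support_approx_continuous:
  fixes \<psi> :: "'a::euclidean_space \<Rightarrow> complex"
  assumes [measurable]: "\<psi> \<in> borel_measurable borel" and B: "\<And>x. norm (\<psi> x) \<le> B" "B > 0"
    and supp: "\<And>x. norm x > R \<Longrightarrow> \<psi> x = 0"
  shows "\<exists>g :: nat \<Rightarrow> 'a \<Rightarrow> complex. (\<forall>n. continuous_on UNIV (g n)) \<and> (\<forall>n x. norm (g n x) \<le> B) \<and>
    (\<forall>n x. norm x > R + 1 \<longrightarrow> g n x = 0) \<and> (AE x in lborel. (\<lambda>n. g n x) \<longlonglongrightarrow> \<psi> x)"
proof -
  have "\<psi> \<in> borel_measurable lebesgue" by (rule measurable_completion) measurable
  then have "\<psi> measurable_on UNIV" by (rule lebesgue_measurable_imp_measurable_on) simp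
  then obtain N f where N: "negligible N" and f: "\<And>n. continuous_on UNIV (f n)"
    and lim: "\<And>x. x \<notin> N \<Longrightarrow> (\<lambda>n. f n x) \<longlonglongrightarrow> \<psi> x"
    unfolding measurable_on_def by auto
  define cut where "cut x = max 0 (min 1 (R + 1 - norm x))" for x :: 'a
  define tr where "tr z = z / of_real (max 1 (norm z / B))" for z :: complex
  have cut01: "0 \<le> cut x" "cut x \<le> 1" for x by (auto simp: cut_def)
  have m1: "max 1 (norm z / B) > 0" for z :: complex by (simp add: less_max_iff_disj)
  have trB: "norm (tr z) \<le> B" for z
  proof -
    have "norm z \<le> B * max 1 (norm z / B)" using B(2) by (auto simp: max_def field_simps)
    then show ?thesis using m1[of z] by (simp only: tr_def norm_divide norm_of_real abs_of_pos pos_divide_le_eq)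
  qed
  have tr_id: "tr (\<psi> x) = \<psi> x" for x
    using B(1)[of x] B(2) by (simp add: tr_def max_def)
  have "complex_of_real (max 1 (norm z / B)) \<noteq> 0" for z :: complex
    unfolding of_real_eq_0_iff using m1[of z] by linarith
  then have "continuous_on UNIV tr"
    unfolding tr_def[abs_def] using B(2) by (intro continuous_intros) auto
  then have ctr: "isCont tr z" for z by (simp add: continuous_on_eq_continuous_at)
  define g where "g n x = of_real (cut x) * tr (f n x)" for n x
  show ?thesis
  proof (intro exI[of _ g] conjI allI impI)
    show "continuous_on UNIV (g n)" for n
      unfolding g_def[abs_def] cut_def
      by (intro continuous_intros continuous_on_compose2[OF \<open>continuous_on UNIV tr\<close> f]) auto
    show "norm (g n x) \<le> B" for n x
    proof -
      have "cut x * norm (tr (f n x)) \<le> 1 * B" using cut01 trB by (intro mult_mono) auto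
      then show ?thesis using cut01[of x] by (simp add: g_def norm_mult)
    qed
    show "g n x = 0" if "norm x > R + 1" for n x using that by (simp add: g_def cut_def)
    have "AE x in lebesgue. x \<notin> N" using N by (intro AE_not_in) (simp add: negligible_iff_null_sets)
    then have "AE x in lborel. x \<notin> N" by (simp add: AE_completion_iff)
    then show "AE x in lborel. (\<lambda>n. g n x) \<longlonglongrightarrow> \<psi> x"
    proof eventually_elim
      case (elim x)
      have "(\<lambda>n. g n x) \<longlonglongrightarrow> of_real (cut x) * tr (\<psi> x)"
        unfolding g_def by (intro tendsto_mult tendsto_const isCont_tendsto_compose[OF ctr] lim elim)
      also have "of_real (cut x) * tr (\<psi> x) = \<psi> x"
        unfolding tr_id using supp[of x] by (cases "norm x > R") (auto simp: cut_def)
      finally show ?case .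
    qed
  qed
qed

text \<open>Pairing \<open>h\<close> with its own conjugate, truncated to a set \<open>E M\<close> where \<open>h\<close> and its argument are
  bounded, gives \<open>I\<^sup>2 \<le> k\<^sup>2 I\<close> for \<open>I\<close> the integral of \<open>|h|\<^sup>2\<close> over \<open>E M\<close>. The pairing bound extends from
  continuous functions to the truncated conjugate by approximation.\<close>

theorem L2_bound_of_mollified:
  fixes h :: "'a::euclidean_space \<Rightarrow> complex"
  assumes h: "temperate h"
    and K: "\<And>e. 0 < e \<Longrightarrow> e \<le> 1 \<Longrightarrow>
      (\<integral>\<^sup>+y. ennreal ((norm (mollified e h y))\<^sup>2) \<partial>lborel) \<le> ennreal (k\<^sup>2)"
  shows "energy h \<le> ennreal (k\<^sup>2)"
proof (rule nn_integral_fatou_bound)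
  note [measurable] = temperate_measurable[OF h]
  define E where "E M = {x. norm x \<le> real M \<and> norm (h x) \<le> real M}" for M
  have [measurable]: "E M \<in> sets borel" for M unfolding E_def by measurable
  let ?f = "\<lambda>M x. ennreal ((norm (h x))\<^sup>2 * indicator (E M) x)"
  show "?f M \<in> borel_measurable lborel" for M by measurable
  have "eventually (\<lambda>M. ?f M x = ennreal ((norm (h x))\<^sup>2)) sequentially" for x
  proof -
    obtain M0 :: nat where "max (norm x) (norm (h x)) \<le> real M0" using real_arch_simple by blast
    then show ?thesis
      by (intro eventually_sequentiallyI[of M0]) (auto simp: E_def indicator_def)
  qed
  then have "(\<lambda>M. ?f M x) \<longlonglongrightarrow> ennreal ((norm (h x))\<^sup>2)" for x by (rule tendsto_eventually)
  then have "liminf (\<lambda>M. ?f M x) = ennreal ((norm (h x))\<^sup>2)" for x by (intro lim_imp_Liminf) auto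
  then show "AE x in lborel. ennreal ((norm (h x))\<^sup>2) \<le> liminf (\<lambda>M. ?f M x)" by (simp only: order_refl eventually_True)
  show "(\<integral>\<^sup>+x. ?f M x \<partial>lborel) \<le> ennreal (k\<^sup>2)" for M
  proof -
    define \<psi> where "\<psi> x = cnj (h x) * indicator (E M) x" for x
    have [measurable]: "\<psi> \<in> borel_measurable borel" unfolding \<psi>_def[abs_def] by measurable
    define B where "B = real M + 1"
    have B: "norm (\<psi> x) \<le> B" "B > 0" for x by (auto simp: \<psi>_def E_def B_def indicator_def)
    have supp: "\<psi> x = 0" if "norm x > real M" for x using that by (auto simp: \<psi>_def E_def)
    obtain g where g: "\<And>n. continuous_on UNIV (g n)" "\<And>n x. norm (g n x) \<le> B"
      "\<And>n x. norm x > real M + 1 \<Longrightarrow> g n x = 0" and lim: "AE x in lborel. (\<lambda>n. g n x) \<longlonglongrightarrow> \<psi> x"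
      using bounded_support_approx_continuous[OF \<open>\<psi> \<in> borel_measurable borel\<close> B supp] by blast
    note [measurable] = borel_measurable_continuous_onI[OF g(1)]
    define D where "D x = (if norm x \<le> real M + 1 then complex_of_real B else 0)" for x :: 'a
    have [measurable]: "D \<in> borel_measurable borel" unfolding D_def[abs_def] by measurable
    have rapidD: "rapid D"
      by (rule rapid_bounded_support[where B=B and R="real M + 1"]) (use B(2) in \<open>auto simp: D_def\<close>)
    have gD: "norm (g n x) \<le> norm (D x)" for n x
      using g(2)[of n x] g(3)[of x n] B(2) by (auto simp: D_def)
    have "(\<lambda>n. LINT x|lborel. h x * g n x) \<longlonglongrightarrow> (LINT x|lborel. h x * \<psi> x)"
    proof (rule integral_dominated_convergence)
      show "integrable lborel (\<lambda>x. norm (h x * D x))"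
        by (intro integrable_norm integrable_temperate_mult h rapidD)
      show "AE x in lborel. norm (h x * g n x) \<le> norm (h x * D x)" for n
        unfolding norm_mult by (intro AE_I2 mult_left_mono gD) simp
      show "AE x in lborel. (\<lambda>n. h x * g n x) \<longlonglongrightarrow> h x * \<psi> x"
        using lim by eventually_elim (intro tendsto_intros)
    qed measurable
    then have 1: "(\<lambda>n. (norm (LINT x|lborel. h x * g n x))\<^sup>2) \<longlonglongrightarrow> (norm (LINT x|lborel. h x * \<psi> x))\<^sup>2"
      by (intro tendsto_intros)
    have 2: "(\<lambda>n. LINT x|lborel. (norm (g n x))\<^sup>2) \<longlonglongrightarrow> (LINT x|lborel. (norm (\<psi> x))\<^sup>2)"
    proof (rule integral_dominated_convergence)
      have "rapid (\<lambda>x. D x * D x)"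
        by (rule rapid_bounded_mult[OF rapidD, of _ B]) (use B(2) in \<open>auto simp: D_def\<close>)
      from rapid_integrable[OF this] have "integrable lborel (\<lambda>x. norm (D x * D x))" by (rule integrable_norm)
      then show "integrable lborel (\<lambda>x. (norm (D x))\<^sup>2)" by (simp only: norm_mult power2_eq_square)
      show "AE x in lborel. norm ((norm (g n x))\<^sup>2) \<le> (norm (D x))\<^sup>2" for n
        using gD by (intro AE_I2) (simp add: power_mono)
      show "AE x in lborel. (\<lambda>n. (norm (g n x))\<^sup>2) \<longlonglongrightarrow> (norm (\<psi> x))\<^sup>2"
        using lim by eventually_elim (intro tendsto_intros)
    qed measurable
    have "(norm (LINT x|lborel. h x * \<psi> x))\<^sup>2 \<le> k\<^sup>2 * (LINT x|lborel. (norm (\<psi> x))\<^sup>2)"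
      by (rule LIMSEQ_le[OF 1 tendsto_mult[OF tendsto_const 2]])
         (use pairing_bound_of_mollified[OF h K g] in blast)
    moreover have h\<psi>: "h x * \<psi> x = of_real ((norm (h x))\<^sup>2 * indicator (E M) x)" for x
      by (cases "x \<in> E M") (simp_all add: \<psi>_def complex_norm_square[symmetric] del: of_real_power)
    moreover have "(norm (\<psi> x))\<^sup>2 = (norm (h x))\<^sup>2 * indicator (E M) x" for x
      by (auto simp: \<psi>_def indicator_def)
    ultimately have ineq: "(LINT x|lborel. (norm (h x))\<^sup>2 * indicator (E M) x)\<^sup>2 \<le> k\<^sup>2
        * (LINT x|lborel. (norm (h x))\<^sup>2 * indicator (E M) x)"
      by (simp only: integral_complex_of_real norm_of_real power2_abs)
    let ?I = "LINT x|lborel. (norm (h x))\<^sup>2 * indicator (E M) x"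
    have I0: "?I \<ge> 0" by (intro integral_nonneg_AE AE_I2) simp
    have "?I \<le> k\<^sup>2"
    proof (cases "?I = 0")
      case False
      then show ?thesis using ineq I0 unfolding power2_eq_square[of ?I] by (simp add: mult_le_cancel_right)
    qed simp
    moreover have "integrable lborel (\<lambda>x. (norm (h x))\<^sup>2 * indicator (E M) x)"
    proof -
      have "integrable lborel (\<lambda>x. h x * \<psi> x)"
        by (intro integrable_temperate_mult h rapid_bounded_support[OF _ B(1) supp]) measurable
      then show ?thesis unfolding h\<psi> by (simp only: complex_of_real_integrable_eq)
    qed
    then have "(\<integral>\<^sup>+x. ?f M x \<partial>lborel) = ennreal ?I"
      by (intro nn_integral_eq_integral) auto
    ultimately show ?thesis by (simp add: ennreal_leI)
  qed
qed

section \<open>The Fourier transform of tempered functions\<close>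

lemma is_fourier_temperate: "is_fourier f h \<Longrightarrow> temperate f" "is_fourier f h \<Longrightarrow> temperate h"
  by (auto simp: is_fourier_def)

lemma is_fourier_test:
  "is_fourier f h \<Longrightarrow> \<phi> \<in> schwartz \<Longrightarrow> (LINT x|lborel. f x * fourier_integral \<phi> x) = (LINT x|lborel. h x * \<phi> x)"
  by (auto simp: is_fourier_def)

text \<open>The heat kernel centred at \<open>y\<close> is a Schwartz function whose transform is a modulated Gaussian.
  Thus the mollifications of the transform are the Fourier integrals of \<open>f\<close> times Gaussians.\<close>

lemma is_fourier_heat:
  fixes f h :: "'a::euclidean_space \<Rightarrow> complex"
  assumes "is_fourier f h" "e > 0"
  shows "(mollified e h y) = (LINT x|lborel. cis ((- y) \<bullet> x) * (f x * of_real (gauss e x)))"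
proof -
  define c where "c = complex_of_real (1 / sqrt (2 * pi * e) ^ DIM('a))"
  define \<phi> where "\<phi> x = cis (x \<bullet> 0) * complex_of_real (gauss (1 / e) (x - y))" for x :: 'a
  have \<phi>: "\<phi> \<in> schwartz" unfolding \<phi>_def[abs_def] using assms(2) by (intro modulated_gauss_schwartz) simp
  have heat: "complex_of_real (heat e (x - y)) = c * \<phi> x" for x
    by (simp add: heat_def c_def \<phi>_def)
  have "(mollified e h y) = (LINT x|lborel. c * (h x * \<phi> x))"
    unfolding heat by (simp only: mult.left_commute)
  also have "\<dots> = c * (LINT x|lborel. f x * fourier_integral \<phi> x)"
    by (simp only: integral_mult_right_zero is_fourier_test[OF assms(1) \<phi>])
  also have "\<dots> = (LINT x|lborel. c * (f x * fourier_integral \<phi> x))"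
    by (simp only: integral_mult_right_zero)
  also have "\<dots> = (LINT x|lborel. cis ((- y) \<bullet> x) * (f x * of_real (gauss e x)))"
  proof (intro Bochner_Integration.integral_cong refl)
    fix x
    have "c * fourier_integral \<phi> x = fourier_integral (\<lambda>x. c * \<phi> x) x"
      unfolding fourier_integral_def by (simp only: mult.left_commute[of _ c] integral_mult_right_zero)
    also have "\<dots> = cis (- (y \<bullet> x)) * of_real (gauss e x)"
      unfolding heat[symmetric] by (rule fourier_translated_heat[OF assms(2)])
    finally have "c * fourier_integral \<phi> x = cis ((- y) \<bullet> x) * of_real (gauss e x)" by simp
    then have "f x * (c * fourier_integral \<phi> x) = f x * (cis ((- y) \<bullet> x) * of_real (gauss e x))" by simp
    then show "c * (f x * fourier_integral \<phi> x) = cis ((- y) \<bullet> x) * (f x * of_real (gauss e x))"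
      by (simp only: mult.left_commute)
  qed
  finally show ?thesis .
qed

lemma nn_integral_lborel_uminus:
  fixes f :: "'a::euclidean_space \<Rightarrow> ennreal"
  assumes [measurable]: "f \<in> borel_measurable borel"
  shows "(\<integral>\<^sup>+x. f (- x) \<partial>lborel) = (\<integral>\<^sup>+x. f x \<partial>lborel)"
  using nn_integral_lborel_affine[of f "-1" 0] by simp

text \<open>By Plancherel's inequality for \<open>f\<close> times a Gaussian, which is integrable, the mollifications of
  \<open>h\<close> are bounded in \<open>L\<^sup>2\<close> uniformly in the scale.\<close>

lemma is_fourier_L2_bound:
  fixes f h :: "'a::euclidean_space \<Rightarrow> complex"
  assumes fh: "is_fourier f h" and f: "energy f \<le> ennreal (c\<^sup>2)"
  shows "energy h \<le> ennreal ((sqrt ((2 * pi) ^ DIM('a)) * c)\<^sup>2)"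
proof (rule L2_bound_of_mollified)
  show "temperate h" by (rule is_fourier_temperate[OF fh])
  fix e :: real assume e: "0 < e"
  note [measurable] = temperate_measurable[OF is_fourier_temperate(1)[OF fh]]
  let ?G = "\<lambda>x. f x * of_real (gauss e x)"
  have G: "integrable lborel ?G"
    by (rule integrable_temperate_mult[OF is_fourier_temperate(1)[OF fh] rapid_gauss[OF e]])
  have "(\<integral>\<^sup>+y. ennreal ((norm (mollified e h y))\<^sup>2) \<partial>lborel)
      = (\<integral>\<^sup>+y. ennreal ((norm (LINT x|lborel. cis ((- y) \<bullet> x) * ?G x))\<^sup>2) \<partial>lborel)"
    by (simp only: is_fourier_heat[OF fh e])
  also have "\<dots> = (\<integral>\<^sup>+y. ennreal ((norm (LINT x|lborel. cis (y \<bullet> x) * ?G x))\<^sup>2) \<partial>lborel)"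
    by (rule nn_integral_lborel_uminus[of "\<lambda>y. ennreal ((norm (LINT x|lborel. cis (y \<bullet> x) * ?G x))\<^sup>2)"]) measurable
  also have "\<dots> \<le> ennreal ((2 * pi) ^ DIM('a)) * (\<integral>\<^sup>+x. ennreal ((norm (?G x))\<^sup>2) \<partial>lborel)"
    by (rule plancherel_inequality[OF G])
  also have "\<dots> \<le> ennreal ((2 * pi) ^ DIM('a)) * ennreal (c\<^sup>2)"
  proof (rule mult_left_mono)
    have "norm (?G x) \<le> norm (f x)" for x
      using gauss_le_1[of e x] e
      by (simp add: norm_mult abs_of_pos[OF gauss_pos] mult_left_le)
    then have "(\<integral>\<^sup>+x. ennreal ((norm (?G x))\<^sup>2) \<partial>lborel) \<le> energy f"
      by (intro nn_integral_mono ennreal_leI power_mono) auto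
    with f show "(\<integral>\<^sup>+x. ennreal ((norm (?G x))\<^sup>2) \<partial>lborel) \<le> ennreal (c\<^sup>2)" by (rule order_trans[rotated])
  qed simp
  also have "\<dots> = ennreal ((sqrt ((2 * pi) ^ DIM('a)) * c)\<^sup>2)"
    by (simp add: power_mult_distrib ennreal_mult)
  finally show "(\<integral>\<^sup>+y. ennreal ((norm (mollified e h y))\<^sup>2) \<partial>lborel)
      \<le> ennreal ((sqrt ((2 * pi) ^ DIM('a)) * c)\<^sup>2)" .
qed

lemma temperate_diff:
  assumes "temperate f" "temperate g"
  shows "temperate (\<lambda>x. f x - g x)"
proof -
  have [measurable]: "g \<in> borel_measurable borel" by (rule temperate_measurable[OF assms(2)])
  have "temperate (\<lambda>x. - g x)" by (rule temperate_bound[OF assms(2)]) auto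
  from temperate_add[OF assms(1) this] show ?thesis by simp
qed

text \<open>The difference has vanishing mollifications, so \<open>L2_bound_of_mollified\<close> applies with \<open>k = 0\<close>.\<close>

lemma temperate_eq_AE_if_mollified_eq:
  fixes h1 h2 :: "'a::euclidean_space \<Rightarrow> complex"
  assumes h: "temperate h1" "temperate h2"
    and eq: "\<And>e y. 0 < e \<Longrightarrow> (mollified e h1 y) = (mollified e h2 y)"
  shows "AE x in lborel. h1 x = h2 x"
proof -
  note [measurable] = temperate_measurable[OF h(1)] temperate_measurable[OF h(2)]
  have "(\<integral>\<^sup>+x. ennreal ((norm (h1 x - h2 x))\<^sup>2) \<partial>lborel) \<le> ennreal (0\<^sup>2)"
  proof (rule L2_bound_of_mollified[OF temperate_diff[OF h]])
    fix e :: real assume e: "0 < e"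
    have "(LINT x|lborel. (h1 x - h2 x) * of_real (heat e (x - y))) = 0" for y
      unfolding left_diff_distrib
      by (subst Bochner_Integration.integral_diff)
         (auto simp: eq[OF e] intro!: integrable_temperate_mult h rapid_translate[OF rapid_heat[OF e]])
    then show "(\<integral>\<^sup>+y. ennreal ((norm (LINT x|lborel. (h1 x - h2 x) * of_real (heat e (x - y))))\<^sup>2) \<partial>lborel) \<le> ennreal (0\<^sup>2)"
      by simp
  qed
  then have "(\<integral>\<^sup>+x. ennreal ((norm (h1 x - h2 x))\<^sup>2) \<partial>lborel) = 0" by simp
  then have "AE x in lborel. ennreal ((norm (h1 x - h2 x))\<^sup>2) = 0"
    by (subst (asm) nn_integral_0_iff_AE) auto
  then show ?thesis by eventually_elim simp
qed

lemma is_fourier_unique: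
  fixes f h1 h2 :: "'a::euclidean_space \<Rightarrow> complex"
  assumes "is_fourier f h1" "is_fourier f h2"
  shows "AE x in lborel. h1 x = h2 x"
proof (rule temperate_eq_AE_if_mollified_eq)
  show "temperate h1" "temperate h2" using assms by (auto intro: is_fourier_temperate)
  fix e :: real and y :: 'a assume e: "0 < e"
  show "(mollified e h1 y) = (mollified e h2 y)"
    unfolding is_fourier_heat[OF assms(1) e] is_fourier_heat[OF assms(2) e] ..
qed

text \<open>The transform of a modulated centred Gaussian is a multiple of a translated heat kernel, so \<open>h\<close>
  determines the mollifications of \<open>f1\<close> and \<open>f2\<close>.\<close>

lemma is_fourier_inj:
  fixes f1 f2 h :: "'a::euclidean_space \<Rightarrow> complex"
  assumes "is_fourier f1 h" "is_fourier f2 h"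
  shows "AE x in lborel. f1 x = f2 x"
proof (rule temperate_eq_AE_if_mollified_eq)
  show "temperate f1" "temperate f2" using assms by (auto intro: is_fourier_temperate)
  fix e :: real and y :: 'a assume e: "0 < e"
  define c where "c = complex_of_real ((2 * pi) ^ DIM('a))"
  have c: "c \<noteq> 0" by (simp add: c_def)
  define \<phi> where "\<phi> x = cis (x \<bullet> y) * complex_of_real (gauss e (x - 0))" for x
  have \<phi>: "\<phi> \<in> schwartz" unfolding \<phi>_def[abs_def] by (rule modulated_gauss_schwartz[OF e])
  have F: "fourier_integral \<phi> x = c * of_real (heat e (x - y))" for x
    using fourier_modulated_gauss[OF e, of y x] by (simp add: \<phi>_def[abs_def] c_def)
  have "c * (mollified e f y) = (LINT x|lborel. h x * \<phi> x)" if "is_fourier f h" for f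
  proof -
    have "c * (mollified e f y) = (LINT x|lborel. f x * fourier_integral \<phi> x)"
      unfolding F by (subst mult.left_commute) (simp only: integral_mult_right_zero)
    then show ?thesis by (simp only: is_fourier_test[OF that \<phi>])
  qed
  from this[OF assms(1)] this[OF assms(2)]
  have "c * (mollified e f1 y) = c * (mollified e f2 y)"
    by (simp only:)
  then show "(mollified e f1 y) = (mollified e f2 y)"
    using c by (simp only: mult_cancel_left simp_thms)
qed

lemma is_fourier_cong:
  fixes f h h' :: "'a::euclidean_space \<Rightarrow> complex"
  assumes fh: "is_fourier f h" and [measurable]: "h' \<in> borel_measurable borel" and eq: "AE x in lborel. h x = h' x"
  shows "is_fourier f h'"
proof -
  note [measurable] = temperate_measurable[OF is_fourier_temperate(2)[OF fh]]
  have "temperate h'"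
  proof (rule temperate_bound[OF is_fourier_temperate(2)[OF fh]])
    show "AE x in lborel. norm (h' x) \<le> norm (h x)" using eq by eventually_elim simp
  qed measurable
  moreover have "(LINT x|lborel. h x * \<phi> x) = (LINT x|lborel. h' x * \<phi> x)" if "\<phi> \<in> schwartz" for \<phi>
  proof (rule integral_cong_AE)
    have [measurable]: "\<phi> \<in> borel_measurable borel" by (rule rapid_measurable[OF rapid_schwartz[OF that]])
    show "(\<lambda>x. h x * \<phi> x) \<in> borel_measurable lborel" "(\<lambda>x. h' x * \<phi> x) \<in> borel_measurable lborel" by measurable
    show "AE x in lborel. h x * \<phi> x = h' x * \<phi> x" using eq by eventually_elim simp
  qed
  ultimately show ?thesis
    unfolding is_fourier_def
    by (intro conjI ballI is_fourier_temperate(1)[OF fh]) (simp_all only: is_fourier_test[OF fh])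
qed

section \<open>Inverse transforms of truncated frequencies\<close>

text \<open>The default \<open>0\<close> makes a pointwise bound for the sequence hold for this value even where the
  sequence diverges, so that no exceptional set of points arises in the estimate in time.\<close>

definition lim_or_0 :: "(nat \<Rightarrow> complex) \<Rightarrow> complex" where
  "lim_or_0 s = (if Cauchy s then lim s else 0)"

lemma borel_measurable_lim_or_0 [measurable (raw)]:
  fixes f :: "nat \<Rightarrow> 'a \<Rightarrow> complex"
  assumes [measurable]: "\<And>j. f j \<in> borel_measurable M"
  shows "(\<lambda>x. lim_or_0 (\<lambda>j. f j x)) \<in> borel_measurable M"
  unfolding lim_or_0_def by measurable

lemma lim_or_0_le_liminf: "ennreal (norm (lim_or_0 s) powr q) \<le> liminf (\<lambda>j. ennreal (norm (s j) powr q))" if "q > 0"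
proof (cases "Cauchy s")
  case True
  then have "s \<longlonglongrightarrow> lim s" by (simp add: Cauchy_convergent_iff convergent_LIMSEQ_iff)
  then have "(\<lambda>j. norm (s j) powr q) \<longlonglongrightarrow> norm (lim s) powr q"
    using that by (intro tendsto_powr' tendsto_norm tendsto_const) auto
  then have "liminf (\<lambda>j. ennreal (norm (s j) powr q)) = ennreal (norm (lim s) powr q)"
    by (intro lim_imp_Liminf tendsto_ennrealI) auto
  with True show ?thesis by (simp add: lim_or_0_def)
qed (simp add: lim_or_0_def)

lemma lim_or_0_of_summable_differences:
  fixes s :: "nat \<Rightarrow> complex"
  assumes "(\<Sum>j. ennreal (norm (s (Suc j) - s j))) < \<infinity>"
  shows "s \<longlonglongrightarrow> lim_or_0 s"
    and "norm (s k) \<le> norm (s 0) + enn2real (\<Sum>j. ennreal (norm (s (Suc j) - s j)))"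
proof -
  have sum: "summable (\<lambda>j. norm (s (Suc j) - s j))"
    using assms by (intro summable_suminf_not_top) auto
  then have "summable (\<lambda>j. s (Suc j) - s j)" by (rule summable_norm_cancel)
  then have "convergent (\<lambda>n. \<Sum>j<n. s (Suc j) - s j)" by (simp add: summable_iff_convergent)
  then obtain L where "(\<lambda>n. \<Sum>j<n. s (Suc j) - s j) \<longlonglongrightarrow> L" unfolding convergent_def by blast
  then have "(\<lambda>n. (s n - s 0) + s 0) \<longlonglongrightarrow> L + s 0"
    unfolding sum_lessThan_telescope by (intro tendsto_add tendsto_const)
  then have "convergent s" by (auto simp: convergent_def)
  then show "s \<longlonglongrightarrow> lim_or_0 s"
    by (simp add: lim_or_0_def Cauchy_convergent_iff convergent_LIMSEQ_iff)
  have "(\<Sum>j. ennreal (norm (s (Suc j) - s j))) = ennreal (\<Sum>j. norm (s (Suc j) - s j))"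
    using sum by (intro suminf_ennreal2) auto
  moreover have "(\<Sum>j. norm (s (Suc j) - s j)) \<ge> 0" using sum by (intro suminf_nonneg) auto
  moreover have "norm (s k) \<le> norm (s 0) + (\<Sum>j. norm (s (Suc j) - s j))"
  proof -
    have "s k = s 0 + (\<Sum>j<k. s (Suc j) - s j)" by (simp add: sum_lessThan_telescope)
    then have "norm (s k) \<le> norm (s 0) + norm (\<Sum>j<k. s (Suc j) - s j)" by (metis norm_triangle_ineq)
    also have "norm (\<Sum>j<k. s (Suc j) - s j) \<le> (\<Sum>j<k. norm (s (Suc j) - s j))" by (rule norm_sum)
    also have "\<dots> \<le> (\<Sum>j. norm (s (Suc j) - s j))" by (rule sum_le_suminf[OF sum]) auto
    finally show ?thesis by simp
  qed
  ultimately show "norm (s k) \<le> norm (s 0) + enn2real (\<Sum>j. ennreal (norm (s (Suc j) - s j)))" by simp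
qed

lemma suminf_geometric_ennreal: "(\<Sum>j. ennreal ((1/4) ^ j)) = ennreal (4/3)"
proof -
  have "(\<lambda>j. (1/4::real) ^ j) sums (4/3)" using geometric_sums[of "1/4::real"] by simp
  then show ?thesis by (subst suminf_ennreal_eq) auto
qed

text \<open>Cauchy-Schwarz for series, with \<open>a j\<close> split as \<open>2\<^sup>-\<^sup>j\<close> times \<open>2\<^sup>j a j\<close>.\<close>

lemma suminf_square_le_weighted:
  fixes a :: "nat \<Rightarrow> real"
  shows "(\<Sum>j. ennreal \<bar>a j\<bar>)\<^sup>2 \<le> ennreal (4/3) * (\<Sum>j. ennreal (4 ^ j * (a j)\<^sup>2))"
proof -
  let ?C = "count_space (UNIV :: nat set)"
  have "(\<Sum>j. ennreal \<bar>a j\<bar>) = (\<integral>\<^sup>+j. ennreal ((1/2) ^ j) * ennreal (2 ^ j * \<bar>a j\<bar>) \<partial>?C)"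
    unfolding nn_integral_count_space_nat
    by (intro suminf_cong) (simp add: ennreal_mult[symmetric] power_divide)
  also have "\<dots>\<^sup>2 \<le> (\<integral>\<^sup>+j. (ennreal ((1/2) ^ j))\<^sup>2 \<partial>?C) * (\<integral>\<^sup>+j. (ennreal (2 ^ j * \<bar>a j\<bar>))\<^sup>2 \<partial>?C)"
    by (rule Cauchy_Schwarz_nn_integral) auto
  also have "(\<integral>\<^sup>+j. (ennreal ((1/2) ^ j))\<^sup>2 \<partial>?C) = ennreal (4/3)"
  proof -
    have "((1/2::real) ^ j)\<^sup>2 = (1/4) ^ j" for j by (simp add: power2_eq_square flip: power_mult_distrib)
    then show ?thesis
      unfolding nn_integral_count_space_nat suminf_geometric_ennreal[symmetric] by (simp add: ennreal_power)
  qed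
  also have "(\<integral>\<^sup>+j. (ennreal (2 ^ j * \<bar>a j\<bar>))\<^sup>2 \<partial>?C) = (\<Sum>j. ennreal (4 ^ j * (a j)\<^sup>2))"
  proof -
    have "((2::real) ^ j)\<^sup>2 = 4 ^ j" for j by (simp add: power2_eq_square flip: power_mult_distrib)
    then have "(2 ^ j * \<bar>a j\<bar>)\<^sup>2 = 4 ^ j * (a j)\<^sup>2" for j
      by (simp only: power_mult_distrib power2_abs)
    then show ?thesis unfolding nn_integral_count_space_nat by (simp add: ennreal_power)
  qed
  finally show ?thesis .
qed

text \<open>Each bound \<open>\<epsilon> j\<close> is met beyond some radius \<open>K j\<close>; partial sums of \<open>K i + 1\<close> are above these radii,
  increasing, and unbounded.\<close>

lemma exists_frequency_cutoffs:
  fixes f :: "'a::euclidean_space \<Rightarrow> real"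
  assumes f: "integrable lborel f" and f0: "\<And>x. f x \<ge> 0" and \<epsilon>: "\<And>j. \<epsilon> j > (0::real)"
  shows "\<exists>\<kappa> :: nat \<Rightarrow> real. (\<forall>j. real j + 1 \<le> \<kappa> j) \<and> incseq \<kappa> \<and>
    (\<forall>j. (\<integral>\<^sup>+x. ennreal (f x) * indicator {x. norm x > \<kappa> j} x \<partial>lborel) \<le> ennreal (\<epsilon> j))"
proof -
  note [measurable] = borel_measurable_integrable[OF f]
  have "(\<lambda>k. LINT x|lborel. f x * indicator {x. norm x > real k} x) \<longlonglongrightarrow> (LINT x|(lborel :: 'a measure). (0::real))"
  proof (rule integral_dominated_convergence[OF _ _ f])
    have "eventually (\<lambda>k. f x * indicator {x. norm x > real k} x = 0) sequentially" for x
    proof -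
      obtain k0 :: nat where "norm x \<le> real k0" using real_arch_simple by blast
      then show ?thesis by (intro eventually_sequentiallyI[of k0]) (auto simp: indicator_def)
    qed
    then show "AE x in lborel. (\<lambda>k. f x * indicator {x. norm x > real k} x) \<longlonglongrightarrow> 0"
      by (intro AE_I2 tendsto_eventually)
  qed (auto simp: f0 indicator_def)
  then have tail: "(\<lambda>k. LINT x|lborel. f x * indicator {x. norm x > real k} x) \<longlonglongrightarrow> 0" by simp
  have "\<exists>k::nat. (LINT x|lborel. f x * indicator {x. norm x > real k} x) \<le> \<epsilon> j" for j
    using order_tendstoD(2)[OF tail \<epsilon>[of j]] by (auto simp: eventually_sequentially intro: less_imp_le)
  then obtain K :: "nat \<Rightarrow> nat" where K: "\<And>j. (LINT x|lborel. f x * indicator {x. norm x > real (K j)} x) \<le> \<epsilon> j" by metis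
  define \<kappa> where "\<kappa> j = (\<Sum>i\<le>j. real (K i) + 1)" for j
  have \<kappa>K: "real (K j) \<le> \<kappa> j" for j
  proof -
    have "real (K j) + 1 \<le> \<kappa> j" unfolding \<kappa>_def by (rule member_le_sum) auto
    then show ?thesis by simp
  qed
  show ?thesis
  proof (intro exI[of _ \<kappa>] conjI allI)
    show "real j + 1 \<le> \<kappa> j" for j
    proof -
      have "(\<Sum>i\<le>j. 1) \<le> \<kappa> j" unfolding \<kappa>_def by (rule sum_mono) simp
      then show ?thesis by simp
    qed
    show "incseq \<kappa>" by (rule incseq_SucI) (simp add: \<kappa>_def)
    fix j
    have "integrable lborel (\<lambda>x. f x * indicator {x. norm x > real (K j)} x)"
      by (rule Bochner_Integration.integrable_bound[OF f]) (auto simp: indicator_def)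
    then have "(\<integral>\<^sup>+x. ennreal (f x * indicator {x. norm x > real (K j)} x) \<partial>lborel)
        = ennreal (LINT x|lborel. f x * indicator {x. norm x > real (K j)} x)"
      by (rule nn_integral_eq_integral) (simp add: f0)
    also have "\<dots> \<le> ennreal (\<epsilon> j)" by (rule ennreal_leI[OF K])
    finally have "(\<integral>\<^sup>+x. ennreal (f x * indicator {x. norm x > real (K j)} x) \<partial>lborel) \<le> ennreal (\<epsilon> j)" .
    moreover have "(\<integral>\<^sup>+x. ennreal (f x) * indicator {x. norm x > \<kappa> j} x \<partial>lborel)
        \<le> (\<integral>\<^sup>+x. ennreal (f x * indicator {x. norm x > real (K j)} x) \<partial>lborel)"
      using \<kappa>K[of j] by (intro nn_integral_mono) (auto simp: indicator_def)
    ultimately show "(\<integral>\<^sup>+x. ennreal (f x) * indicator {x. norm x > \<kappa> j} x \<partial>lborel) \<le> ennreal (\<epsilon> j)"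
      by (rule order_trans[rotated])
  qed
qed

definition inverse_fourier :: "('a::euclidean_space \<Rightarrow> complex) \<Rightarrow> 'a \<Rightarrow> complex" where
  "inverse_fourier G x = of_real (1 / (2 * pi) ^ DIM('a)) * (LINT \<xi>|lborel. cis (x \<bullet> \<xi>) * G \<xi>)"

lemma borel_measurable_inverse_fourier [measurable]:
  assumes [measurable]: "G \<in> borel_measurable borel"
  shows "inverse_fourier G \<in> borel_measurable borel"
  unfolding inverse_fourier_def[abs_def] by measurable

lemma inverse_fourier_diff:
  assumes "integrable lborel G" "integrable lborel H"
  shows "inverse_fourier G x - inverse_fourier H x = inverse_fourier (\<lambda>\<xi>. G \<xi> - H \<xi>) x"
  unfolding inverse_fourier_def right_diff_distrib[symmetric]
  by (subst Bochner_Integration.integral_diff[symmetric])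
     (auto intro!: integrable_cis_mult assms simp: right_diff_distrib)

lemma norm_inverse_fourier_le:
  "norm (inverse_fourier G (x::'a::euclidean_space)) \<le> 1 / (2 * pi) ^ DIM('a) * (LINT \<xi>|lborel. norm (G \<xi>))"
proof -
  have "norm (LINT \<xi>|lborel. cis (x \<bullet> \<xi>) * G \<xi>) \<le> (LINT \<xi>|lborel. norm (G \<xi>))"
    using integral_norm_bound[of lborel "\<lambda>\<xi>. cis (x \<bullet> \<xi>) * G \<xi>"] by (simp add: norm_mult)
  then have "1 / (2 * pi) ^ DIM('a) * norm (LINT \<xi>|lborel. cis (x \<bullet> \<xi>) * G \<xi>) \<le> 1 / (2 * pi) ^ DIM('a)
      * (LINT \<xi>|lborel. norm (G \<xi>))"
    by (rule mult_left_mono) simp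
  moreover have "norm (complex_of_real (1 / (2 * pi) ^ DIM('a))) = 1 / (2 * pi) ^ DIM('a)"
    unfolding norm_of_real by simp
  ultimately show ?thesis unfolding inverse_fourier_def norm_mult by simp
qed

lemma inverse_fourier_L2_bound:
  fixes G :: "'a::euclidean_space \<Rightarrow> complex"
  assumes G: "integrable lborel G"
  shows "(\<integral>\<^sup>+x. ennreal ((norm (inverse_fourier G x))\<^sup>2) \<partial>lborel) \<le> ennreal (1 / (2 * pi) ^ DIM('a)) * energy G"
proof -
  let ?c = "1 / (2 * pi) ^ DIM('a)"
  note [measurable] = borel_measurable_integrable[OF G]
  have c: "?c > 0" by simp
  have "(norm (inverse_fourier G x))\<^sup>2 = ?c\<^sup>2 * (norm (LINT \<xi>|lborel. cis (x \<bullet> \<xi>) * G \<xi>))\<^sup>2" for x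
    unfolding inverse_fourier_def norm_mult power_mult_distrib norm_of_real power2_abs ..
  then have "(\<integral>\<^sup>+x. ennreal ((norm (inverse_fourier G x))\<^sup>2) \<partial>lborel)
      = (\<integral>\<^sup>+x. ennreal (?c\<^sup>2) * ennreal ((norm (LINT \<xi>|lborel. cis (x \<bullet> \<xi>) * G \<xi>))\<^sup>2) \<partial>lborel)"
    by (simp only: ennreal_mult' zero_le_power2)
  also have "\<dots> = ennreal (?c\<^sup>2) * (\<integral>\<^sup>+x. ennreal ((norm (LINT \<xi>|lborel. cis (x \<bullet> \<xi>) * G \<xi>))\<^sup>2) \<partial>lborel)"
    by (rule nn_integral_cmult) measurable
  also have "\<dots> \<le> ennreal (?c\<^sup>2) * (ennreal ((2 * pi) ^ DIM('a)) * energy G)"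
    by (intro mult_left_mono plancherel_inequality G) simp
  also have "\<dots> = (ennreal (?c\<^sup>2) * ennreal ((2 * pi) ^ DIM('a))) * energy G"
    by (simp only: mult.assoc)
  also have "ennreal (?c\<^sup>2) * ennreal ((2 * pi) ^ DIM('a)) = ennreal (?c\<^sup>2 * (2 * pi) ^ DIM('a))"
    by (rule ennreal_mult[symmetric]) auto
  also have "?c\<^sup>2 * (2 * pi) ^ DIM('a) = ?c" by (simp add: power2_eq_square)
  finally show ?thesis .
qed

text \<open>The defining identity of \<open>is_fourier\<close> for \<open>inverse_fourier G\<close> and \<open>G\<close>: Fubini and the inversion
  formula for \<open>\<phi>\<close>.\<close>

lemma inverse_fourier_pairing:
  fixes G \<phi> :: "'a::euclidean_space \<Rightarrow> complex"
  assumes G: "integrable lborel G" and \<phi>: "\<phi> \<in> schwartz"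
  shows "(LINT x|lborel. inverse_fourier G x * fourier_integral \<phi> x) = (LINT \<xi>|lborel. G \<xi> * \<phi> \<xi>)"
proof -
  note [measurable] = borel_measurable_integrable[OF G] rapid_measurable[OF rapid_schwartz[OF \<phi>]]
  note iF = rapid_integrable[OF rapid_fourier[OF \<phi>]]
  define c where "c = complex_of_real (1 / (2 * pi) ^ DIM('a))"
  have c: "c * of_real ((2 * pi) ^ DIM('a)) = 1" unfolding c_def of_real_mult[symmetric] by simp
  define Q where "Q = (\<lambda>(x, \<xi>). cis (x \<bullet> \<xi>) * (fourier_integral \<phi> x * G \<xi>))"
  have [measurable]: "Q \<in> borel_measurable (lborel \<Otimes>\<^sub>M lborel)" unfolding Q_def by measurable
  have Q: "integrable (lborel \<Otimes>\<^sub>M lborel) Q"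
  proof (rule Bochner_Integration.integrable_bound)
    show "integrable (lborel \<Otimes>\<^sub>M lborel) (\<lambda>(x, \<xi>). fourier_integral \<phi> x * G \<xi>)"
      by (rule integrable_tensor[OF lborel.sigma_finite_measure_axioms iF G])
  qed (auto simp: Q_def norm_mult)
  have 1: "inverse_fourier G x * fourier_integral \<phi> x = c * (LINT \<xi>|lborel. Q (x, \<xi>))" for x
  proof -
    have "(LINT \<xi>|lborel. Q (x, \<xi>)) = (LINT \<xi>|lborel. fourier_integral \<phi> x * (cis (x \<bullet> \<xi>) * G \<xi>))"
      by (simp add: Q_def mult.left_commute)
    also have "\<dots> = fourier_integral \<phi> x * (LINT \<xi>|lborel. cis (x \<bullet> \<xi>) * G \<xi>)"
      by (rule integral_mult_right_zero)
    finally show ?thesis by (simp only: inverse_fourier_def c_def mult_ac)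
  qed
  have 2: "(LINT x|lborel. Q (x, \<xi>)) = of_real ((2 * pi) ^ DIM('a)) * (G \<xi> * \<phi> \<xi>)" for \<xi>
  proof -
    have "(LINT x|lborel. Q (x, \<xi>)) = (LINT x|lborel. (cis (x \<bullet> \<xi>) * fourier_integral \<phi> x) * G \<xi>)"
      by (simp add: Q_def mult.assoc)
    also have "\<dots> = (LINT x|lborel. cis (x \<bullet> \<xi>) * fourier_integral \<phi> x) * G \<xi>"
      by (rule integral_mult_left_zero)
    finally show ?thesis unfolding fourier_inversion_schwartz[OF \<phi>] by (simp only: mult_ac)
  qed
  have "(LINT x|lborel. inverse_fourier G x * fourier_integral \<phi> x) = c * (LINT x|lborel. LINT \<xi>|lborel. Q (x, \<xi>))"
    by (simp only: 1 integral_mult_right_zero)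
  also have "(LINT x|lborel. LINT \<xi>|lborel. Q (x, \<xi>)) = (LINT \<xi>|lborel. LINT x|lborel. Q (x, \<xi>))"
    using lborel_pair.Fubini_integral[of "\<lambda>a b. Q (a, b)"] Q by simp
  also have "\<dots> = of_real ((2 * pi) ^ DIM('a)) * (LINT \<xi>|lborel. G \<xi> * \<phi> \<xi>)"
    by (simp only: 2 integral_mult_right_zero)
  finally show ?thesis unfolding mult.assoc[symmetric] c by simp
qed

text \<open>The truncations \<open>Gj j\<close> are integrable although \<open>G\<close> need not be, and their inverse transforms
  \<open>v j\<close> are given by integrals at every point. By Plancherel's inequality the increments of \<open>v\<close> have
  squared \<open>L\<^sup>2\<close> norms of order \<open>16\<^sup>-\<^sup>j\<close>, which beats the weights \<open>4\<^sup>j\<close> in \<open>suminf_square_le_weighted\<close>. Hence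
  the sum \<open>S\<close> of the increments is square integrable, \<open>v j\<close> converges almost everywhere, and all \<open>v j\<close>
  are dominated by a single tempered function \<open>D\<close>. Both sides of the identity for \<open>v j\<close> and \<open>Gj j\<close>
  then converge.\<close>

theorem is_fourier_lim_truncations:
  fixes G :: "'a::euclidean_space \<Rightarrow> complex" and \<kappa> :: "nat \<Rightarrow> real"
  defines "Gj \<equiv> \<lambda>j \<xi>. if norm \<xi> \<le> \<kappa> j then G \<xi> else 0"
  assumes G: "temperate G" and int: "\<And>j. integrable lborel (Gj j)"
    and \<kappa>: "\<And>j. real j \<le> \<kappa> j" "incseq \<kappa>"
    and tail: "\<And>j. (\<integral>\<^sup>+\<xi>. ennreal ((norm (G \<xi>))\<^sup>2) * indicator {\<xi>. norm \<xi> > \<kappa> j} \<xi> \<partial>lborel) \<le> ennreal ((1/16) ^ j)"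
  shows "is_fourier (\<lambda>x. lim_or_0 (\<lambda>j. inverse_fourier (Gj j) x)) G"
proof -
  note [measurable] = temperate_measurable[OF G]
  have [measurable]: "Gj j \<in> borel_measurable borel" for j unfolding Gj_def by measurable
  define v where "v j = inverse_fourier (Gj j)" for j
  have [measurable]: "v j \<in> borel_measurable borel" for j unfolding v_def by measurable
  define V where "V x = lim_or_0 (\<lambda>j. v j x)" for x
  have [measurable]: "V \<in> borel_measurable borel" unfolding V_def[abs_def] by measurable
  define S where "S x = (\<Sum>j. ennreal (norm (v (Suc j) x - v j x)))" for x
  have [measurable]: "S \<in> borel_measurable borel" unfolding S_def[abs_def] by measurable
  let ?c = "1 / (2 * pi) ^ DIM('a)"
  let ?E = "\<lambda>j. \<integral>\<^sup>+x. ennreal ((norm (v (Suc j) x - v j x))\<^sup>2) \<partial>lborel"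
  have diff: "?E j \<le> ennreal ?c * ennreal ((1/16) ^ j)" for j
  proof -
    have "?E j \<le> ennreal ?c * (\<integral>\<^sup>+\<xi>. ennreal ((norm (Gj (Suc j) \<xi> - Gj j \<xi>))\<^sup>2) \<partial>lborel)"
      unfolding v_def inverse_fourier_diff[OF int int]
      by (intro inverse_fourier_L2_bound Bochner_Integration.integrable_diff int)
    also have "\<dots> \<le> ennreal ?c * (\<integral>\<^sup>+\<xi>. ennreal ((norm (G \<xi>))\<^sup>2) * indicator {\<xi>. norm \<xi> > \<kappa> j} \<xi> \<partial>lborel)"
      using incseq_SucD[OF \<kappa>(2), of j]
      by (intro mult_left_mono nn_integral_mono) (auto simp: Gj_def indicator_def)
    also have "\<dots> \<le> ennreal ?c * ennreal ((1/16) ^ j)" by (intro mult_left_mono tail) simp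
    finally show ?thesis .
  qed
  have S2: "(\<integral>\<^sup>+x. (S x)\<^sup>2 \<partial>lborel) < \<infinity>"
  proof -
    have "(\<integral>\<^sup>+x. (S x)\<^sup>2 \<partial>lborel) \<le> (\<integral>\<^sup>+x. ennreal (4/3)
        * (\<Sum>j. ennreal (4 ^ j) * ennreal ((norm (v (Suc j) x - v j x))\<^sup>2)) \<partial>lborel)"
    proof (rule nn_integral_mono)
      fix x
      show "(S x)\<^sup>2 \<le> ennreal (4/3) * (\<Sum>j. ennreal (4 ^ j) * ennreal ((norm (v (Suc j) x - v j x))\<^sup>2))"
        using suminf_square_le_weighted[of "\<lambda>j. norm (v (Suc j) x - v j x)"]
        by (simp only: S_def abs_norm_cancel ennreal_mult' zero_le_power zero_le_numeral)
    qed
    also have "\<dots> = ennreal (4/3) * (\<Sum>j. ennreal (4 ^ j) * ?E j)"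
      by (simp add: nn_integral_cmult nn_integral_suminf)
    also have "\<dots> \<le> ennreal (4/3) * (\<Sum>j. ennreal ?c * ennreal ((1/4) ^ j))"
    proof (intro mult_left_mono suminf_le)
      fix j
      have "ennreal (4 ^ j) * ?E j \<le> ennreal (4 ^ j) * (ennreal ?c * ennreal ((1/16) ^ j))"
        by (intro mult_left_mono diff) simp
      also have "\<dots> = ennreal ?c * (ennreal (4 ^ j) * ennreal ((1/16) ^ j))" by (rule mult.left_commute)
      also have "ennreal (4 ^ j) * ennreal ((1/16) ^ j) = ennreal ((1/4) ^ j)"
        by (simp add: ennreal_mult[symmetric] power_mult_distrib[symmetric])
      finally show "ennreal (4 ^ j) * ?E j \<le> ennreal ?c * ennreal ((1/4) ^ j)" .
    qed auto
    also have "\<dots> = ennreal (4/3) * (ennreal ?c * ennreal (4/3))"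
      by (simp only: ennreal_suminf_cmult suminf_geometric_ennreal)
    also have "\<dots> < \<infinity>" by (simp add: ennreal_mult_less_top)
    finally show ?thesis .
  qed
  then have "AE x in lborel. (S x)\<^sup>2 \<noteq> \<infinity>"
    by (intro nn_integral_PInf_AE) auto
  then have Sfin: "AE x in lborel. S x < \<infinity>"
  proof eventually_elim
    case (elim x)
    then show ?case by (cases "S x") (auto simp: power2_eq_square ennreal_top_mult)
  qed
  have lim: "AE x in lborel. (\<lambda>j. v j x) \<longlonglongrightarrow> V x"
    using Sfin unfolding V_def S_def by eventually_elim (rule lim_or_0_of_summable_differences)
  define B where "B = ?c * (LINT \<xi>|lborel. norm (Gj 0 \<xi>))"
  have B: "B \<ge> 0" unfolding B_def by (intro mult_nonneg_nonneg integral_nonneg_AE) auto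
  \<comment> \<open>\<open>s \<le> 1 + s\<^sup>2\<close> replaces the square integrable function \<open>S\<close> by an integrable one.\<close>
  define D where "D x = complex_of_real (B + 1) + of_real ((enn2real (S x))\<^sup>2)" for x
  have D: "temperate D"
    unfolding D_def[abs_def]
  proof (rule temperate_add)
    show "temperate (\<lambda>x::'a. complex_of_real (B + 1))" by (rule temperate_const)
    have "integrable lborel (\<lambda>x. (enn2real (S x))\<^sup>2)"
    proof (rule integrableI_bounded)
      have "(\<integral>\<^sup>+x. ennreal (norm ((enn2real (S x))\<^sup>2)) \<partial>lborel) \<le> (\<integral>\<^sup>+x. (S x)\<^sup>2 \<partial>lborel)"
      proof (rule nn_integral_mono)
        fix x
        have "ennreal (norm ((enn2real (S x))\<^sup>2)) = (ennreal (enn2real (S x)))\<^sup>2"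
          by (simp add: ennreal_power)
        also have "\<dots> \<le> (S x)\<^sup>2" by (intro power_mono) (auto simp: ennreal_enn2real_if)
        finally show "ennreal (norm ((enn2real (S x))\<^sup>2)) \<le> (S x)\<^sup>2" .
      qed
      with S2 show "(\<integral>\<^sup>+x. ennreal (norm ((enn2real (S x))\<^sup>2)) \<partial>lborel) < \<infinity>" by (rule order.strict_trans1[rotated])
    qed measurable
    then show "temperate (\<lambda>x. complex_of_real ((enn2real (S x))\<^sup>2))"
      by (intro temperate_integrableI integrable_of_real)
  qed
  have vD: "AE x in lborel. \<forall>j. norm (v j x) \<le> norm (D x)"
    using Sfin
  proof eventually_elim
    case (elim x)
    have "norm (v j x) \<le> norm (D x)" for j
    proof -
      have "norm (v j x) \<le> norm (v 0 x) + enn2real (S x)"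
        using lim_or_0_of_summable_differences(2)[of "\<lambda>j. v j x" j] elim by (simp add: S_def)
      also have "norm (v 0 x) \<le> B" unfolding v_def B_def by (rule norm_inverse_fourier_le)
      also have "enn2real (S x) \<le> 1 + (enn2real (S x))\<^sup>2"
        using zero_le_power2[of "enn2real (S x) - 1/2"] by (simp add: power2_eq_square algebra_simps)
      also have "B + (1 + (enn2real (S x))\<^sup>2) = norm (D x)"
      proof -
        have "D x = complex_of_real (B + 1 + (enn2real (S x))\<^sup>2)" by (simp add: D_def)
        then show ?thesis using B by (simp only: norm_of_real) simp
      qed
      finally show ?thesis by simp
    qed
    then show ?case by blast
  qed
  have VD: "AE x in lborel. norm (V x) \<le> norm (D x)"
    using vD lim
  proof eventually_elim
    case (elim x)
    then show ?case by (intro LIMSEQ_le_const2[OF tendsto_norm[OF elim(2)]]) auto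
  qed
  have V: "temperate V" by (rule temperate_bound[OF D _ VD]) measurable
  moreover have "(LINT x|lborel. V x * fourier_integral \<phi> x) = (LINT \<xi>|lborel. G \<xi> * \<phi> \<xi>)" if \<phi>: "\<phi> \<in> schwartz" for \<phi>
  proof (rule LIMSEQ_unique)
    note [measurable] = rapid_measurable[OF rapid_schwartz[OF \<phi>]]
    show "(\<lambda>j. LINT x|lborel. v j x * fourier_integral \<phi> x) \<longlonglongrightarrow> (LINT x|lborel. V x * fourier_integral \<phi> x)"
    proof (rule integral_dominated_convergence)
      show "integrable lborel (\<lambda>x. norm (D x * fourier_integral \<phi> x))"
        by (intro integrable_norm integrable_temperate_mult D rapid_fourier \<phi>)
      show "AE x in lborel. norm (v j x * fourier_integral \<phi> x) \<le> norm (D x * fourier_integral \<phi> x)" for j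
        using vD by eventually_elim (auto simp: norm_mult intro: mult_right_mono)
      show "AE x in lborel. (\<lambda>j. v j x * fourier_integral \<phi> x) \<longlonglongrightarrow> V x * fourier_integral \<phi> x"
        using lim by eventually_elim (intro tendsto_intros)
    qed measurable
    have "(\<lambda>j. LINT \<xi>|lborel. Gj j \<xi> * \<phi> \<xi>) \<longlonglongrightarrow> (LINT \<xi>|lborel. G \<xi> * \<phi> \<xi>)"
    proof (rule integral_dominated_convergence)
      show "integrable lborel (\<lambda>x. norm (G x * \<phi> x))"
        by (intro integrable_norm integrable_temperate_mult G rapid_schwartz \<phi>)
      show "AE x in lborel. norm (Gj j x * \<phi> x) \<le> norm (G x * \<phi> x)" for j
        by (intro AE_I2) (simp add: Gj_def norm_mult)
      have "eventually (\<lambda>j. Gj j x * \<phi> x = G x * \<phi> x) sequentially" for x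
      proof -
        obtain k :: nat where "norm x \<le> real k" using real_arch_simple by blast
        then have "norm x \<le> \<kappa> j" if "j \<ge> k" for j using \<kappa>(1)[of j] that by (smt (verit) of_nat_mono)
        then show ?thesis by (intro eventually_sequentiallyI[of k]) (simp add: Gj_def)
      qed
      then show "AE x in lborel. (\<lambda>j. Gj j x * \<phi> x) \<longlonglongrightarrow> G x * \<phi> x"
        by (intro AE_I2 tendsto_eventually)
    qed measurable
    then show "(\<lambda>j. LINT x|lborel. v j x * fourier_integral \<phi> x) \<longlonglongrightarrow> (LINT \<xi>|lborel. G \<xi> * \<phi> \<xi>)"
      unfolding v_def by (simp only: inverse_fourier_pairing[OF int \<phi>])
  qed
  ultimately have "is_fourier V G" unfolding is_fourier_def using G by blast
  then show ?thesis by (simp only: V_def[abs_def] v_def)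
qed

section \<open>The wave evolution\<close>

lemma Lp_norm_le:
  assumes q: "q > 0" and B: "B \<ge> 0" and le: "(\<integral>\<^sup>+x. ennreal (norm (f x) powr q) \<partial>M) \<le> ennreal (B powr q)"
  shows "Lp_norm M q f \<le> ennreal B"
proof -
  let ?I = "\<integral>\<^sup>+x. ennreal (norm (f x) powr q) \<partial>M"
  have fin: "?I \<noteq> \<infinity>" using le by (metis ennreal_less_top infinity_ennreal_def leD)
  have "enn2real ?I \<le> B powr q"
    using enn2real_mono[OF le] by simp
  then have "enn2real ?I powr (1 / q) \<le> (B powr q) powr (1 / q)"
    using q by (intro powr_mono2) auto
  also have "\<dots> = B" using q B by (simp add: powr_powr)
  finally show ?thesis using fin by (simp add: Lp_norm_def ennreal_leI)
qed

lemma L2_integral_of_Lp_norm: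
  assumes "Lp_norm M 2 f < \<infinity>"
  obtains \<nu> where "\<nu> \<ge> 0" "Lp_norm M 2 f = ennreal \<nu>" "(\<integral>\<^sup>+x. ennreal ((norm (f x))\<^sup>2) \<partial>M) = ennreal (\<nu>\<^sup>2)"
proof -
  let ?I = "\<integral>\<^sup>+x. ennreal (norm (f x) powr 2) \<partial>M"
  have I: "?I = (\<integral>\<^sup>+x. ennreal ((norm (f x))\<^sup>2) \<partial>M)" by (simp add: powr_numeral)
  have fin: "?I \<noteq> \<infinity>" using assms by (auto simp: Lp_norm_def)
  define \<nu> where "\<nu> = enn2real ?I powr (1 / 2)"
  have "\<nu> \<ge> 0" by (simp add: \<nu>_def)
  moreover have "Lp_norm M 2 f = ennreal \<nu>"
    using fin by (simp add: Lp_norm_def \<nu>_def)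
  moreover have "ennreal (\<nu>\<^sup>2) = ?I"
    unfolding \<nu>_def using fin by (simp add: powr_half_sqrt less_top)
  then have "(\<integral>\<^sup>+x. ennreal ((norm (f x))\<^sup>2) \<partial>M) = ennreal (\<nu>\<^sup>2)" unfolding I by (rule sym)
  ultimately show thesis by (rule that)
qed

lemma integrable_low_frequencies:
  fixes F :: "'a::euclidean_space \<Rightarrow> complex"
  assumes [measurable]: "F \<in> borel_measurable borel" and b: "2 * b < real DIM('a)" and R: "R \<ge> 0"
    and fin: "weighted_energy b F < \<infinity>"
  shows "integrable lborel (\<lambda>x. if norm x \<le> R then F x else 0)"
proof (rule integrableI_bounded)
  let ?I = "\<integral>\<^sup>+x. ennreal (norm (if norm x \<le> R then F x else 0)) \<partial>lborel"
  have "?I\<^sup>2 < \<infinity>"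
    using low_frequency_L1_bound[OF assms(1) b R]
    by (rule le_less_trans) (use fin in \<open>simp add: ennreal_mult_less_top\<close>)
  then show "?I < \<infinity>" by (cases ?I) (auto simp: power2_eq_square ennreal_top_mult)
qed measurable

text \<open>The wave is the limit of the integrals over \<open>|\<xi>| \<le> \<kappa> j\<close>, with radii that do not depend on the
  time: the multiplier has modulus one, so the tails are the same for all \<open>t\<close>. At a fixed \<open>x\<close> each of
  these integrals is a \<open>time_profile\<close>, and its bound does not depend on \<open>j\<close>. As \<open>\<kappa> j \<ge> 1\<close> and
  \<open>b \<ge> 0\<close>, the tails of \<open>F\<close> are dominated by those of the square integrable function \<open>h\<close>.\<close>

lemma wave_solution:
  fixes f F h :: "'a::euclidean_space \<Rightarrow> complex" and q b C :: real
  assumes q: "q \<ge> 2" and b: "b = real DIM('a) / 2 - 1 / q" and C: "C > 0"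
    and time_bound: "\<forall>(H :: 'a \<Rightarrow> complex) A. integrable lborel H \<longrightarrow> A \<ge> 0 \<longrightarrow>
      weighted_energy b H \<le> ennreal (A\<^sup>2) \<longrightarrow>
      (\<integral>\<^sup>+t. ennreal (norm (time_profile H t) powr q) \<partial>lborel) \<le> ennreal ((C * A) powr q)"
    and fF: "is_fourier f F" and h[measurable]: "h \<in> borel_measurable borel"
    and F: "\<And>x. F x = of_real (norm x powr (- b)) * h x"
    and A0: "energy h \<le> ennreal (A\<^sup>2)" "A \<ge> 0"
  shows "\<exists>u. is_wave f u \<and> (\<forall>x. (\<integral>\<^sup>+t. ennreal (norm (u t x) powr q) \<partial>lborel) \<le> ennreal ((C
      * (A / (2 * pi) ^ DIM('a))) powr q))"
proof -
  have n: "real DIM('a) \<ge> 1" by (simp add: Suc_le_eq DIM_positive)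
  have "1 / q \<le> 1 / 2" using q by (intro divide_left_mono) auto
  with n have b0: "b \<ge> 0" unfolding b by linarith
  have b1: "2 * b < real DIM('a)" using q by (simp add: b)
  note tF = is_fourier_temperate(2)[OF fF]
  note [measurable] = temperate_measurable[OF tF]
  have Fh: "(norm (F x))\<^sup>2 * norm x powr (2 * b) \<le> (norm (h x))\<^sup>2" for x
  proof (cases "x = 0")
    case False
    have "norm x powr (- b) * norm x powr (- b) * norm x powr (2 * b) = 1"
      using False by (simp add: powr_add[symmetric])
    then show ?thesis by (simp add: F norm_mult power_mult_distrib power2_eq_square mult_ac)
  qed simp
  have wF: "weighted_energy b F \<le> ennreal (A\<^sup>2)"
    by (rule order_trans[OF nn_integral_mono A0(1)]) (rule ennreal_leI[OF Fh])
  have ih: "integrable lborel (\<lambda>x. (norm (h x))\<^sup>2)"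
  proof (rule integrableI_bounded)
    show "(\<integral>\<^sup>+x. ennreal (norm ((norm (h x))\<^sup>2)) \<partial>lborel) < \<infinity>"
      using le_less_trans[OF A0(1) ennreal_less_top] by simp
  qed measurable
  obtain \<kappa> :: "nat \<Rightarrow> real" where \<kappa>: "\<And>j. real j + 1 \<le> \<kappa> j" "incseq \<kappa>"
    and tail: "\<And>j. (\<integral>\<^sup>+x. ennreal ((norm (h x))\<^sup>2) * indicator {x. norm x > \<kappa> j} x \<partial>lborel) \<le> ennreal ((1/16) ^ j)"
    using exists_frequency_cutoffs[OF ih, of "\<lambda>j. (1/16) ^ j"] by auto
  define Fj where "Fj j x = (if norm x \<le> \<kappa> j then F x else 0)" for j x
  have [measurable]: "Fj j \<in> borel_measurable borel" for j unfolding Fj_def by measurable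
  have iFj: "integrable lborel (Fj j)" for j
    unfolding Fj_def
  proof (rule integrable_low_frequencies[OF _ b1])
    show "\<kappa> j \<ge> 0" using \<kappa>(1)[of j] by linarith
    show "weighted_energy b F < \<infinity>"
      using le_less_trans[OF wF ennreal_less_top] by simp
  qed measurable
  define G where "G t x = cis (t * norm x) * F x" for t and x :: 'a
  define v where "v j t x = inverse_fourier (\<lambda>\<xi>. cis (t * norm \<xi>) * Fj j \<xi>) x" for j t x
  have [measurable]: "(\<lambda>(t, x). v j t x) \<in> borel_measurable (borel \<Otimes>\<^sub>M borel)" for j
    unfolding v_def inverse_fourier_def by measurable
  define u where "u t x = lim_or_0 (\<lambda>j. v j t x)" for t x
  have u_meas: "(\<lambda>(t, x). u t x) \<in> borel_measurable (lborel \<Otimes>\<^sub>M lborel)"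
    unfolding u_def by measurable
  have fourier_u: "is_fourier (u t) (G t)" for t
  proof -
    have nG: "norm (G t x) = norm (F x)" for x by (simp add: G_def norm_mult)
    have tG: "temperate (G t)"
    proof (rule temperate_bound[OF tF])
      show "G t \<in> borel_measurable borel" unfolding G_def[abs_def] by measurable
    qed (simp add: nG)
    have eq: "(\<lambda>x. if norm x \<le> \<kappa> j then G t x else 0) = (\<lambda>\<xi>. cis (t * norm \<xi>) * Fj j \<xi>)" for j
      by (auto simp: G_def Fj_def)
    have "is_fourier (\<lambda>x. lim_or_0 (\<lambda>j. inverse_fourier (\<lambda>\<xi>. if norm \<xi> \<le> \<kappa> j then G t \<xi> else 0) x)) (G t)"
    proof (rule is_fourier_lim_truncations[OF tG _ _ \<kappa>(2)])
      show "integrable lborel (\<lambda>\<xi>. if norm \<xi> \<le> \<kappa> j then G t \<xi> else 0)" for j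
        unfolding eq by (rule integrable_cis_mult[OF iFj]) measurable
      show "real j \<le> \<kappa> j" for j using \<kappa>(1)[of j] by simp
      show "(\<integral>\<^sup>+\<xi>. ennreal ((norm (G t \<xi>))\<^sup>2) * indicator {\<xi>. norm \<xi> > \<kappa> j} \<xi> \<partial>lborel) \<le> ennreal ((1/16) ^ j)" for j
      proof (rule order_trans[OF nn_integral_mono tail])
        fix x :: 'a
        show "ennreal ((norm (G t x))\<^sup>2) * indicator {x. norm x > \<kappa> j} x
            \<le> ennreal ((norm (h x))\<^sup>2) * indicator {x. norm x > \<kappa> j} x"
        proof (cases "norm x > \<kappa> j")
          case True
          then have "norm x \<ge> 1" using \<kappa>(1)[of j] by linarith
          then have "norm x powr (- b) \<le> norm x powr 0" using b0 by (intro powr_mono) auto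
          also have "norm x powr 0 = 1" using \<open>norm x \<ge> 1\<close> by auto
          finally have "norm x powr (- b) \<le> 1" .
          then have "norm x powr (- b) * norm (h x) \<le> 1 * norm (h x)"
            using \<open>norm x \<ge> 1\<close> by (intro mult_right_mono) auto
          then have "norm (G t x) \<le> norm (h x)" by (simp add: nG F norm_mult)
          then show ?thesis using True by (simp add: ennreal_leI power_mono)
        qed simp
      qed
    qed
    then show ?thesis by (simp only: eq u_def[abs_def] v_def)
  qed
  have "is_wave f u"
    unfolding is_wave_def is_mult_def
  proof (intro conjI allI exI[of _ F] u_meas fF)
    fix t
    have "(\<lambda>\<xi>. exp (\<i> * complex_of_real (t * norm \<xi>)) * F \<xi>) = G t"
      by (auto simp: G_def cis_conv_exp)
    then show "is_fourier (u t) (\<lambda>\<xi>. exp (\<i> * complex_of_real (t * norm \<xi>)) * F \<xi>)"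
      using fourier_u[of t] by (simp only:)
  qed
  moreover have "(\<integral>\<^sup>+t. ennreal (norm (u t x) powr q) \<partial>lborel) \<le> ennreal ((C * (A / (2 * pi) ^ DIM('a))) powr q)" for x
  proof (rule nn_integral_fatou_bound[where f="\<lambda>j t. ennreal (norm (v j t x) powr q)"])
    show "(\<lambda>t. ennreal (norm (v j t x) powr q)) \<in> borel_measurable lborel" for j by measurable
    show "AE t in lborel. ennreal (norm (u t x) powr q) \<le> liminf (\<lambda>j. ennreal (norm (v j t x) powr q))"
      unfolding u_def using q by (intro AE_I2 lim_or_0_le_liminf) simp
    fix j
    define c where "c = 1 / (2 * pi) ^ DIM('a)"
    have c: "c > 0" by (simp add: c_def)
    \<comment> \<open>The normalisation and the phase at \<open>x\<close> are absorbed into the amplitude.\<close>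
    define H where "H \<xi> = of_real c * (cis (x \<bullet> \<xi>) * Fj j \<xi>)" for \<xi>
    have H: "integrable lborel H"
      unfolding H_def[abs_def] by (intro integrable_mult_right integrable_cis_mult iFj) measurable
    have vH: "v j t x = (time_profile H t)" for t
    proof -
      have "v j t x = of_real c * (LINT \<xi>|lborel. cis (x \<bullet> \<xi>) * (cis (t * norm \<xi>) * Fj j \<xi>))"
        by (simp only: v_def inverse_fourier_def c_def)
      also have "\<dots> = (LINT \<xi>|lborel. of_real c * (cis (x \<bullet> \<xi>) * (cis (t * norm \<xi>) * Fj j \<xi>)))"
        by (rule integral_mult_right_zero[symmetric])
      finally show ?thesis by (simp only: H_def mult.left_commute)
    qed
    have "weighted_energy b H \<le> (\<integral>\<^sup>+\<xi>. ennreal (c\<^sup>2) * ennreal ((norm (F \<xi>))\<^sup>2 * norm \<xi> powr (2 * b)) \<partial>lborel)"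
    proof (rule nn_integral_mono)
      fix \<xi>
      have "norm (H \<xi>) \<le> c * norm (F \<xi>)" using c by (simp add: H_def Fj_def norm_mult)
      then have "(norm (H \<xi>))\<^sup>2 \<le> (c * norm (F \<xi>))\<^sup>2" by (intro power_mono) auto
      then have "(norm (H \<xi>))\<^sup>2 * norm \<xi> powr (2 * b) \<le> (c * norm (F \<xi>))\<^sup>2 * norm \<xi> powr (2 * b)"
        by (rule mult_right_mono) simp
      then have "ennreal ((norm (H \<xi>))\<^sup>2 * norm \<xi> powr (2 * b)) \<le> ennreal (c\<^sup>2 * ((norm (F \<xi>))\<^sup>2 * norm \<xi> powr (2 * b)))"
        by (intro ennreal_leI) (simp only: power_mult_distrib mult.assoc)
      then show "ennreal ((norm (H \<xi>))\<^sup>2 * norm \<xi> powr (2 * b))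
          \<le> ennreal (c\<^sup>2) * ennreal ((norm (F \<xi>))\<^sup>2 * norm \<xi> powr (2 * b))"
        by (simp only: ennreal_mult' zero_le_power2)
    qed
    also have "\<dots> = ennreal (c\<^sup>2) * weighted_energy b F"
      by (rule nn_integral_cmult) measurable
    also have "\<dots> \<le> ennreal (c\<^sup>2) * ennreal (A\<^sup>2)" by (rule mult_left_mono[OF wF]) simp
    also have "\<dots> = ennreal ((A * c)\<^sup>2)"
      by (simp only: ennreal_mult'[symmetric] zero_le_power2 power_mult_distrib mult.commute)
    finally have "weighted_energy b H \<le> ennreal ((A * c)\<^sup>2)" .
    from time_bound[rule_format, OF H _ this]
    have "(\<integral>\<^sup>+t. ennreal (norm (time_profile H t) powr q) \<partial>lborel) \<le> ennreal ((C * (A * c)) powr q)"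
      using A0(2) c by simp
    then show "(\<integral>\<^sup>+t. ennreal (norm (v j t x) powr q) \<partial>lborel) \<le> ennreal ((C * (A / (2 * pi) ^ DIM('a))) powr q)"
      unfolding vH by (simp add: c_def)
  qed
  ultimately show ?thesis by blast
qed

text \<open>For each time the two representatives have the same Fourier transform. Joint measurability allows
  exchanging the order of the two quantifiers over almost all points.\<close>

lemma is_wave_unique:
  fixes f :: "'a::euclidean_space \<Rightarrow> complex"
  assumes u: "is_wave f u" and w: "is_wave f w"
  shows "AE x in lborel. AE t in lborel. u t x = w t x"
proof -
  have AE_t: "AE x in lborel. u t x = w t x" for t
  proof -
    let ?p = "\<lambda>\<xi>::'a. exp (\<i> * complex_of_real (t * norm \<xi>))"
    have "is_mult (\<lambda>r. exp (\<i> * complex_of_real (t * r))) f (u t)" "is_mult (\<lambda>r. exp (\<i> * complex_of_real (t * r))) f (w t)"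
      using u w unfolding is_wave_def by blast+
    then obtain h1 h2 where 1: "is_fourier f h1" "is_fourier (u t) (\<lambda>\<xi>. ?p \<xi> * h1 \<xi>)"
      and 2: "is_fourier f h2" "is_fourier (w t) (\<lambda>\<xi>. ?p \<xi> * h2 \<xi>)"
      unfolding is_mult_def by blast
    have "AE \<xi> in lborel. ?p \<xi> * h1 \<xi> = ?p \<xi> * h2 \<xi>"
      using is_fourier_unique[OF 1(1) 2(1)] by eventually_elim simp
    with temperate_measurable[OF is_fourier_temperate(2)[OF 2(2)]]
    have "is_fourier (u t) (\<lambda>\<xi>. ?p \<xi> * h2 \<xi>)" by (rule is_fourier_cong[OF 1(2)])
    then show ?thesis by (rule is_fourier_inj) (rule 2(2))
  qed
  have [measurable]: "(\<lambda>(t, x). u t x) \<in> borel_measurable (lborel \<Otimes>\<^sub>M lborel)" "(\<lambda>(t, x). w t x) \<in> borel_measurable (lborel \<Otimes>\<^sub>M lborel)"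
    using u w unfolding is_wave_def by blast+
  have "{z \<in> space (lborel \<Otimes>\<^sub>M lborel). u (fst z) (snd z) = w (fst z) (snd z)} \<in> sets (lborel \<Otimes>\<^sub>M lborel)"
    by measurable
  then have "(AE t in lborel. AE x in lborel. u t x = w t x) \<longleftrightarrow> (AE x in lborel. AE t in lborel. u t x = w t x)"
    by (rule lborel_pair.AE_commute)
  with AE_t show ?thesis by simp
qed

lemma LinfLq_norm_le:
  fixes u w :: "real \<Rightarrow> 'a::euclidean_space \<Rightarrow> complex"
  assumes u: "(\<lambda>(t, x). u t x) \<in> borel_measurable (lborel \<Otimes>\<^sub>M lborel)"
    and eq: "AE x in lborel. AE t in lborel. u t x = w t x"
    and bound: "\<And>x. Lp_norm lborel q (\<lambda>t. w t x) \<le> B"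
  shows "LinfLq_norm q u \<le> B"
proof -
  have swap[measurable]: "(\<lambda>(x, t). u t x) \<in> borel_measurable (lborel \<Otimes>\<^sub>M lborel)"
    using measurable_compose[OF measurable_pair_swap'[of lborel lborel] u] by (simp add: case_prod_beta')
  have "(\<lambda>x. Lp_norm lborel q (\<lambda>t. u t x)) \<in> borel_measurable lborel"
    unfolding Lp_norm_def Let_def by measurable
  moreover have "AE x in lborel. Lp_norm lborel q (\<lambda>t. u t x) \<le> B"
    using eq
  proof eventually_elim
    case (elim x)
    have "(\<integral>\<^sup>+t. ennreal (norm (u t x) powr q) \<partial>lborel) = (\<integral>\<^sup>+t. ennreal (norm (w t x) powr q) \<partial>lborel)"
    proof (intro nn_integral_cong_AE)
      show "AE t in lborel. ennreal (norm (u t x) powr q) = ennreal (norm (w t x) powr q)"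
        using elim by eventually_elim simp
    qed
    then have "Lp_norm lborel q (\<lambda>t. u t x) = Lp_norm lborel q (\<lambda>t. w t x)"
      by (simp add: Lp_norm_def)
    with bound[of x] show ?case by simp
  qed
  ultimately show ?thesis unfolding LinfLq_norm_def by (rule esssup_I)
qed

text \<open>The norm of \<open>f\<close> is defined through a chosen representative \<open>g'\<close> of \<open>D\<^sup>b f\<close>. Its transform agrees
  almost everywhere with the transform \<open>h\<close> of the function \<open>g\<close> from which \<open>f\<close> arises as \<open>D\<^sup>-\<^sup>b g\<close>, so
  the \<open>L\<^sup>2\<close> norm of \<open>g'\<close> bounds that of \<open>h\<close> up to a constant.\<close>

theorem wave_estimate:
  fixes q b :: real
  assumes q: "2 \<le> q" and b: "b = real DIM('a::euclidean_space) / 2 - 1 / q"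
  shows "\<exists>C\<ge>0. \<forall>f :: 'a \<Rightarrow> complex. f \<in> Hdot b \<longrightarrow>
    (\<exists>u. is_wave f u) \<and> (\<forall>u. is_wave f u \<longrightarrow> LinfLq_norm q u \<le> ennreal C * Hdot_norm b f)"
proof -
  let ?P = "(2 * pi) ^ DIM('a)"
  obtain C where C: "C > 0" and time_bound: "\<forall>(H :: 'a \<Rightarrow> complex) A. integrable lborel H \<longrightarrow> A \<ge> 0 \<longrightarrow>
      weighted_energy b H \<le> ennreal (A\<^sup>2) \<longrightarrow>
      (\<integral>\<^sup>+t. ennreal (norm (time_profile H t) powr q) \<partial>lborel) \<le> ennreal ((C * A) powr q)"
    using time_norm_bound[OF q b] by blast
  define K where "K = C * sqrt ?P / ?P"
  have K: "K > 0" using C by (simp add: K_def)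
  show ?thesis
  proof (intro exI[of _ K] conjI allI impI)
    show "K \<ge> 0" using K by simp
    fix f :: "'a \<Rightarrow> complex" assume "f \<in> Hdot b"
    then obtain g h where g: "g \<in> L2_space" and gh: "is_fourier g h"
      and fF: "is_fourier f (\<lambda>\<xi>. of_real (norm \<xi> powr (- b)) * h \<xi>)"
      unfolding Hdot_def is_mult_def by blast
    let ?F = "\<lambda>\<xi>. of_real (norm \<xi> powr (- b)) * h \<xi>"
    note [measurable] = temperate_measurable[OF is_fourier_temperate(2)[OF gh]]
    note solution = wave_solution[OF q b C time_bound fF _ refl]
    have "Lp_norm lborel 2 g < \<infinity>" using g by (simp add: L2_space_def)
    then obtain \<nu> where \<nu>: "\<nu> \<ge> 0" "energy g = ennreal (\<nu>\<^sup>2)"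
      by (rule L2_integral_of_Lp_norm)
    have "energy h \<le> ennreal ((sqrt ?P * \<nu>)\<^sup>2)"
      by (rule is_fourier_L2_bound[OF gh]) (simp add: \<nu>)
    from solution[OF _ this] \<nu>(1) show "\<exists>u. is_wave f u" by force
    fix u assume u: "is_wave f u"
    define g' where "g' = mult (\<lambda>r. of_real (r powr b)) f"
    \<comment> \<open>At the origin the two powers do not cancel, because \<open>0 powr s = 0\<close>.\<close>
    have inv: "of_real (norm \<xi> powr b) * ?F \<xi> = h \<xi>" if "\<xi> \<noteq> 0" for \<xi>
      using that by (simp add: mult.assoc[symmetric] powr_add[symmetric] flip: of_real_mult)
    have "AE \<xi> in lborel. h \<xi> = of_real (norm \<xi> powr b) * ?F \<xi>"
      using AE_lborel_singleton[of "0::'a"] by eventually_elim (rule inv[symmetric])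
    then have "is_fourier g (\<lambda>\<xi>. of_real (norm \<xi> powr b) * ?F \<xi>)"
      by (intro is_fourier_cong[OF gh]) measurable
    with fF have "is_mult (\<lambda>r. of_real (r powr b)) f g" unfolding is_mult_def by blast
    then have "is_mult (\<lambda>r. of_real (r powr b)) f g'"
      unfolding g'_def mult_def by (rule someI[of "is_mult (\<lambda>r. of_real (r powr b)) f"])
    then obtain h' where h': "is_fourier f h'" "is_fourier g' (\<lambda>\<xi>. of_real (norm \<xi> powr b) * h' \<xi>)"
      unfolding is_mult_def by blast
    have "AE \<xi> in lborel. of_real (norm \<xi> powr b) * h' \<xi> = h \<xi>"
      using is_fourier_unique[OF h'(1) fF] AE_lborel_singleton[of "0::'a"]
    proof eventually_elim
      case (elim \<xi>)
      then show ?case using inv[of \<xi>] by simp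
    qed
    then have g'h: "is_fourier g' h" by (intro is_fourier_cong[OF h'(2)]) measurable
    show "LinfLq_norm q u \<le> ennreal K * Hdot_norm b f"
    proof (cases "Lp_norm lborel 2 g' < \<infinity>")
      case False
      then have "Hdot_norm b f = \<infinity>" by (simp add: Hdot_norm_def g'_def not_less top_unique)
      then show ?thesis using K by (simp add: ennreal_mult_top)
    next
      case True
      then obtain \<mu> where \<mu>: "\<mu> \<ge> 0" "Lp_norm lborel 2 g' = ennreal \<mu>" "energy g' = ennreal (\<mu>\<^sup>2)"
        by (rule L2_integral_of_Lp_norm)
      have "energy h \<le> ennreal ((sqrt ?P * \<mu>)\<^sup>2)"
        by (rule is_fourier_L2_bound[OF g'h]) (simp add: \<mu>)
      from solution[OF _ this] \<mu>(1) obtain w where w: "is_wave f w"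
        and wq: "\<And>x. (\<integral>\<^sup>+t. ennreal (norm (w t x) powr q) \<partial>lborel) \<le> ennreal ((C * (sqrt ?P * \<mu> / ?P)) powr q)"
        by auto
      have eq: "C * (sqrt ?P * \<mu> / ?P) = K * \<mu>" by (simp add: K_def)
      have "LinfLq_norm q u \<le> ennreal (K * \<mu>)"
      proof (rule LinfLq_norm_le)
        show "(\<lambda>(t, x). u t x) \<in> borel_measurable (lborel \<Otimes>\<^sub>M lborel)" using u by (simp add: is_wave_def)
        show "AE x in lborel. AE t in lborel. u t x = w t x" by (rule is_wave_unique[OF u w])
        show "Lp_norm lborel q (\<lambda>t. w t x) \<le> ennreal (K * \<mu>)" for x
          using q K \<mu>(1) wq[of x] unfolding eq by (intro Lp_norm_le) auto
      qed
      also have "\<dots> = ennreal K * Hdot_norm b f"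
        using K \<mu> by (simp add: Hdot_norm_def g'_def[symmetric] ennreal_mult)
      finally show ?thesis .
    qed
  qed
qed

theorem proposition4:
  fixes q b :: real
  assumes "2 \<le> q"
    and "b = real CARD('n::finite) / 2 - 1 / q"
  shows "\<exists>C::real. C \<ge> 0 \<and> (\<forall>f :: real ^ 'n \<Rightarrow> complex. f \<in> Hdot b \<longrightarrow>
           (\<exists>u. is_wave f u) \<and>
           (\<forall>u. is_wave f u \<longrightarrow> LinfLq_norm q u \<le> ennreal C * Hdot_norm b f))"
proof -
  have "b = real DIM(real ^ 'n) / 2 - 1 / q" using assms(2) by simp
  from wave_estimate[OF assms(1) this] show ?thesis .
qed

end
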